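(* Let $\lambda=\Lambda_0$. In each of the types $E_6^{(2)}$ and $F_4^{(1)}$, the maps $\tilde E_i,\tilde F_i:\mathcal Y(\lambda)\to\mathcal Y(\lambda)\cup\{0\}$, $\varepsilon_i,\varphi_i:\mathcal Y(\lambda)\to\mathbb Z$ $(i\in I)$ and $\mathrm{wt}:\mathcal Y(\lambda)\to P$ (defined by the signature rule, the numbers of $-$'s and $+$'s in the $i$-signature, and $\mathrm{wt}(Y)=\lambda-\sum_{i\in I}k_i\alpha_i$) endow the set $\mathcal Y(\lambda)$ of reduced Young walls with the structure of an affine crystal.
   Context: **Cartan data.** $I=\{0,1,2,3,4\}$, $a_{ij}=\langle h_i,\alpha_j\rangle$, $a_{ii}=2$; the nonzero off-diagonal entries are: for $E_6^{(2)}$, $a_{01}=a_{10}=a_{12}=a_{21}=-1$, $a_{23}=-2$, $a_{32}=-1$, $a_{34}=a_{43}=-1$; for $F_4^{(1)}$, $a_{01}=a_{10}=a_{12}=a_{21}=-1$, $a_{23}=-1$, $a_{32}=-2$, $a_{34}=a_{43}=-1$. $P$ is the affine weight lattice. **Affine crystal.** A set $\mathcal B$ with maps $\mathrm{wt}:\mathcal B\to P$, $\tilde e_i,\tilde f_i:\mathcal B\to\mathcal B\cup\{0\}$, $\varepsilon_i,\varphi_i:\mathcal B\to\mathbb Z\cup\{-\infty\}$ such that: $\varphi_i(b)=\varepsilon_i(b)+\langle h_i,\mathrm{wt}(b)\rangle$; if $\tilde e_ib\in\mathcal B$ then $\mathrm{wt}(\tilde e_ib)=\mathrm{wt}(b)+\alpha_i$,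 $\varepsilon_i(\tilde e_ib)=\varepsilon_i(b)-1$, $\varphi_i(\tilde e_ib)=\varphi_i(b)+1$; if $\tilde f_ib\in\mathcal B$ then $\mathrm{wt}(\tilde f_ib)=\mathrm{wt}(b)-\alpha_i$, $\varepsilon_i(\tilde f_ib)=\varepsilon_i(b)+1$, $\varphi_i(\tilde f_ib)=\varphi_i(b)-1$; $\tilde f_ib=b'$ iff $b=\tilde e_ib'$; and $\varphi_i(b)=-\infty$ implies $\tilde e_ib=\tilde f_ib=0$. **Young column patterns.** A pattern is an infinite vertical stack of colored blocks arranged in rows indexed by $\mathbb Z$ from bottom to top. It is invariant under the shift by four rows combined with the $180^\circ$ rotation around the vertical axis; this symmetry $\sigma$ sends a block with index $m$ to the block with the same letter and index $m+1$. "$x$ on $y$" means block $x$ rests on block $y$ (so $y$ must be present for there to be no empty space below $x$); $i$-block means a block of color $i$. *Type $E_6^{(2)}$*, for every $m\in\mathbb Z$: row $4m$: $c_m$ (color 3), $a_m$ (color 1); row $4m+1$: $b_m,b'_m$ (color 2); row $4m+2$: $a'_m$ (color 1), $c'_m$ (color 3); row $4m+3$: $z_m$ (color 0), $b''_m$ (color 2), $d_m$ (color 4). Support: $b_m$ on $c_m$; $b'_m$ on $c_m,a_m$; $a'_m$ on $b_m$; $c'_m$ on $b_m,b'_m$; $z_m$ on $a'_m$; $b''_m$ on $a'_m,c'_m$; $d_m$ on $c'_m$; $a_{m+1}$ on $z_m,b''_m$; $c_{m+1}$ on $b''_m,d_m$. *Type $F_4^{(1)}$*, for every $m\in\mathbb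 Z$: row $4m$: $c^1_m$ (color 3), $d^1_m$ (color 4), $a^1_m$ (color 1); row $4m+1$: $c^2_m$ (color 3), $b^1_m$ (color 2); row $4m+2$: $b^2_m$ (color 2), $c^3_m$ (color 3); row $4m+3$ (a double-height row): $a^2_m$ (color 1), $c^4_m$ (color 3), $d^2_m$ (color 4), $z_m$ (color 0), $b^3_m$ (color 2). Support: $c^2_m$ on $c^1_m,d^1_m$; $b^1_m$ on $c^1_m,a^1_m$; $b^2_m$ on $c^2_m$; $c^3_m$ on $b^1_m$; $a^2_m$ on $b^2_m$; $c^4_m$ on $b^2_m,c^3_m$; $d^2_m$ on $c^3_m$; $z_m$ on $a^2_m$; $b^3_m$ on $a^2_m,c^4_m$; $c^1_{m+1}$ on $b^3_m,c^4_m,d^2_m$; $d^1_{m+1}$ on $c^4_m,d^2_m$; $a^1_{m+1}$ on $z_m,b^3_m$. **Young columns.** A pre-Young column is a nonempty set of blocks of the pattern whose height is bounded above and which contains, with any block, all blocks it rests on. A block of it is free if removing it leaves a pre-Young column. A pre-Young column is exceptional if its highest nonempty row contains precisely one free $2$-block and the column contains a free $1$-block (up to $\sigma$ the only one is: all blocks of index $\le0$ together with $a_1,c_1,b_1$ in type $E_6^{(2)}$, and with $c^1_1,d^1_1,a^1_1,c^2_1,b^2_1$ in type $F_4^{(1)}$). A Young column is a non-exceptional pre-Young column. Two Young columns are equivalent if they are related by vertical shift and $180^\circ$ rotation, i.e. by a power of $\sigma$. Let $C$ (resp. $C'$) be the set of equivalence classes in type $E_6^{(2)}$ (resp. $F_4^{(1)}$).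 Some classes have names. *Type $E_6^{(2)}$:* let $D$ be the set of all blocks of index $\le-1$ and $c_0,a_0,b_0,b'_0,a'_0,c'_0,b''_0$; $y_\emptyset$ is the class of $D\cup\{d_0,c_1,b_1,a'_1,z_1\}$, $y_{r_1}$ of $D\cup\{z_0,d_0,c_1,b_1,a'_1\}$, $y_{r_2}$ of $D\cup\{z_0,a_1,b'_1,d_0,c_1\}$. *Type $F_4^{(1)}$:* let $D$ be the set of all blocks of index $\le-1$ and all blocks of index $0$ except $z_0,d^2_0$; $y_\emptyset$ is the class of $D\cup\{d^2_0,c^1_1,d^1_1,c^2_1,b^2_1,a^2_1,z_1\}$, $y_{r_1}$ of $D\cup\{z_0,d^2_0,c^1_1,d^1_1,c^2_1,b^2_1,a^2_1\}$, $y_{r_2}$ of $D\cup\{z_0,a^1_1,b^1_1,d^2_0,c^1_1,d^1_1,c^2_1\}$, $y_{r_3}$ of $D\cup\{z_0,a^1_1,b^1_1,c^3_1,d^2_0,c^1_1,d^1_1\}$, $y_{r_4}$ of $D\cup\{z_0,a^1_1,b^1_1,c^3_1,d^2_1,d^2_0,c^1_1\}$. **Crystal operators on Young columns.** An $i$-block in a Young column $y$ is removable if removing it gives a Young column; an $i$-block of the pattern not in $y$ is addable if adding it gives a Young column. $\tilde f_i$ adds an addable $i$-block if one exists (the higher one if there are two), else gives $0$; moreover $\tilde f_i(y)=0$ if $y\in y_{r_j}$, $j\ne i$. $\tilde e_i$ removes a removable $i$-block if one exists (the lower one if there are two), else gives $0$; moreover $\tilde e_i(y)=0$ if $y\in y_{r_j}$,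 $j\neq i$. $\varphi_i(y)=\max\{n:\tilde f_i^ny\ne0\}$, $\varepsilon_i(y)=\max\{n:\tilde e_i^ny\neq0\}$. These descend to $C$ and $C'$, making them classical crystals isomorphic to level $1$ perfect crystals. **Energy function.** On tensor products, $\tilde f_i(a\otimes b)=\tilde f_ia\otimes b$ if $\varphi_i(a)>\varepsilon_i(b)$ and $a\otimes\tilde f_ib$ if $\varphi_i(a)\le\varepsilon_i(b)$; $\tilde e_i(a\otimes b)=\tilde e_ia\otimes b$ if $\varphi_i(a)\ge\varepsilon_i(b)$ and $a\otimes\tilde e_ib$ otherwise. $H:C\otimes C\to\mathbb Z$ (resp. $H':C'\otimes C'\to\mathbb Z$) is the unique function with value $0$ at $y_\emptyset\otimes y_\emptyset$ such that, whenever $\tilde f_i(a\otimes b)\neq0$, $H(\tilde f_i(a\otimes b))-H(a\otimes b)$ equals $0$ if $i\ne0$, $-1$ if $i=0$ and $\varphi_0(a)>\varepsilon_0(b)$, and $+1$ if $i=0$ and $\varphi_0(a)\le\varepsilon_0(b)$ (and likewise for $H'$). **Young walls.** The Young wall pattern consists of copies of the Young column pattern, all at the same height and orientation, placed in columns $k=0,1,2,\dots$ from right to left. Fix a Young column $g\in y_\emptyset$ (the ground-state column); the ground-state wall $Y_\lambda$ has $g$ in every column. A Young wall $Y=(\dots,y_2,y_1,y_0)$ is a set of blocks in the Young wall pattern differing from $Y_\lambda$ in finitely many blocks and such that each column $y_k$ is a Young column. $|y_k|_0$ is the number of $0$-blocks in $y_k\setminus g$ minus that in $g\setminus y_k$.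 A Young wall is reduced if for all $k\ge0$ one has $H(y_{k+1}\otimes y_k)+|y_{k+1}|_0-|y_k|_0=0$ (with $H'$ in place of $H$ in type $F_4^{(1)}$; classes of columns are inserted in $H,H'$). $\mathcal Y(\lambda)$ is the set of reduced Young walls. **Structure maps.** The $i$-signature of a Young column $y$ is $\varepsilon_i(y)$ copies of $-$ followed by $\varphi_i(y)$ copies of $+$. For a Young wall $Y$, concatenate $\cdots\mathrm{sign}_i(y_2)\,\mathrm{sign}_i(y_1)\,\mathrm{sign}_i(y_0)$ and cancel successively every $+-$ pair; the result (finitely many $-$'s followed by finitely many $+$'s) is $\mathrm{sign}_i(Y)$. $\tilde E_iY$ applies $\tilde e_i$ to the column containing the rightmost $-$ of $\mathrm{sign}_i(Y)$ ($0$ if there is none); $\tilde F_iY$ applies $\tilde f_i$ to the column containing the leftmost $+$ ($0$ if there is none). $\varepsilon_i(Y)$ and $\varphi_i(Y)$ are the numbers of $-$'s and $+$'s in $\mathrm{sign}_i(Y)$. $\mathrm{wt}(Y)=\lambda-\sum_ik_i\alpha_i$, where $k_i$ is the number of $i$-blocks of $Y$ that have been added to the ground-state wall. *)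

theory Defs
  imports "HOL-Library.FuncSet" "HOL-Library.Function_Algebras" "HOL-Library.Product_Plus"
begin

section \<open>Weights and affine crystals\<close>

datatype idx = I0 | I1 | I2 | I3 | I4

lemma UNIV_idx: "(UNIV :: idx set) = {I0, I1, I2, I3, I4}"
  by (auto intro: idx.exhaust)

instance idx :: finite
  by standard (simp add: UNIV_idx)

text \<open>
  The affine weight lattice \<open>P = \<Oplus>\<^sub>i \<int>\<Lambda>\<^sub>i \<oplus> \<int>\<delta>\<close>: the pair \<open>(c, n)\<close> stands for
  \<open>(\<Sum>i. c i \<Lambda>\<^sub>i) + n \<delta>\<close>.  In both types the coefficient of \<open>\<alpha>\<^sub>0\<close> in \<open>\<delta>\<close> is \<open>1\<close>, so that
  \<open>\<alpha>\<^sub>j = (\<Sum>i. a\<^sub>i\<^sub>j \<Lambda>\<^sub>i) + \<delta>\<^sub>j\<^sub>0 \<delta>\<close>.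
\<close>

type_synonym weight = "(idx \<Rightarrow> int) \<times> int"

definition Lambda :: "idx \<Rightarrow> weight" where
  "Lambda i = ((\<lambda>j. if j = i then 1 else 0), 0)"

definition alpha :: "(idx \<Rightarrow> idx \<Rightarrow> int) \<Rightarrow> idx \<Rightarrow> weight" where
  "alpha A j = ((\<lambda>i. A i j), if j = I0 then 1 else 0)"

definition pair_h :: "idx \<Rightarrow> weight \<Rightarrow> int" where
  "pair_h i w = fst w i"

definition wscale :: "int \<Rightarrow> weight \<Rightarrow> weight" where
  "wscale n w = ((\<lambda>i. n * fst w i), n * snd w)"

text \<open>The set \<open>\<int> \<union> {-\<infinity>}\<close>, on which integers act by addition.\<close>

datatype zbot = NegInf | Fin int

fun zadd :: "zbot \<Rightarrow> int \<Rightarrow> zbot" where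
  "zadd NegInf n = NegInf"
| "zadd (Fin m) n = Fin (m + n)"

text \<open>The element \<open>0\<close> adjoined to a crystal is \<^const>\<open>None\<close>.\<close>

definition affine_crystal ::
  "(idx \<Rightarrow> idx \<Rightarrow> int) \<Rightarrow> 'b set \<Rightarrow> ('b \<Rightarrow> weight) \<Rightarrow>
   (idx \<Rightarrow> 'b \<Rightarrow> 'b option) \<Rightarrow> (idx \<Rightarrow> 'b \<Rightarrow> 'b option) \<Rightarrow>
   (idx \<Rightarrow> 'b \<Rightarrow> zbot) \<Rightarrow> (idx \<Rightarrow> 'b \<Rightarrow> zbot) \<Rightarrow> bool" where
  "affine_crystal A B wt e f eps phi \<longleftrightarrow>
     (\<forall>i. \<forall>b\<in>B. phi i b = zadd (eps i b) (pair_h i (wt b))) \<and>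
     (\<forall>i. \<forall>b\<in>B. \<forall>b'. e i b = Some b' \<longrightarrow>
        b' \<in> B \<and> wt b' = wt b + alpha A i \<and>
        eps i b' = zadd (eps i b) (-1) \<and> phi i b' = zadd (phi i b) 1) \<and>
     (\<forall>i. \<forall>b\<in>B. \<forall>b'. f i b = Some b' \<longrightarrow>
        b' \<in> B \<and> wt b' = wt b - alpha A i \<and>
        eps i b' = zadd (eps i b) 1 \<and> phi i b' = zadd (phi i b) (-1)) \<and>
     (\<forall>i. \<forall>b\<in>B. \<forall>b'\<in>B. f i b = Some b' \<longleftrightarrow> e i b' = Some b) \<and>
     (\<forall>i. \<forall>b\<in>B. phi i b = NegInf \<longrightarrow> e i b = None \<and> f i b = None)"


section \<open>Young column patterns\<close>

text \<open>A block is a letter together with its index; \<open>\<sigma>\<close> is the shift of the index by one.\<close>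

type_synonym 'l block = "'l \<times> int"

type_synonym 'l column = "'l block set"

text \<open>
  \<open>level\<close> is the row of the blocks of index \<open>0\<close>; \<open>y_empty\<close> and \<open>y_r j\<close> are representatives
  of the classes \<open>y\<^sub>\<emptyset>\<close> and \<open>y\<^sub>r\<^sub>j\<close> (\<^const>\<open>None\<close> where the type has no \<open>y\<^sub>r\<^sub>j\<close>).
\<close>

record 'l pattern =
  cartan :: "idx \<Rightarrow> idx \<Rightarrow> int"
  colour :: "'l \<Rightarrow> idx"
  level :: "'l \<Rightarrow> int"
  rests_on :: "'l block \<Rightarrow> 'l block set"
  y_empty :: "'l column"
  y_r :: "idx \<Rightarrow> 'l column option"

definition bcol :: "'l pattern \<Rightarrow> 'l block \<Rightarrow> idx" where
  "bcol T b = colour T (fst b)"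

definition row :: "'l pattern \<Rightarrow> 'l block \<Rightarrow> int" where
  "row T b = 4 * snd b + level T (fst b)"


subsection \<open>Type \<open>E\<^sub>6\<^sup>(\<^sup>2\<^sup>)\<close>\<close>

datatype e6_letter = E_c | E_a | E_b | E_b' | E_a' | E_c' | E_z | E_b'' | E_d

definition e6_cartan :: "idx \<Rightarrow> idx \<Rightarrow> int" where
  "e6_cartan i j =
     (if i = j then 2
      else if (i, j) = (I2, I3) then -2
      else if (i, j) \<in> {(I0, I1), (I1, I0), (I1, I2), (I2, I1), (I3, I2), (I3, I4), (I4, I3)} then -1
      else 0)"

fun e6_colour :: "e6_letter \<Rightarrow> idx" where
  "e6_colour E_c = I3"
| "e6_colour E_a = I1"
| "e6_colour E_b = I2"
| "e6_colour E_b' = I2"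
| "e6_colour E_a' = I1"
| "e6_colour E_c' = I3"
| "e6_colour E_z = I0"
| "e6_colour E_b'' = I2"
| "e6_colour E_d = I4"

fun e6_level :: "e6_letter \<Rightarrow> int" where
  "e6_level E_c = 0"
| "e6_level E_a = 0"
| "e6_level E_b = 1"
| "e6_level E_b' = 1"
| "e6_level E_a' = 2"
| "e6_level E_c' = 2"
| "e6_level E_z = 3"
| "e6_level E_b'' = 3"
| "e6_level E_d = 3"

fun e6_rests_on :: "e6_letter block \<Rightarrow> e6_letter block set" where
  "e6_rests_on (E_b, m) = {(E_c, m)}"
| "e6_rests_on (E_b', m) = {(E_c, m), (E_a, m)}"
| "e6_rests_on (E_a', m) = {(E_b, m)}"
| "e6_rests_on (E_c', m) = {(E_b, m), (E_b', m)}"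
| "e6_rests_on (E_z, m) = {(E_a', m)}"
| "e6_rests_on (E_b'', m) = {(E_a', m), (E_c', m)}"
| "e6_rests_on (E_d, m) = {(E_c', m)}"
| "e6_rests_on (E_a, m) = {(E_z, m - 1), (E_b'', m - 1)}"
| "e6_rests_on (E_c, m) = {(E_b'', m - 1), (E_d, m - 1)}"

definition e6_D :: "e6_letter column" where
  "e6_D = {(l, m). m \<le> -1} \<union>
     {(E_c, 0), (E_a, 0), (E_b, 0), (E_b', 0), (E_a', 0), (E_c', 0), (E_b'', 0)}"

definition e6_y_empty :: "e6_letter column" where
  "e6_y_empty = e6_D \<union> {(E_d, 0), (E_c, 1), (E_b, 1), (E_a', 1), (E_z, 1)}"

fun e6_y_r :: "idx \<Rightarrow> e6_letter column option" where
  "e6_y_r I0 = None"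
| "e6_y_r I1 = Some (e6_D \<union> {(E_z, 0), (E_d, 0), (E_c, 1), (E_b, 1), (E_a', 1)})"
| "e6_y_r I2 = Some (e6_D \<union> {(E_z, 0), (E_a, 1), (E_b', 1), (E_d, 0), (E_c, 1)})"
| "e6_y_r I3 = None"
| "e6_y_r I4 = None"

definition e6 :: "e6_letter pattern" where
  "e6 = \<lparr> cartan = e6_cartan, colour = e6_colour, level = e6_level,
          rests_on = e6_rests_on, y_empty = e6_y_empty, y_r = e6_y_r \<rparr>"


subsection \<open>Type \<open>F\<^sub>4\<^sup>(\<^sup>1\<^sup>)\<close>\<close>

datatype f4_letter =
  F_c1 | F_d1 | F_a1 | F_c2 | F_b1 | F_b2 | F_c3 | F_a2 | F_c4 | F_d2 | F_z | F_b3

definition f4_cartan :: "idx \<Rightarrow> idx \<Rightarrow> int" where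
  "f4_cartan i j =
     (if i = j then 2
      else if (i, j) = (I3, I2) then -2
      else if (i, j) \<in> {(I0, I1), (I1, I0), (I1, I2), (I2, I1), (I2, I3), (I3, I4), (I4, I3)} then -1
      else 0)"

fun f4_colour :: "f4_letter \<Rightarrow> idx" where
  "f4_colour F_c1 = I3"
| "f4_colour F_d1 = I4"
| "f4_colour F_a1 = I1"
| "f4_colour F_c2 = I3"
| "f4_colour F_b1 = I2"
| "f4_colour F_b2 = I2"
| "f4_colour F_c3 = I3"
| "f4_colour F_a2 = I1"
| "f4_colour F_c4 = I3"
| "f4_colour F_d2 = I4"
| "f4_colour F_z = I0"
| "f4_colour F_b3 = I2"

fun f4_level :: "f4_letter \<Rightarrow> int" where
  "f4_level F_c1 = 0"
| "f4_level F_d1 = 0"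
| "f4_level F_a1 = 0"
| "f4_level F_c2 = 1"
| "f4_level F_b1 = 1"
| "f4_level F_b2 = 2"
| "f4_level F_c3 = 2"
| "f4_level F_a2 = 3"
| "f4_level F_c4 = 3"
| "f4_level F_d2 = 3"
| "f4_level F_z = 3"
| "f4_level F_b3 = 3"

fun f4_rests_on :: "f4_letter block \<Rightarrow> f4_letter block set" where
  "f4_rests_on (F_c2, m) = {(F_c1, m), (F_d1, m)}"
| "f4_rests_on (F_b1, m) = {(F_c1, m), (F_a1, m)}"
| "f4_rests_on (F_b2, m) = {(F_c2, m)}"
| "f4_rests_on (F_c3, m) = {(F_b1, m)}"
| "f4_rests_on (F_a2, m) = {(F_b2, m)}"
| "f4_rests_on (F_c4, m) = {(F_b2, m), (F_c3, m)}"
| "f4_rests_on (F_d2, m) = {(F_c3, m)}"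
| "f4_rests_on (F_z, m) = {(F_a2, m)}"
| "f4_rests_on (F_b3, m) = {(F_a2, m), (F_c4, m)}"
| "f4_rests_on (F_c1, m) = {(F_b3, m - 1), (F_c4, m - 1), (F_d2, m - 1)}"
| "f4_rests_on (F_d1, m) = {(F_c4, m - 1), (F_d2, m - 1)}"
| "f4_rests_on (F_a1, m) = {(F_z, m - 1), (F_b3, m - 1)}"

definition f4_D :: "f4_letter column" where
  "f4_D = {(l, m). m \<le> -1} \<union> {(l, m). m = 0 \<and> l \<noteq> F_z \<and> l \<noteq> F_d2}"

definition f4_y_empty :: "f4_letter column" where
  "f4_y_empty = f4_D \<union>
     {(F_d2, 0), (F_c1, 1), (F_d1, 1), (F_c2, 1), (F_b2, 1), (F_a2, 1), (F_z, 1)}"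

fun f4_y_r :: "idx \<Rightarrow> f4_letter column option" where
  "f4_y_r I0 = None"
| "f4_y_r I1 = Some (f4_D \<union>
     {(F_z, 0), (F_d2, 0), (F_c1, 1), (F_d1, 1), (F_c2, 1), (F_b2, 1), (F_a2, 1)})"
| "f4_y_r I2 = Some (f4_D \<union>
     {(F_z, 0), (F_a1, 1), (F_b1, 1), (F_d2, 0), (F_c1, 1), (F_d1, 1), (F_c2, 1)})"
| "f4_y_r I3 = Some (f4_D \<union>
     {(F_z, 0), (F_a1, 1), (F_b1, 1), (F_c3, 1), (F_d2, 0), (F_c1, 1), (F_d1, 1)})"
| "f4_y_r I4 = Some (f4_D \<union>
     {(F_z, 0), (F_a1, 1), (F_b1, 1), (F_c3, 1), (F_d2, 1), (F_d2, 0), (F_c1, 1)})"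

definition f4 :: "f4_letter pattern" where
  "f4 = \<lparr> cartan = f4_cartan, colour = f4_colour, level = f4_level,
          rests_on = f4_rests_on, y_empty = f4_y_empty, y_r = f4_y_r \<rparr>"


section \<open>Young columns\<close>

definition pre_young :: "'l pattern \<Rightarrow> 'l column \<Rightarrow> bool" where
  "pre_young T y \<longleftrightarrow> y \<noteq> {} \<and> bdd_above (row T ` y) \<and> (\<forall>b\<in>y. rests_on T b \<subseteq> y)"

definition free_block :: "'l pattern \<Rightarrow> 'l column \<Rightarrow> 'l block \<Rightarrow> bool" where
  "free_block T y b \<longleftrightarrow> b \<in> y \<and> pre_young T (y - {b})"

definition top_row :: "'l pattern \<Rightarrow> 'l column \<Rightarrow> int" where
  "top_row T y = (GREATEST r. r \<in> row T ` y)"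

definition exceptional :: "'l pattern \<Rightarrow> 'l column \<Rightarrow> bool" where
  "exceptional T y \<longleftrightarrow>
     (\<exists>!b. free_block T y b \<and> bcol T b = I2 \<and> row T b = top_row T y) \<and>
     (\<exists>b. free_block T y b \<and> bcol T b = I1)"

definition young :: "'l pattern \<Rightarrow> 'l column \<Rightarrow> bool" where
  "young T y \<longleftrightarrow> pre_young T y \<and> \<not> exceptional T y"

definition sigma_pow :: "int \<Rightarrow> 'l column \<Rightarrow> 'l column" where
  "sigma_pow n y = (\<lambda>(l, m). (l, m + n)) ` y"

definition col_equiv :: "'l pattern \<Rightarrow> ('l column \<times> 'l column) set" where
  "col_equiv T = {(y, y'). young T y \<and> young T y' \<and> (\<exists>n. y' = sigma_pow n y)}"

definition cls :: "'l pattern \<Rightarrow> 'l column \<Rightarrow> 'l column set" where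
  "cls T y = col_equiv T `` {y}"

definition col_classes :: "'l pattern \<Rightarrow> 'l column set set" where
  "col_classes T = {y. young T y} // col_equiv T"

definition addable :: "'l pattern \<Rightarrow> idx \<Rightarrow> 'l column \<Rightarrow> 'l block \<Rightarrow> bool" where
  "addable T i y b \<longleftrightarrow> b \<notin> y \<and> bcol T b = i \<and> young T (insert b y)"

definition removable :: "'l pattern \<Rightarrow> idx \<Rightarrow> 'l column \<Rightarrow> 'l block \<Rightarrow> bool" where
  "removable T i y b \<longleftrightarrow> b \<in> y \<and> bcol T b = i \<and> young T (y - {b})"

definition blocked :: "'l pattern \<Rightarrow> idx \<Rightarrow> 'l column \<Rightarrow> bool" where
  "blocked T i y \<longleftrightarrow> (\<exists>j r. j \<noteq> i \<and> y_r T j = Some r \<and> y \<in> cls T r)"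

definition col_f :: "'l pattern \<Rightarrow> idx \<Rightarrow> 'l column \<Rightarrow> 'l column option" where
  "col_f T i y =
     (if blocked T i y \<or> \<not> (\<exists>b. addable T i y b) then None
      else Some (insert (arg_max (row T) (addable T i y)) y))"

definition col_e :: "'l pattern \<Rightarrow> idx \<Rightarrow> 'l column \<Rightarrow> 'l column option" where
  "col_e T i y =
     (if blocked T i y \<or> \<not> (\<exists>b. removable T i y b) then None
      else Some (y - {arg_min (row T) (removable T i y)}))"

definition iter_op :: "('b \<Rightarrow> 'b option) \<Rightarrow> nat \<Rightarrow> 'b \<Rightarrow> 'b option" where
  "iter_op g n b = ((\<lambda>x. Option.bind x g) ^^ n) (Some b)"

definition col_phi :: "'l pattern \<Rightarrow> idx \<Rightarrow> 'l column \<Rightarrow> nat" where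
  "col_phi T i y = Max {n. iter_op (col_f T i) n y \<noteq> None}"

definition col_eps :: "'l pattern \<Rightarrow> idx \<Rightarrow> 'l column \<Rightarrow> nat" where
  "col_eps T i y = Max {n. iter_op (col_e T i) n y \<noteq> None}"


section \<open>Classes of columns and the energy function\<close>

text \<open>The value on a class of a map that is constant on the class.\<close>

definition descend :: "('a \<Rightarrow> 'b) \<Rightarrow> 'a set \<Rightarrow> 'b" where
  "descend g A = the_elem (g ` A)"

definition cls_f :: "'l pattern \<Rightarrow> idx \<Rightarrow> 'l column set \<Rightarrow> 'l column set option" where
  "cls_f T i = descend (\<lambda>y. map_option (cls T) (col_f T i y))"

definition cls_phi :: "'l pattern \<Rightarrow> idx \<Rightarrow> 'l column set \<Rightarrow> nat" where
  "cls_phi T i = descend (col_phi T i)"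

definition cls_eps :: "'l pattern \<Rightarrow> idx \<Rightarrow> 'l column set \<Rightarrow> nat" where
  "cls_eps T i = descend (col_eps T i)"

definition tensor_f ::
  "'l pattern \<Rightarrow> idx \<Rightarrow> 'l column set \<times> 'l column set \<Rightarrow>
   ('l column set \<times> 'l column set) option" where
  "tensor_f T i = (\<lambda>(a, b).
     if cls_phi T i a > cls_eps T i b then map_option (\<lambda>a'. (a', b)) (cls_f T i a)
     else map_option (\<lambda>b'. (a, b')) (cls_f T i b))"

definition is_energy ::
  "'l pattern \<Rightarrow> ('l column set \<times> 'l column set \<Rightarrow> int) \<Rightarrow> bool" where
  "is_energy T H \<longleftrightarrow>
     H (cls T (y_empty T), cls T (y_empty T)) = 0 \<and>
     (\<forall>i. \<forall>a\<in>col_classes T. \<forall>b\<in>col_classes T. \<forall>p. tensor_f T i (a, b) = Some p \<longrightarrow>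
        H p - H (a, b) =
          (if i \<noteq> I0 then 0 else if cls_phi T I0 a > cls_eps T I0 b then -1 else 1))"

definition energy :: "'l pattern \<Rightarrow> 'l column set \<times> 'l column set \<Rightarrow> int" where
  "energy T = (THE H. H \<in> extensional (col_classes T \<times> col_classes T) \<and> is_energy T H)"


section \<open>Young walls\<close>

text \<open>
  A wall is given by its columns, \<open>Y k\<close> being the set of blocks of \<open>Y\<close> in column \<open>k\<close>, where
  columns are numbered from right to left; \<open>g\<close> is the ground-state column.
\<close>

type_synonym 'l wall = "nat \<Rightarrow> 'l column"

definition young_wall :: "'l pattern \<Rightarrow> 'l column \<Rightarrow> 'l wall \<Rightarrow> bool" where
  "young_wall T g Y \<longleftrightarrow>
     (\<forall>k. young T (Y k)) \<and> finite {(k, b). b \<in> (Y k - g) \<union> (g - Y k)}"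

definition zero_content :: "'l pattern \<Rightarrow> 'l column \<Rightarrow> 'l column \<Rightarrow> int" where
  "zero_content T g y =
     int (card {b \<in> y - g. bcol T b = I0}) - int (card {b \<in> g - y. bcol T b = I0})"

definition reduced_walls :: "'l pattern \<Rightarrow> 'l column \<Rightarrow> 'l wall set" where
  "reduced_walls T g = {Y. young_wall T g Y \<and>
     (\<forall>k. energy T (cls T (Y (Suc k)), cls T (Y k))
            + zero_content T g (Y (Suc k)) - zero_content T g (Y k) = 0)}"


subsection \<open>The signature rule\<close>

text \<open>
  The letters of the (left-infinite) concatenated \<open>i\<close>-signature of a wall are addressed by
  pairs \<open>(k, j)\<close>: the \<open>j\<close>-th letter, counted from the left and starting at \<open>0\<close>, of the
  signature of column \<open>k\<close>.
\<close>

fun is_minus :: "'l pattern \<Rightarrow> idx \<Rightarrow> 'l wall \<Rightarrow> nat \<times> nat \<Rightarrow> bool" where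
  "is_minus T i Y (k, j) \<longleftrightarrow> j < col_eps T i (Y k)"

fun is_plus :: "'l pattern \<Rightarrow> idx \<Rightarrow> 'l wall \<Rightarrow> nat \<times> nat \<Rightarrow> bool" where
  "is_plus T i Y (k, j) \<longleftrightarrow>
     col_eps T i (Y k) \<le> j \<and> j < col_eps T i (Y k) + col_phi T i (Y k)"

fun left_of :: "nat \<times> nat \<Rightarrow> nat \<times> nat \<Rightarrow> bool" where
  "left_of (k, j) (k', j') \<longleftrightarrow> k' < k \<or> k = k' \<and> j < j'"

text \<open>
  Successive cancellation: \<open>cancels T i Y p q\<close> holds if the \<open>+\<close> at \<open>p\<close> is eventually cancelled
  with the \<open>-\<close> at \<open>q\<close>, i.e. if all letters strictly between them cancel among themselves.
\<close>

inductive cancels ::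
  "'l pattern \<Rightarrow> idx \<Rightarrow> 'l wall \<Rightarrow> nat \<times> nat \<Rightarrow> nat \<times> nat \<Rightarrow> bool"
  for T :: "'l pattern" and i :: idx and Y :: "'l wall" where
  "\<lbrakk> is_plus T i Y p; is_minus T i Y q; left_of p q;
     \<forall>r. (is_plus T i Y r \<or> is_minus T i Y r) \<and> left_of p r \<and> left_of r q \<longrightarrow>
       (\<exists>s. left_of p s \<and> left_of s q \<and> (cancels T i Y r s \<or> cancels T i Y s r)) \<rbrakk>
   \<Longrightarrow> cancels T i Y p q"

definition sig_minus :: "'l pattern \<Rightarrow> idx \<Rightarrow> 'l wall \<Rightarrow> (nat \<times> nat) set" where
  "sig_minus T i Y = {q. is_minus T i Y q \<and> \<not> (\<exists>p. cancels T i Y p q)}"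

definition sig_plus :: "'l pattern \<Rightarrow> idx \<Rightarrow> 'l wall \<Rightarrow> (nat \<times> nat) set" where
  "sig_plus T i Y = {p. is_plus T i Y p \<and> \<not> (\<exists>q. cancels T i Y p q)}"

definition wall_eps :: "'l pattern \<Rightarrow> idx \<Rightarrow> 'l wall \<Rightarrow> zbot" where
  "wall_eps T i Y = Fin (int (card (sig_minus T i Y)))"

definition wall_phi :: "'l pattern \<Rightarrow> idx \<Rightarrow> 'l wall \<Rightarrow> zbot" where
  "wall_phi T i Y = Fin (int (card (sig_plus T i Y)))"

text \<open>The column of the rightmost \<open>-\<close> is the one of least number, that of the leftmost \<open>+\<close>
  the one of greatest number.\<close>

definition wall_e :: "'l pattern \<Rightarrow> idx \<Rightarrow> 'l wall \<Rightarrow> 'l wall option" where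
  "wall_e T i Y =
     (if sig_minus T i Y = {} then None
      else let k = (LEAST k. k \<in> fst ` sig_minus T i Y)
           in map_option (\<lambda>c. Y(k := c)) (col_e T i (Y k)))"

definition wall_f :: "'l pattern \<Rightarrow> idx \<Rightarrow> 'l wall \<Rightarrow> 'l wall option" where
  "wall_f T i Y =
     (if sig_plus T i Y = {} then None
      else let k = (GREATEST k. k \<in> fst ` sig_plus T i Y)
           in map_option (\<lambda>c. Y(k := c)) (col_f T i (Y k)))"

definition added :: "'l pattern \<Rightarrow> 'l column \<Rightarrow> 'l wall \<Rightarrow> idx \<Rightarrow> nat" where
  "added T g Y i = card {(k, b). b \<in> Y k - g \<and> bcol T b = i}"

definition wall_wt :: "'l pattern \<Rightarrow> weight \<Rightarrow> 'l column \<Rightarrow> 'l wall \<Rightarrow> weight" where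
  "wall_wt T lam g Y = lam - (\<Sum>i\<in>UNIV. wscale (int (added T g Y i)) (alpha (cartan T) i))"

end

theory Submission
  imports Defs
begin

text \<open>
  An operator \<open>f\<^sub>i\<close> keeps the length of the signature of the column on which it acts and changes its
  first \<open>+\<close> into \<open>-\<close>.  Changing the leftmost uncancelled \<open>+\<close> of a bracket word into \<open>-\<close>, or its
  rightmost uncancelled \<open>-\<close> into \<open>+\<close>, does not alter which letters cancel each other; hence
  \<open>E\<^sub>i\<close> and \<open>F\<^sub>i\<close> are inverse to each other and change \<open>\<epsilon>\<^sub>i\<close> and \<open>\<phi>\<^sub>i\<close> by one.  The column acted upon
  is also the factor picked by the tensor product rule in both pairs of neighbouring columns, so
  that the energy changes by the number of added \<open>0\<close>-blocks and reducedness is preserved.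

  The energy is nonnegative, and on pairs with a factor \<open>y\<^sub>\<emptyset>\<close> it vanishes only at
  \<open>y\<^sub>\<emptyset> \<otimes> y\<^sub>\<emptyset>\<close>.  Hence, going from left to right in a reduced wall, the \<open>0\<close>-contents increase from
  \<open>0\<close>, and this forces every column to contain the ground-state column: the number of added blocks
  then is the full content of the wall, and the weight is as required.

  What remains are statements on single columns and on pairs of them, which are finite modulo the
  shift \<open>\<sigma>\<close>.  There are 27, respectively 53, classes of columns.
\<close>

section \<open>Matching of brackets\<close>

text \<open>Two obstacles shape the argument. The count \<open>added\<close> ignores blocks of the
  ground-state column \<open>g\<close> that a wall lacks, so the weight formula needs every column
  to contain \<open>g\<close>. Surplus 0-blocks alone do not ensure this: the shift of
  \<open>g\<close> by one has 0-content 1, but lacks the uppermost 0-block of \<open>g\<close>. A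
  column of 0-content at least 2, or of 0-content 1 and class other than that of \<open>g\<close>,
  does contain \<open>g\<close>. The remaining case cannot occur in a reduced wall: going left from
  such a column, energy 0 preserves the class of \<open>g\<close>, and the final step to a column of
  content 0, again of the class of \<open>g\<close>, would need positive energy, whereas this pair
  has energy 0. Second, \<open>energy\<close> is a definite description, so a table of values
  identifies it only together with uniqueness, which comes from connectedness of the tensor square
  under the operators. The tables are certificates: their consistency arrow by arrow and the
  completeness of the list of classes are decided by evaluation, and shift invariance carries the
  result to all columns.\<close>

inductive mat :: "('a \<Rightarrow> bool) \<Rightarrow> ('a \<Rightarrow> bool) \<Rightarrow> ('a \<Rightarrow> 'a \<Rightarrow> bool) \<Rightarrow> 'a \<Rightarrow> 'a \<Rightarrow> bool"
  for P M L where
  matI: "\<lbrakk> P p; M q; L p q;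
     \<forall>r. (P r \<or> M r) \<and> L p r \<and> L r q \<longrightarrow>
       (\<exists>s. L p s \<and> L s q \<and> (mat P M L r s \<or> mat P M L s r)) \<rbrakk>
   \<Longrightarrow> mat P M L p q"

text \<open>Finiteness is asked only for the letters between two positions, since the 0-signature of
  a wall extends infinitely far to the left.\<close>

locale brackets =
  fixes P M :: "'a \<Rightarrow> bool" and L :: "'a \<Rightarrow> 'a \<Rightarrow> bool"
  assumes irrefl: "\<not> L x x"
    and trans: "L x y \<Longrightarrow> L y z \<Longrightarrow> L x z"
    and total: "x \<noteq> y \<Longrightarrow> L x y \<or> L y x"
    and disj: "\<not> (P x \<and> M x)"
    and fin: "finite {r. (P r \<or> M r) \<and> L x r \<and> L r y}"
begin

abbreviation "mt \<equiv> mat P M L"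

definition "U_plus = {p. P p \<and> \<not> (\<exists>q. mt p q)}"
definition "U_minus = {q. M q \<and> \<not> (\<exists>p. mt p q)}"

lemma mt_D: "mt p q \<Longrightarrow> P p \<and> M q \<and> L p q"
  by (erule mat.cases) auto

lemma mt_inner: "mt p q \<Longrightarrow> P r \<or> M r \<Longrightarrow> L p r \<Longrightarrow> L r q \<Longrightarrow>
   \<exists>s. L p s \<and> L s q \<and> (mt r s \<or> mt s r)"
  by (erule mat.cases) blast

lemma P_not_target: "P x \<Longrightarrow> \<not> mt y x"
  using mt_D disj by blast

lemma M_not_source: "M x \<Longrightarrow> \<not> mt x y"
  using mt_D disj by blast

lemma mt_plus_inner: "mt p q \<Longrightarrow> P r \<Longrightarrow> L p r \<Longrightarrow> L r q \<Longrightarrow> \<exists>s. L p s \<and> L s q \<and> mt r s"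
  using mt_inner P_not_target M_not_source by blast

lemma mt_minus_inner: "mt p q \<Longrightarrow> M r \<Longrightarrow> L p r \<Longrightarrow> L r q \<Longrightarrow> \<exists>s. L p s \<and> L s q \<and> mt s r"
  using mt_inner P_not_target M_not_source by blast

text \<open>By induction on the matching, the letters inside the pair have unique partners, all of
  them inside. A second partner of an endpoint either lies inside, contradicting its unique partner,
  or lies beyond the other endpoint. In that case the other endpoint is matched to a letter inside,
  which again has a different unique partner.\<close>

lemma mt_unique: "mt p q \<Longrightarrow> (\<forall>q'. mt p q' \<longrightarrow> q' = q) \<and> (\<forall>p'. mt p' q \<longrightarrow> p' = p)"
proof (induction rule: mat.induct)
  case (matI p q)
  let ?U = "\<lambda>a b. (\<forall>q'. mt a q' \<longrightarrow> q' = b) \<and> (\<forall>p'. mt p' b \<longrightarrow> p' = a)"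
  have plus: "\<exists>t. L p t \<and> L t q \<and> mt s t \<and> ?U s t" if "P s" "L p s" "L s q" for s
    using matI(4) that P_not_target M_not_source by blast
  have minus: "\<exists>s. L p s \<and> L s q \<and> mt s t \<and> ?U s t" if "M t" "L p t" "L t q" for t
    using matI(4) that P_not_target M_not_source by blast
  have left: "p' = p" if m: "mt p' q" for p'
  proof (rule ccontr)
    assume "p' \<noteq> p"
    then consider "L p p'" | "L p' p" using total by blast
    then show False
    proof cases
      case 1
      then show False using plus[of p'] m mt_D irrefl by metis
    next
      case 2
      then obtain t where t: "L t q" "mt p t"
        using mt_plus_inner[OF m \<open>P p\<close> 2 \<open>L p q\<close>] by blast
      then show False using minus[of t] mt_D irrefl by metis
    qed
  qed
  have right: "q' = q" if m: "mt p q'" for q'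
  proof (rule ccontr)
    assume "q' \<noteq> q"
    then consider "L q' q" | "L q q'" using total by blast
    then show False
    proof cases
      case 1
      then show False using minus[of q'] m mt_D irrefl by metis
    next
      case 2
      then obtain t where t: "L p t" "mt t q"
        using mt_minus_inner[OF m \<open>M q\<close> \<open>L p q\<close> 2] by blast
      then show False using plus[of t] mt_D irrefl by metis
    qed
  qed
  show ?case using left right by blast
qed

lemma mt_right_unique: "mt p q \<Longrightarrow> mt p q' \<Longrightarrow> q = q'"
  using mt_unique by metis

lemma mt_left_unique: "mt p q \<Longrightarrow> mt p' q \<Longrightarrow> p = p'"
  using mt_unique by metis

text \<open>All letters inside a matched pair are themselves matched. Hence a matched pair lies
  wholly to one side of every uncancelled letter, the form in which \<open>partner_left\<close> and
  \<open>partner_right\<close> put it.\<close>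

lemma not_enclosed:
  assumes "x \<in> U_plus \<union> U_minus" "mt p q"
  shows "\<not> (L p x \<and> L x q)"
  using assms mt_inner[of p q x] P_not_target[of x] M_not_source[of x]
  unfolding U_plus_def U_minus_def by blast

lemma partner_left:
  assumes "x \<in> U_plus \<union> U_minus" "mt p q" "L p x"
  shows "L q x"
proof -
  have "q \<noteq> x" using assms mt_D disj unfolding U_plus_def U_minus_def by blast
  then show ?thesis using total not_enclosed[OF assms(1,2)] assms(3) by blast
qed

lemma partner_right:
  assumes "x \<in> U_plus \<union> U_minus" "mt p q" "L x q"
  shows "L x p"
proof -
  have "p \<noteq> x" using assms mt_D disj unfolding U_plus_def U_minus_def by blast
  then show ?thesis using total not_enclosed[OF assms(1,2)] assms(3) by blast
qed

text \<open>Take an uncancelled \<open>+\<close> to the left of an uncancelled \<open>-\<close> with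
  as few letters between them as possible. An uncancelled letter between them would give a closer
  pair, and the matched letters have their partners between them too. So the two letters match each
  other, a contradiction.\<close>

lemma U_minus_left_of_U_plus:
  assumes "p \<in> U_plus" "q \<in> U_minus"
  shows "L q p"
proof -
  have "\<not> L p q"
    using assms
  proof (induction "card {r. (P r \<or> M r) \<and> L p r \<and> L r q}" arbitrary: p q rule: less_induct)
    case less
    show ?case
    proof
      assume pq: "L p q"
      have P: "P p" and M: "M q" using less.prems unfolding U_plus_def U_minus_def by auto
      have "\<exists>s. L p s \<and> L s q \<and> (mt r s \<or> mt s r)" if r: "P r \<or> M r" "L p r" "L r q" for r
      proof (cases "r \<in> U_plus \<union> U_minus")
        case True
        then show ?thesis
        proof
          assume rU: "r \<in> U_plus"
          have "{t. (P t \<or> M t) \<and> L r t \<and> L t q} \<subset> {t. (P t \<or> M t) \<and> L p t \<and> L t q}"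
            using r trans irrefl by blast
          then have "\<not> L r q" using less.hyps[OF psubset_card_mono[OF fin] rU less.prems(2)] by blast
          then show ?thesis using r by blast
        next
          assume rU: "r \<in> U_minus"
          have "{t. (P t \<or> M t) \<and> L p t \<and> L t r} \<subset> {t. (P t \<or> M t) \<and> L p t \<and> L t q}"
            using r trans irrefl by blast
          then have "\<not> L p r" using less.hyps[OF psubset_card_mono[OF fin] less.prems(1) rU] by blast
          then show ?thesis using r by blast
        qed
      next
        case False
        then obtain s where s: "mt r s \<or> mt s r" using r(1) unfolding U_plus_def U_minus_def by blast
        then show ?thesis
          using partner_left[of q] partner_right[of p] less.prems r trans mt_D by (meson UnCI)
      qed
      then have "mt p q" using P M pq by (intro mat.intros) auto
      then show False using less.prems unfolding U_plus_def by blast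
    qed
  qed
  then show ?thesis using assms total[of p q] disj[of p] unfolding U_plus_def U_minus_def by auto
qed

text \<open>The set of letters is unchanged, so a difference could only come from a new pair ending
  in \<open>x\<close>. Its \<open>+\<close> stands left of the leftmost uncancelled
  \<open>+\<close>, hence was already cancelled by some \<open>t\<close> to the left of
  \<open>x\<close>. But the letters inside the new pair, \<open>t\<close> among them, cancel
  strictly inside it, so \<open>t\<close> would have two partners.\<close>

lemma mat_toggle_leftmost_plus:
  assumes x: "x \<in> U_plus" and left: "\<And>y. y \<in> U_plus \<Longrightarrow> \<not> L y x"
  shows "mat (\<lambda>y. P y \<and> y \<noteq> x) (\<lambda>y. M y \<or> y = x) L = mt"
proof (intro ext iffI)
  let ?P = "\<lambda>y. P y \<and> y \<noteq> x" and ?M = "\<lambda>y. M y \<or> y = x"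
  have xP: "P x" and xn: "\<And>q. \<not> mt x q" using x unfolding U_plus_def by auto
  fix p q
  show "mat ?P ?M L p q" if "mt p q"
    using that
  proof (induction rule: mat.induct)
    case (matI p q)
    have pq: "mt p q" using matI by (intro mat.intros) auto
    have "p \<noteq> x" using xn pq by blast
    then show ?case using matI xP by (intro mat.intros) auto
  qed
  show "mt p q" if "mat ?P ?M L p q"
    using that
  proof (induction rule: mat.induct)
    case (matI p q)
    have inner: "\<exists>s. L p s \<and> L s q \<and> (mt r s \<or> mt s r)" if "P r \<or> M r" "L p r" "L r q" for r
      using matI that by blast
    have "q \<noteq> x"
    proof
      assume q: "q = x"
      have "p \<notin> U_plus" using left matI q by blast
      then obtain t where t: "mt p t" using matI unfolding U_plus_def by blast
      have "L t x" using partner_left[of x p t] x t matI q by blast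
      then obtain s where s: "L p s" "mt s t" 
        using inner[of t] t mt_D[OF t] q M_not_source by blast
      then show False using mt_left_unique t irrefl by blast
    qed
    then show ?case using matI inner by (intro mat.intros) auto
  qed
qed

text \<open>Mirror image of the previous argument: the only possible new pair would begin in
  \<open>x\<close>.\<close>

lemma mat_toggle_rightmost_minus:
  assumes x: "x \<in> U_minus" and right: "\<And>y. y \<in> U_minus \<Longrightarrow> \<not> L x y"
  shows "mat (\<lambda>y. P y \<or> y = x) (\<lambda>y. M y \<and> y \<noteq> x) L = mt"
proof (intro ext iffI)
  let ?P = "\<lambda>y. P y \<or> y = x" and ?M = "\<lambda>y. M y \<and> y \<noteq> x"
  have xM: "M x" and xn: "\<And>q. \<not> mt q x" using x unfolding U_minus_def by auto
  fix p q
  show "mat ?P ?M L p q" if "mt p q"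
    using that
  proof (induction rule: mat.induct)
    case (matI p q)
    have pq: "mt p q" using matI by (intro mat.intros) auto
    have "q \<noteq> x" using xn pq by blast
    then show ?case using matI xM by (intro mat.intros) auto
  qed
  show "mt p q" if "mat ?P ?M L p q"
    using that
  proof (induction rule: mat.induct)
    case (matI p q)
    have inner: "\<exists>s. L p s \<and> L s q \<and> (mt r s \<or> mt s r)" if "P r \<or> M r" "L p r" "L r q" for r
      using matI that by blast
    have "p \<noteq> x"
    proof
      assume p: "p = x"
      have "q \<notin> U_minus" using right matI p by blast
      then obtain t where t: "mt t q" using matI unfolding U_minus_def by blast
      have "L x t" using partner_right[of x t q] x t matI p by blast
      then obtain s where s: "L s q" "mt t s" 
        using inner[of t] t mt_D[OF t] p P_not_target by blast
      then show False using mt_right_unique t irrefl by blast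
    qed
    then show ?case using matI inner by (intro mat.intros) auto
  qed
qed

end

section \<open>Signatures of Young walls\<close>

lemma brackets_signature: "brackets (is_plus T i Y) (is_minus T i Y) left_of"
proof
  fix x y z :: "nat \<times> nat"
  show "\<not> left_of x x" by (cases x) auto
  show "left_of x z" if "left_of x y" "left_of y z"
    using that by (cases x; cases y; cases z) auto
  show "x \<noteq> y \<Longrightarrow> left_of x y \<or> left_of y x" by (cases x; cases y) auto
  show "\<not> (is_plus T i Y x \<and> is_minus T i Y x)" by (cases x) auto
  \<comment> \<open>Column numbers decrease from left to right, so everything to the right of
    \<open>x\<close> lies in the finitely many columns up to \<open>fst x\<close>.\<close>
  let ?A = "SIGMA k:{..fst x}. {..<col_eps T i (Y k) + col_phi T i (Y k)}"
  have "{r. (is_plus T i Y r \<or> is_minus T i Y r) \<and> left_of x r \<and> left_of r y} \<subseteq> ?A"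
    by (cases x; cases y) auto
  then show "finite {r. (is_plus T i Y r \<or> is_minus T i Y r) \<and> left_of x r \<and> left_of r y}"
    by (rule finite_subset) auto
qed

text \<open>In \<open>mat\<close> the positions of the letters are parameters. This allows the
  cancellations of two walls to be compared when the letters of one arise from those of the other by
  toggling a sign.\<close>

lemma cancels_eq_mat: "cancels T i Y = mat (is_plus T i Y) (is_minus T i Y) left_of"
proof (intro ext iffI)
  fix p q
  show "mat (is_plus T i Y) (is_minus T i Y) left_of p q" if "cancels T i Y p q"
    using that
  proof (induction rule: cancels.induct)
    case (1 p q)
    then show ?case by (intro matI) blast+
  qed
  show "cancels T i Y p q" if "mat (is_plus T i Y) (is_minus T i Y) left_of p q"
    using that
  proof (induction rule: mat.induct)
    case (matI p q)
    then show ?case by (intro cancels.intros) blast+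
  qed
qed

lemma sig_plus_eq: "sig_plus T i Y = brackets.U_plus (is_plus T i Y) (is_minus T i Y) left_of"
  by (simp add: sig_plus_def brackets.U_plus_def[OF brackets_signature] cancels_eq_mat)

lemma sig_minus_eq: "sig_minus T i Y = brackets.U_minus (is_plus T i Y) (is_minus T i Y) left_of"
  by (simp add: sig_minus_def brackets.U_minus_def[OF brackets_signature] cancels_eq_mat)

lemma sig_letters:
  "p \<in> sig_plus T i Y \<Longrightarrow> is_plus T i Y p" "p \<in> sig_minus T i Y \<Longrightarrow> is_minus T i Y p"
  by (simp_all add: sig_plus_def sig_minus_def)

lemma cancels_D: "cancels T i Y p q \<Longrightarrow> is_plus T i Y p \<and> is_minus T i Y q \<and> left_of p q"
  by (erule cancels.cases) auto

lemma sig_partner_left: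
  "x \<in> sig_plus T i Y \<union> sig_minus T i Y \<Longrightarrow> cancels T i Y p q \<Longrightarrow> left_of p x \<Longrightarrow> left_of q x"
  using brackets.partner_left[OF brackets_signature] by (simp add: sig_plus_eq sig_minus_eq cancels_eq_mat)

lemma sig_partner_right:
  "x \<in> sig_plus T i Y \<union> sig_minus T i Y \<Longrightarrow> cancels T i Y p q \<Longrightarrow> left_of x q \<Longrightarrow> left_of x p"
  using brackets.partner_right[OF brackets_signature] by (simp add: sig_plus_eq sig_minus_eq cancels_eq_mat)

lemma sig_minus_left_of_plus:
  "p \<in> sig_plus T i Y \<Longrightarrow> q \<in> sig_minus T i Y \<Longrightarrow> left_of q p"
  using brackets.U_minus_left_of_U_plus[OF brackets_signature] by (simp add: sig_plus_eq sig_minus_eq)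

lemma cancels_right_unique: "cancels T i Y p q \<Longrightarrow> cancels T i Y p q' \<Longrightarrow> q = q'"
  using brackets.mt_right_unique[OF brackets_signature] by (simp add: cancels_eq_mat)

lemma cancels_left_unique: "cancels T i Y p q \<Longrightarrow> cancels T i Y p' q \<Longrightarrow> p = p'"
  using brackets.mt_left_unique[OF brackets_signature] by (simp add: cancels_eq_mat)

text \<open>A \<open>-\<close> cancelling the first \<open>+\<close> would have to stand before the
  uncancelled \<open>+\<close> at \<open>(k, j)\<close>, hence between two \<open>+\<close> of the
  same column, where no \<open>-\<close> occurs. So the letter changed by the column operator is the
  one selected by the signature rule; \<open>last_minus_of_column\<close> is the dual
  statement.\<close>

lemma first_plus_of_column:
  assumes "(k, j) \<in> sig_plus T i Y"
  shows "(k, col_eps T i (Y k)) \<in> sig_plus T i Y"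
proof (rule ccontr)
  let ?x = "(k, col_eps T i (Y k))"
  assume neg: "?x \<notin> sig_plus T i Y"
  have j: "col_eps T i (Y k) < j" "j < col_eps T i (Y k) + col_phi T i (Y k)"
    using sig_letters(1)[OF assms] assms neg by (auto simp: le_less)
  then obtain q where q: "cancels T i Y ?x q" using neg by (auto simp: sig_plus_def)
  have "left_of q (k, j)" using sig_partner_left[OF _ q] assms j by auto
  then show False using cancels_D[OF q] by (cases q) auto
qed

lemma last_minus_of_column:
  assumes "(k, j) \<in> sig_minus T i Y"
  shows "(k, col_eps T i (Y k) - 1) \<in> sig_minus T i Y"
proof (rule ccontr)
  let ?x = "(k, col_eps T i (Y k) - 1)"
  assume neg: "?x \<notin> sig_minus T i Y"
  have j: "j < col_eps T i (Y k) - 1"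
  proof -
    have "j < col_eps T i (Y k)" using sig_letters(2)[OF assms] by simp
    moreover have "j \<noteq> col_eps T i (Y k) - 1" using assms neg by auto
    ultimately show ?thesis by linarith
  qed
  then obtain p where p: "cancels T i Y p ?x" using neg by (auto simp: sig_minus_def)
  have "left_of (k, j) p" using sig_partner_right[OF _ p] assms j by auto
  then show False using cancels_D[OF p] by (cases p) auto
qed

text \<open>Each \<open>+\<close> of column \<open>k + 1\<close> is cancelled by a \<open>-\<close>
  that stands before the uncancelled letter \<open>(k, j)\<close> and therefore in column
  \<open>k\<close>; cancellation is injective. This is the condition under which the tensor product
  rule picks the right factor of columns \<open>k + 1\<close> and \<open>k\<close>.\<close>

lemma phi_le_of_uncancelled:
  assumes x: "(k, j) \<in> sig_plus T i Y \<union> sig_minus T i Y"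
    and no: "\<And>j'. (Suc k, j') \<notin> sig_plus T i Y"
  shows "col_phi T i (Y (Suc k)) \<le> card {j'. j' < j \<and> j' < col_eps T i (Y k)}"
proof -
  let ?e = "col_eps T i (Y (Suc k))" and ?p = "col_phi T i (Y (Suc k))"
  let ?A = "Pair (Suc k) ` {?e..<?e + ?p}"
  let ?B = "Pair k ` {j'. j' < j \<and> j' < col_eps T i (Y k)}"
  define h where "h p = (SOME q. cancels T i Y p q)" for p
  have h: "cancels T i Y p (h p)" if "p \<in> ?A" for p
  proof -
    have "is_plus T i Y p" using that by auto
    moreover have "p \<notin> sig_plus T i Y" using that no by auto
    ultimately show ?thesis unfolding h_def sig_plus_def by (auto intro: someI)
  qed
  have "card ?A \<le> card ?B"
  proof (rule card_inj_on_le)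
    show "inj_on h ?A" by (rule inj_onI) (metis h cancels_left_unique)
    show "h ` ?A \<subseteq> ?B"
    proof (rule image_subsetI)
      fix p assume p: "p \<in> ?A"
      have "left_of p (k, j)" using p by auto
      then have "left_of (h p) (k, j)" using sig_partner_left[OF x h[OF p]] by blast
      then show "h p \<in> ?B" using cancels_D[OF h[OF p]] p by (cases "h p") auto
    qed
  qed simp
  then show ?thesis by (simp add: card_image inj_on_def)
qed

text \<open>Dually, each \<open>-\<close> of column \<open>k\<close> is cancelled by a
  \<open>+\<close> of column \<open>k + 1\<close> that stands after the uncancelled letter
  \<open>(Suc k, j)\<close>. Since that letter itself is not counted, the strict inequality
  selecting the left factor can be obtained.\<close>

lemma eps_le_of_uncancelled:
  assumes x: "(Suc k, j) \<in> sig_plus T i Y \<union> sig_minus T i Y"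
    and no: "\<And>j'. (k, j') \<notin> sig_minus T i Y"
  shows "col_eps T i (Y k) \<le> card {j'. j < j' \<and> is_plus T i Y (Suc k, j')}"
proof -
  let ?A = "Pair k ` {..<col_eps T i (Y k)}"
  let ?S = "{j'. j < j' \<and> is_plus T i Y (Suc k, j')}"
  have fin: "finite ?S"
    by (rule finite_subset[of _ "{..<col_eps T i (Y (Suc k)) + col_phi T i (Y (Suc k))}"]) auto
  define h where "h q = (SOME p. cancels T i Y p q)" for q
  have h: "cancels T i Y (h q) q" if "q \<in> ?A" for q
  proof -
    have "is_minus T i Y q" using that by auto
    moreover have "q \<notin> sig_minus T i Y" using that no by auto
    ultimately show ?thesis unfolding h_def sig_minus_def by (auto intro: someI)
  qed
  have "card ?A \<le> card (Pair (Suc k) ` ?S)"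
  proof (rule card_inj_on_le)
    show "inj_on h ?A" by (rule inj_onI) (metis h cancels_right_unique)
    show "h ` ?A \<subseteq> Pair (Suc k) ` ?S"
    proof (rule image_subsetI)
      fix q assume q: "q \<in> ?A"
      have "left_of (Suc k, j) q" using q by auto
      then have "left_of (Suc k, j) (h q)" using sig_partner_right[OF x h[OF q]] by blast
      then show "h q \<in> Pair (Suc k) ` ?S" using cancels_D[OF h[OF q]] q by (cases "h q") auto
    qed
  qed (use fin in simp)
  then show ?thesis by (simp add: card_image inj_on_def)
qed

lemma young_wall_tail:
  assumes "young_wall T g Y"
  obtains N where "\<And>k. k \<ge> N \<Longrightarrow> Y k = g"
proof -
  have "finite (fst ` {(k, b). b \<in> (Y k - g) \<union> (g - Y k)})"
    using assms unfolding young_wall_def by blast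
  then obtain N where N: "\<And>k. k \<in> fst ` {(k, b). b \<in> (Y k - g) \<union> (g - Y k)} \<Longrightarrow> k < N"
    unfolding finite_nat_set_iff_bounded by blast
  have "Y k = g" if "k \<ge> N" for k
  proof (rule ccontr)
    assume "Y k \<noteq> g"
    then obtain b where "b \<in> (Y k - g) \<union> (g - Y k)" by blast
    then have "k \<in> fst ` {(k, b). b \<in> (Y k - g) \<union> (g - Y k)}"
      by (intro image_eqI[of _ _ "(k, b)"]) auto
    then show False using N that by force
  qed
  then show thesis using that by blast
qed

text \<open>The facts about single columns and neighbouring pairs on which the signature argument
  rests. \<open>balance\<close> is restricted to columns containing \<open>g\<close>, where the
  blocks outside \<open>g\<close> make up the whole difference of contents;
  \<open>energy_left\<close> and \<open>energy_right\<close> are the two cases of the tensor product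
  rule.\<close>

locale wall_model =
  fixes T :: "'l pattern" and g :: "'l column"
  assumes f_step: "young T y \<Longrightarrow> col_f T i y = Some y' \<Longrightarrow>
      young T y' \<and> (\<exists>b. b \<notin> y \<and> bcol T b = i \<and> y' = insert b y) \<and> col_e T i y' = Some y \<and>
      col_eps T i y' = Suc (col_eps T i y) \<and> col_phi T i y = Suc (col_phi T i y')"
    and e_step: "young T y \<Longrightarrow> col_e T i y = Some y' \<Longrightarrow> young T y' \<and> col_f T i y' = Some y"
    and f_None: "young T y \<Longrightarrow> col_f T i y = None \<longleftrightarrow> col_phi T i y = 0"
    and eps_g: "col_eps T i g = (if i = I0 then 1 else 0)"
    and phi_g: "col_phi T i g = (if i = I0 then 1 else 0)"
    and balance: "young T y \<Longrightarrow> g \<subseteq> y \<Longrightarrow> finite (y - g) \<Longrightarrow>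
      int (col_phi T i y) - int (col_eps T i y) =
        - (\<Sum>j\<in>UNIV. cartan T i j * int (card {b \<in> y - g. bcol T b = j}))"
    and energy_left: "young T y \<Longrightarrow> young T z \<Longrightarrow> col_f T i y = Some y' \<Longrightarrow>
      col_eps T i z < col_phi T i y \<Longrightarrow>
      energy T (cls T y', cls T z) = energy T (cls T y, cls T z) - (if i = I0 then 1 else 0)"
    and energy_right: "young T y \<Longrightarrow> young T z \<Longrightarrow> col_f T i z = Some z' \<Longrightarrow>
      col_phi T i y \<le> col_eps T i z \<Longrightarrow>
      energy T (cls T y, cls T z') = energy T (cls T y, cls T z) + (if i = I0 then 1 else 0)"
    and contains_g: "Y \<in> reduced_walls T g \<Longrightarrow> g \<subseteq> Y k"
begin

text \<open>
  The ground-state columns contribute \<open>-+\<close> each to the \<open>0\<close>-signature and nothing to the other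
  ones, so that all letters beyond the column \<open>N\<close> cancel and only the \<open>+\<close> of the column \<open>N\<close>
  has to be taken into account.
\<close>

lemma signature_count:
  assumes tail: "\<And>k. k \<ge> N \<Longrightarrow> Y k = g"
  shows "finite (sig_plus T i Y)" "finite (sig_minus T i Y)"
    "int (card (sig_plus T i Y)) - int (card (sig_minus T i Y)) =
       (if i = I0 then 1 else 0) + (\<Sum>k<N. int (col_phi T i (Y k)) - int (col_eps T i (Y k)))"
proof -
  let ?e = "\<lambda>k. col_eps T i (Y k)" and ?p = "\<lambda>k. col_phi T i (Y k)"
  define Z where "Z = (if i = I0 then {(N, 1::nat)} else {})"
  define A where "A = (SIGMA k:{..<N}. {?e k..<?e k + ?p k})"
  define B where "B = (SIGMA k:{..<N}. {..<?e k})"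
  have tail_plus: "is_plus T i Y (k, j) \<longleftrightarrow> i = I0 \<and> j = 1"
    and tail_minus: "is_minus T i Y (k, j) \<longleftrightarrow> i = I0 \<and> j = 0" if "k \<ge> N" for k j
    using tail[OF that] by (auto simp: eps_g phi_g)
  \<comment> \<open>In the tail these two letters are adjacent, so the condition on the letters
    between them is vacuous.\<close>
  have cancel: "cancels T i Y (Suc k, 1) (k, 0)" if "k \<ge> N" "i = I0" for k
  proof (rule cancels.intros)
    show "\<forall>r. (is_plus T i Y r \<or> is_minus T i Y r) \<and> left_of (Suc k, 1) r \<and> left_of r (k, 0) \<longrightarrow>
      (\<exists>s. left_of (Suc k, 1) s \<and> left_of s (k, 0) \<and> (cancels T i Y r s \<or> cancels T i Y s r))"
    proof (intro allI impI, elim conjE)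
      fix r assume r: "is_plus T i Y r \<or> is_minus T i Y r" "left_of (Suc k, 1) r" "left_of r (k, 0)"
      obtain k' j where [simp]: "r = (k', j)" by (cases r)
      have "k' = Suc k" "1 < j" using r by auto
      then show "\<exists>s. left_of (Suc k, 1) s \<and> left_of s (k, 0) \<and> (cancels T i Y r s \<or> cancels T i Y s r)"
        using r(1) tail_plus[of "Suc k" j] tail_minus[of "Suc k" j] that by auto
    qed
  qed (use that tail_plus[of "Suc k" 1] tail_minus[of k 0] in auto)
  have fin: "finite (Z \<union> A)" "finite B" unfolding Z_def A_def B_def by auto
  have plus_iff: "is_plus T i Y p \<longleftrightarrow> p \<in> Z \<union> A \<or> (\<exists>k\<ge>N. i = I0 \<and> p = (Suc k, 1))" for p
  proof (cases p)
    case (Pair k j)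
    show ?thesis
    proof (cases "k < N")
      case True
      then show ?thesis unfolding Pair Z_def A_def by auto
    next
      case False
      then have "k = N \<or> (\<exists>k'\<ge>N. k = Suc k')" by (cases k) (auto simp: not_less le_Suc_eq)
      then show ?thesis using tail_plus[of k j] False unfolding Pair Z_def A_def by auto
    qed
  qed
  have minus_iff: "is_minus T i Y q \<longleftrightarrow> q \<in> B \<or> (\<exists>k\<ge>N. i = I0 \<and> q = (k, 0))" for q
  proof (cases q)
    case (Pair k j)
    then show ?thesis using tail_minus[of k j] unfolding B_def by (cases "k < N") auto
  qed
  have minus_sub: "sig_minus T i Y \<subseteq> B"
    using cancel minus_iff unfolding sig_minus_def by blast
  have plus_sub: "sig_plus T i Y \<subseteq> Z \<union> A"
    using cancel plus_iff unfolding sig_plus_def by blast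
  show "finite (sig_plus T i Y)" "finite (sig_minus T i Y)"
    using plus_sub minus_sub fin finite_subset by blast+
  \<comment> \<open>Cancellation is a bijection between the cancelled letters of
    \<open>Z \<union> A\<close> and those of \<open>B\<close>, so discarding them leaves the
    difference of the two cardinalities unchanged.\<close>
  define A' where "A' = {p \<in> Z \<union> A. \<exists>q. cancels T i Y p q}"
  define B' where "B' = {q \<in> B. \<exists>p. cancels T i Y p q}"
  have to_B: "q \<in> B" if "p \<in> Z \<union> A" "cancels T i Y p q" for p q
  proof -
    have "left_of p q" "is_minus T i Y q" using cancels_D[OF that(2)] by auto
    then show ?thesis using that(1) minus_iff[of q] unfolding Z_def A_def by (auto split: if_splits)
  qed
  have to_A: "p \<in> Z \<union> A" if q: "q \<in> B" "cancels T i Y p q" for p q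
  proof (rule ccontr)
    assume "p \<notin> Z \<union> A"
    then obtain k where "k \<ge> N" "i = I0" "p = (Suc k, 1)"
      using cancels_D[OF q(2)] plus_iff[of p] by blast
    then have "q = (k, 0)" using cancel q(2) cancels_right_unique by blast
    then show False using q(1) \<open>k \<ge> N\<close> unfolding B_def by auto
  qed
  define h where "h p = (SOME q. cancels T i Y p q)" for p
  have h: "cancels T i Y p (h p)" if "p \<in> A'" for p
    using that unfolding A'_def h_def by (auto intro: someI)
  have "bij_betw h A' B'"
  proof (rule bij_betwI')
    show "(h p = h p') = (p = p')" if "p \<in> A'" "p' \<in> A'" for p p'
      using h[OF that(1)] h[OF that(2)] cancels_left_unique by metis
    show "h p \<in> B'" if "p \<in> A'" for p
      using h[OF that] to_B that unfolding A'_def B'_def by blast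
    show "\<exists>p\<in>A'. q = h p" if q: "q \<in> B'" for q
    proof -
      obtain p where p: "cancels T i Y p q" "q \<in> B" using q unfolding B'_def by blast
      then have "p \<in> A'" using to_A unfolding A'_def by blast
      then show ?thesis using h cancels_right_unique p by blast
    qed
  qed
  then have "card A' = card B'" by (rule bij_betw_same_card)
  moreover have "card (sig_plus T i Y) = card (Z \<union> A) - card A'"
  proof -
    have "sig_plus T i Y = (Z \<union> A) - A'"
      using plus_sub plus_iff unfolding A'_def sig_plus_def by blast
    moreover have "A' \<subseteq> Z \<union> A" unfolding A'_def by blast
    ultimately show ?thesis using fin(1) by (metis card_Diff_subset finite_subset)
  qed
  moreover have "card (sig_minus T i Y) = card B - card B'"
  proof -
    have "sig_minus T i Y = B - B'"
      using minus_sub minus_iff unfolding B'_def sig_minus_def by blast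
    moreover have "B' \<subseteq> B" unfolding B'_def by blast
    ultimately show ?thesis using fin(2) by (metis card_Diff_subset finite_subset)
  qed
  moreover have "card A' \<le> card (Z \<union> A)" "card B' \<le> card B"
    using fin by (auto intro!: card_mono simp: A'_def B'_def)
  moreover have "card (Z \<union> A) = (if i = I0 then 1 else 0) + (\<Sum>k<N. ?p k)"
  proof -
    have "card (Z \<union> A) = card Z + card A"
      by (rule card_Un_disjoint) (auto simp: Z_def A_def)
    then show ?thesis unfolding Z_def A_def by simp
  qed
  moreover have "card B = (\<Sum>k<N. ?e k)" unfolding B_def by simp
  ultimately show "int (card (sig_plus T i Y)) - int (card (sig_minus T i Y)) =
       (if i = I0 then 1 else 0) + (\<Sum>k<N. int (?p k) - int (?e k))"
    by (simp add: sum_subtractf of_nat_diff)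
qed

section \<open>Contents and weights of reduced walls\<close>

lemma reduced_D:
  assumes "Y \<in> reduced_walls T g"
  shows "young_wall T g Y" "young T (Y k)" "g \<subseteq> Y k"
    "finite (Y k - g)" "finite {(k, b). b \<in> Y k - g \<and> bcol T b = j}"
proof -
  show Y: "young_wall T g Y" using assms by (simp add: reduced_walls_def)
  then show "young T (Y k)" by (simp add: young_wall_def)
  show "g \<subseteq> Y k" using contains_g assms .
  have fin: "finite {(k, b). b \<in> (Y k - g) \<union> (g - Y k)}" using Y by (simp add: young_wall_def)
  then show "finite {(k, b). b \<in> Y k - g \<and> bcol T b = j}"
    by (rule finite_subset[rotated]) auto
  have "Y k - g \<subseteq> snd ` {(k, b). b \<in> (Y k - g) \<union> (g - Y k)}" by force
  then show "finite (Y k - g)" using fin finite_surj by blast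
qed

lemma sig_finite:
  assumes "Y \<in> reduced_walls T g"
  shows "finite (sig_plus T i Y)" "finite (sig_minus T i Y)"
  using young_wall_tail[OF reduced_D(1)[OF assms]] signature_count by metis+

text \<open>The columns contribute their balances, and the \<open>+\<close> left over at the border
  of the ground-state tail contributes the pairing with \<open>Lambda I0\<close>.\<close>

lemma phi_minus_eps:
  assumes Y: "Y \<in> reduced_walls T g"
  shows "int (card (sig_plus T i Y)) - int (card (sig_minus T i Y)) =
    (if i = I0 then 1 else 0) - (\<Sum>j\<in>UNIV. cartan T i j * int (added T g Y j))"
proof -
  obtain N where N: "\<And>k. k \<ge> N \<Longrightarrow> Y k = g" using young_wall_tail[OF reduced_D(1)[OF Y]] by blast
  have add: "int (added T g Y j) = (\<Sum>k<N. int (card {b \<in> Y k - g. bcol T b = j}))" for j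
  proof -
    have "{(k, b). b \<in> Y k - g \<and> bcol T b = j} = (SIGMA k:{..<N}. {b \<in> Y k - g. bcol T b = j})"
      using N by (auto simp: not_le[symmetric])
    moreover have "finite {b \<in> Y k - g. bcol T b = j}" for k
      by (rule finite_subset[OF _ reduced_D(4)[OF Y]]) auto
    ultimately show ?thesis unfolding added_def by simp
  qed
  have "(\<Sum>k<N. int (col_phi T i (Y k)) - int (col_eps T i (Y k))) =
      - (\<Sum>k<N. \<Sum>j\<in>UNIV. cartan T i j * int (card {b \<in> Y k - g. bcol T b = j}))"
    using balance[OF reduced_D(2,3,4)[OF Y]] by (simp add: sum_negf)
  also have "\<dots> = - (\<Sum>j\<in>UNIV. cartan T i j * int (added T g Y j))"
    unfolding add sum_distrib_left by (subst sum.swap) simp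
  finally show ?thesis using signature_count(3)[of N Y i, OF N] by simp
qed

lemma pair_h_wall_wt:
  "pair_h i (wall_wt T (Lambda I0) g Y) =
    (if i = I0 then 1 else 0) - (\<Sum>j\<in>UNIV. cartan T i j * int (added T g Y j))"
proof -
  have *: "fst (sum h S) i = (\<Sum>x\<in>S. fst (h x) i)" if "finite S" for h :: "idx \<Rightarrow> weight" and S
    using that by (induction rule: finite_induct) auto
  show ?thesis
    by (auto simp: pair_h_def wall_wt_def * Lambda_def wscale_def alpha_def mult.commute)
qed

lemma zero_content_insert:
  assumes "finite (y - g)" "g \<subseteq> y" "b \<notin> y"
  shows "zero_content T g (insert b y) = zero_content T g y + (if bcol T b = I0 then 1 else 0)"
proof -
  let ?S = "{b' \<in> y - g. bcol T b' = I0}"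
  have "finite ?S" by (rule finite_subset[OF _ assms(1)]) auto
  then have card: "card (insert b ?S) = Suc (card ?S)"
    by (rule card_insert_disjoint) (use assms in auto)
  have ins: "{b' \<in> insert b y - g. bcol T b' = I0} = (if bcol T b = I0 then insert b ?S else ?S)"
    using assms by auto
  have none: "{b' \<in> g - insert b y. bcol T b' = I0} = {}" "{b' \<in> g - y. bcol T b' = I0} = {}"
    using assms by auto
  show ?thesis
  proof (cases "bcol T b = I0")
    case True
    then have "int (card (if bcol T b = I0 then insert b ?S else ?S)) = int (card ?S) + 1"
      using card by simp
    then show ?thesis unfolding zero_content_def ins none using True by simp
  next
    case False
    then show ?thesis unfolding zero_content_def ins none by simp
  qed
qed

lemma wall_wt_insert:
  assumes Y: "Y \<in> reduced_walls T g" and b: "b \<notin> Y k" "bcol T b = i"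
  shows "wall_wt T lam g (Y(k := insert b (Y k))) = wall_wt T lam g Y - alpha (cartan T) i"
proof -
  let ?Y = "Y(k := insert b (Y k))"
  \<comment> \<open>A block of \<open>g\<close> would not be counted by \<open>added\<close>; but
    all blocks of \<open>g\<close> are already present in column \<open>k\<close>, so the new block
    is not one of them.\<close>
  have bg: "b \<notin> g" using b reduced_D(3)[OF Y, of k] by blast
  have set: "{(k', b'). b' \<in> ?Y k' - g \<and> bcol T b' = j} =
      (if j = i then insert (k, b) {(k', b'). b' \<in> Y k' - g \<and> bcol T b' = j}
       else {(k', b'). b' \<in> Y k' - g \<and> bcol T b' = j})" for j
    using b bg by (auto split: if_splits)
  have add: "added T g ?Y j = added T g Y j + (if j = i then 1 else 0)" for j
  proof -
    let ?S = "{(k', b'). b' \<in> Y k' - g \<and> bcol T b' = j}"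
    have "card (insert (k, b) ?S) = Suc (card ?S)"
      by (rule card_insert_disjoint[OF reduced_D(5)[OF Y]]) (use b in simp)
    then show ?thesis unfolding added_def set by (cases "j = i") (simp_all del: Diff_iff)
  qed
  have ws: "wscale (int (n + (if j = i then 1 else 0))) w = wscale (int n) w + (if j = i then w else 0)"
    for n j w by (auto simp: wscale_def algebra_simps prod_eq_iff fun_eq_iff)
  show ?thesis
    unfolding wall_wt_def add ws sum.distrib by simp
qed

lemma young_wall_upd:
  assumes Y: "young_wall T g Y" and y: "young T y" "finite ((y - Y k) \<union> (Y k - y))"
  shows "young_wall T g (Y(k := y))"
proof -
  have "{(k', b). b \<in> ((Y(k := y)) k' - g) \<union> (g - (Y(k := y)) k')} \<subseteq>
    {(k', b). b \<in> (Y k' - g) \<union> (g - Y k')} \<union> Pair k ` ((y - Y k) \<union> (Y k - y))"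
    by (auto split: if_splits)
  moreover have "finite \<dots>" using Y y(2) by (simp add: young_wall_def)
  ultimately have "finite {(k', b). b \<in> ((Y(k := y)) k' - g) \<union> (g - (Y(k := y)) k')}"
    by (rule finite_subset)
  then show ?thesis using Y y(1) by (simp add: young_wall_def)
qed

text \<open>Column \<open>k\<close> occurs in only two of the defining equations: as right factor
  next to column \<open>k + 1\<close>, and as left factor next to column \<open>k - 1\<close>. The
  second does not arise for \<open>k = 0\<close>. The opposite signs of the 0-content in the two
  hypotheses reflect these two roles.\<close>

lemma reduced_upd:
  assumes Y: "Y \<in> reduced_walls T g" and yw: "young_wall T g (Y(k := y))"
    and left: "energy T (cls T (Y (Suc k)), cls T y) - zero_content T g y =
      energy T (cls T (Y (Suc k)), cls T (Y k)) - zero_content T g (Y k)"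
    and right: "\<And>k'. k = Suc k' \<Longrightarrow>
      energy T (cls T y, cls T (Y k')) + zero_content T g y =
      energy T (cls T (Y k), cls T (Y k')) + zero_content T g (Y k)"
  shows "Y(k := y) \<in> reduced_walls T g"
proof -
  have red: "energy T (cls T (Y (Suc k)), cls T (Y k)) + zero_content T g (Y (Suc k)) - zero_content T g (Y k) = 0" for k
    using Y by (simp add: reduced_walls_def)
  have "energy T (cls T ((Y(k := y)) (Suc k')), cls T ((Y(k := y)) k'))
      + zero_content T g ((Y(k := y)) (Suc k')) - zero_content T g ((Y(k := y)) k') = 0" for k'
  proof -
    consider "k' = k" | "Suc k' = k" | "k' \<noteq> k" "Suc k' \<noteq> k" by blast
    then show ?thesis
    proof cases
      case 1 then show ?thesis using red[of k] left by simp
    next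
      case 2 then show ?thesis using red[of k'] right[of k'] by auto
    next
      case 3 then show ?thesis using red[of k'] by simp
    qed
  qed
  then show ?thesis using yw by (simp add: reduced_walls_def)
qed

section \<open>The operators on reduced walls\<close>

lemma wall_f_None: 
  assumes Y: "Y \<in> reduced_walls T g"
  shows "wall_f T i Y = None \<longleftrightarrow> sig_plus T i Y = {}"
proof -
  have "col_f T i (Y (GREATEST k. k \<in> fst ` sig_plus T i Y)) \<noteq> None" if ne: "sig_plus T i Y \<noteq> {}"
  proof -
    have "(GREATEST k. k \<in> fst ` sig_plus T i Y) \<in> fst ` sig_plus T i Y"
    proof (rule GreatestI_ex_nat)
      show "\<exists>k. k \<in> fst ` sig_plus T i Y" using ne by blast
      show "k \<le> Max (fst ` sig_plus T i Y)" if "k \<in> fst ` sig_plus T i Y" for k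
        using sig_finite(1)[OF Y] that by (intro Max_ge) auto
    qed
    then obtain j where "is_plus T i Y (GREATEST k. k \<in> fst ` sig_plus T i Y, j)"
      using sig_letters(1) by force
    then show ?thesis using f_None[OF reduced_D(2)[OF Y]] by auto
  qed
  then show ?thesis unfolding wall_f_def Let_def by auto
qed

lemma wall_f_Some:
  assumes Y: "Y \<in> reduced_walls T g" and f: "wall_f T i Y = Some Y'"
  obtains k y' where "Y' = Y(k := y')" "col_f T i (Y k) = Some y'"
    "(k, col_eps T i (Y k)) \<in> sig_plus T i Y"
    "\<And>p. p \<in> sig_plus T i Y \<Longrightarrow> \<not> left_of p (k, col_eps T i (Y k))"
proof -
  define k where "k = (GREATEST k. k \<in> fst ` sig_plus T i Y)"
  have ne: "sig_plus T i Y \<noteq> {}" using wall_f_None[OF Y] f by force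
  have bd: "k \<le> Max (fst ` sig_plus T i Y)" if "k \<in> fst ` sig_plus T i Y" for k
    using sig_finite(1)[OF Y] that by (intro Max_ge) auto
  have k: "k \<in> fst ` sig_plus T i Y"
    unfolding k_def by (rule GreatestI_ex_nat) (use ne bd in blast)+
  have kmax: "k' \<le> k" if "k' \<in> fst ` sig_plus T i Y" for k'
    unfolding k_def by (rule Greatest_le_nat) (use that bd in blast)+
  obtain y' where "Y' = Y(k := y')" "col_f T i (Y k) = Some y'"
    using f ne unfolding wall_f_def Let_def k_def by auto
  moreover have "(k, col_eps T i (Y k)) \<in> sig_plus T i Y"
    using k first_plus_of_column by force
  moreover have "\<not> left_of p (k, col_eps T i (Y k))" if "p \<in> sig_plus T i Y" for p
    using sig_letters(1)[OF that] kmax[OF imageI[OF that]] by (cases p) auto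
  ultimately show thesis using that by blast
qed

lemma wall_e_Some:
  assumes Y: "Y \<in> reduced_walls T g" and e: "wall_e T i Y = Some Y'"
  obtains k y' where "Y' = Y(k := y')" "col_e T i (Y k) = Some y'"
    "(k, col_eps T i (Y k) - 1) \<in> sig_minus T i Y" 
    "\<And>p. p \<in> sig_minus T i Y \<Longrightarrow> \<not> left_of (k, col_eps T i (Y k) - 1) p"
proof -
  define k where "k = (LEAST k. k \<in> fst ` sig_minus T i Y)"
  have ne: "sig_minus T i Y \<noteq> {}" using e unfolding wall_e_def by auto
  have k: "k \<in> fst ` sig_minus T i Y"
    unfolding k_def by (rule LeastI_ex) (use ne in blast)
  have kmin: "k \<le> k'" if "k' \<in> fst ` sig_minus T i Y" for k'
    unfolding k_def by (rule Least_le) (rule that)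
  obtain y' where "Y' = Y(k := y')" "col_e T i (Y k) = Some y'"
    using e ne unfolding wall_e_def Let_def k_def by auto
  moreover have "(k, col_eps T i (Y k) - 1) \<in> sig_minus T i Y"
    using k last_minus_of_column by force
  moreover have "\<not> left_of (k, col_eps T i (Y k) - 1) p" if "p \<in> sig_minus T i Y" for p
    using sig_letters(2)[OF that] kmin[OF imageI[OF that]] by (cases p) auto
  ultimately show thesis using that by blast
qed

text \<open>The sum of \<epsilon> and \<phi> of the column is preserved, so positions continue to
  name the same letters; only the letter at position \<epsilon>, formerly the first
  \<open>+\<close>, has become the last \<open>-\<close>.\<close>

lemma signature_after_f:
  assumes Y: "Y \<in> reduced_walls T g" and f: "col_f T i (Y k) = Some y'"
    and x: "(k, col_eps T i (Y k)) \<in> sig_plus T i Y"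
    and left: "\<And>p. p \<in> sig_plus T i Y \<Longrightarrow> \<not> left_of p (k, col_eps T i (Y k))"
  shows "sig_plus T i (Y(k := y')) = sig_plus T i Y - {(k, col_eps T i (Y k))}"
    "sig_minus T i (Y(k := y')) = insert (k, col_eps T i (Y k)) (sig_minus T i Y)"
proof -
  let ?Y = "Y(k := y')" and ?x = "(k, col_eps T i (Y k))"
  note step = f_step[OF reduced_D(2)[OF Y] f]
  have plus: "is_plus T i ?Y = (\<lambda>p. is_plus T i Y p \<and> p \<noteq> ?x)"
  proof
    fix p show "is_plus T i ?Y p = (is_plus T i Y p \<and> p \<noteq> ?x)"
      using step by (cases p) auto
  qed
  have minus: "is_minus T i ?Y = (\<lambda>p. is_minus T i Y p \<or> p = ?x)"
  proof
    fix p show "is_minus T i ?Y p = (is_minus T i Y p \<or> p = ?x)"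
      using step by (cases p) auto
  qed
  have can: "cancels T i ?Y = cancels T i Y"
    unfolding cancels_eq_mat plus minus
    by (rule brackets.mat_toggle_leftmost_plus[OF brackets_signature])
      (use x left in \<open>auto simp: sig_plus_eq\<close>)
  show "sig_plus T i ?Y = sig_plus T i Y - {?x}"
    unfolding sig_plus_def can plus by auto
  have "\<not> cancels T i Y p ?x" for p
    using cancels_D[of T i Y p ?x] sig_letters(1)[OF x] by auto
  then show "sig_minus T i ?Y = insert ?x (sig_minus T i Y)"
    unfolding sig_minus_def can minus by auto
qed

lemma signature_after_e:
  assumes Y: "Y \<in> reduced_walls T g" and e: "col_e T i (Y k) = Some y'"
    and x: "(k, col_eps T i (Y k) - 1) \<in> sig_minus T i Y"
    and right: "\<And>p. p \<in> sig_minus T i Y \<Longrightarrow> \<not> left_of (k, col_eps T i (Y k) - 1) p"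
  shows "sig_minus T i (Y(k := y')) = sig_minus T i Y - {(k, col_eps T i (Y k) - 1)}"
    "sig_plus T i (Y(k := y')) = insert (k, col_eps T i (Y k) - 1) (sig_plus T i Y)"
proof -
  let ?Y = "Y(k := y')" and ?x = "(k, col_eps T i (Y k) - 1)"
  note e' = e_step[OF reduced_D(2)[OF Y] e]
  note step = f_step[OF conjunct1[OF e'] conjunct2[OF e']]
  have plus: "is_plus T i ?Y = (\<lambda>p. is_plus T i Y p \<or> p = ?x)"
  proof
    fix p show "is_plus T i ?Y p = (is_plus T i Y p \<or> p = ?x)"
      using step by (cases p) auto
  qed
  have minus: "is_minus T i ?Y = (\<lambda>p. is_minus T i Y p \<and> p \<noteq> ?x)"
  proof
    fix p show "is_minus T i ?Y p = (is_minus T i Y p \<and> p \<noteq> ?x)"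
      using step by (cases p) auto
  qed
  have can: "cancels T i ?Y = cancels T i Y"
    unfolding cancels_eq_mat plus minus
    by (rule brackets.mat_toggle_rightmost_minus[OF brackets_signature])
      (use x right in \<open>auto simp: sig_minus_eq\<close>)
  show "sig_minus T i ?Y = sig_minus T i Y - {?x}"
    unfolding sig_minus_def can minus by auto
  have "\<not> cancels T i Y ?x q" for q
    using cancels_D[of T i Y ?x q] sig_letters(2)[OF x] by auto
  then show "sig_plus T i ?Y = insert ?x (sig_plus T i Y)"
    unfolding sig_plus_def can plus by auto
qed

lemma wall_f_step:
  assumes Y: "Y \<in> reduced_walls T g" and f: "wall_f T i Y = Some Y'"
  shows "Y' \<in> reduced_walls T g" "wall_wt T lam g Y' = wall_wt T lam g Y - alpha (cartan T) i"
    "card (sig_plus T i Y) = Suc (card (sig_plus T i Y'))"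
    "card (sig_minus T i Y') = Suc (card (sig_minus T i Y))"
    "wall_e T i Y' = Some Y"
proof -
  obtain k y' where Y': "Y' = Y(k := y')" and fk: "col_f T i (Y k) = Some y'"
    and x: "(k, col_eps T i (Y k)) \<in> sig_plus T i Y"
    and left: "\<And>p. p \<in> sig_plus T i Y \<Longrightarrow> \<not> left_of p (k, col_eps T i (Y k))"
    using wall_f_Some[OF Y f] by metis
  let ?x = "(k, col_eps T i (Y k))"
  note step = f_step[OF reduced_D(2)[OF Y] fk]
  then obtain b where b: "b \<notin> Y k" "bcol T b = i" "y' = insert b (Y k)" by blast
  note sig = signature_after_f[OF Y fk x left, folded Y']
  \<comment> \<open>No \<open>+\<close> of column \<open>k + 1\<close> survives, and the chosen
    letter follows all \<open>-\<close> of column \<open>k\<close>. Hence the right factor of these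
    two columns is the one acted upon.\<close>
  have "col_phi T i (Y (Suc k)) \<le> card {j'. j' < col_eps T i (Y k) \<and> j' < col_eps T i (Y k)}"
  proof (rule phi_le_of_uncancelled)
    show "(Suc k, j') \<notin> sig_plus T i Y" for j' using left[of "(Suc k, j')"] by auto
  qed (use x in auto)
  then have L: "col_phi T i (Y (Suc k)) \<le> col_eps T i (Y k)" by simp
  \<comment> \<open>The \<open>-\<close> of the next column are cancelled by \<open>+\<close> of
    column \<open>k\<close> after its first one, whence the strict inequality selecting the left
    factor.\<close>
  have R: "col_eps T i (Y k') < col_phi T i (Y k)" if k': "k = Suc k'" for k'
  proof -
    have "col_eps T i (Y k') \<le> card {j'. col_eps T i (Y k) < j' \<and> is_plus T i Y (Suc k', j')}"
    proof (rule eps_le_of_uncancelled)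
      show "(k', j') \<notin> sig_minus T i Y" for j'
        using sig_minus_left_of_plus[OF x, of "(k', j')"] k' by auto
    qed (use x k' in auto)
    also have "\<dots> \<le> card {col_eps T i (Y k)<..<col_eps T i (Y k) + col_phi T i (Y k)}"
      by (rule card_mono) (auto simp: k')
    also have "\<dots> < col_phi T i (Y k)" using sig_letters(1)[OF x] by auto
    finally show ?thesis .
  qed
  have yw: "young_wall T g Y'"
    unfolding Y' b(3)
    by (rule young_wall_upd[OF reduced_D(1)[OF Y]]) (use step b in \<open>auto simp: insert_Diff_if\<close>)
  have z: "zero_content T g y' = zero_content T g (Y k) + (if i = I0 then 1 else 0)"
    using zero_content_insert[OF reduced_D(4,3)[OF Y] b(1)] b by simp
  show "Y' \<in> reduced_walls T g"
    unfolding Y'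
  proof (rule reduced_upd[OF Y yw[unfolded Y']])
    show "energy T (cls T (Y (Suc k)), cls T y') - zero_content T g y' =
      energy T (cls T (Y (Suc k)), cls T (Y k)) - zero_content T g (Y k)"
      using energy_right[OF reduced_D(2)[OF Y] reduced_D(2)[OF Y] fk L] z by simp
    show "energy T (cls T y', cls T (Y k')) + zero_content T g y' =
      energy T (cls T (Y k), cls T (Y k')) + zero_content T g (Y k)" if "k = Suc k'" for k'
      using energy_left[OF reduced_D(2)[OF Y] reduced_D(2)[OF Y] fk R[OF that]] z by simp
  qed
  show "wall_wt T lam g Y' = wall_wt T lam g Y - alpha (cartan T) i"
    unfolding Y' b(3) by (rule wall_wt_insert[OF Y b(1,2)])
  show "card (sig_plus T i Y) = Suc (card (sig_plus T i Y'))"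
    using card.remove[OF sig_finite(1)[OF Y] x] sig by simp
  have "?x \<notin> sig_minus T i Y" using sig_letters(1)[OF x] sig_letters(2)[of ?x T i Y] by auto
  then show "card (sig_minus T i Y') = Suc (card (sig_minus T i Y))"
    using sig_finite(2)[OF Y] sig by simp
  \<comment> \<open>Every surviving \<open>-\<close> of the old wall stands left of the toggled
    letter, which thus becomes the rightmost \<open>-\<close> of the new wall.\<close>
  have "fst ` sig_minus T i Y' = insert k (fst ` sig_minus T i Y)" using sig by auto
  moreover have "k \<le> k'" if "k' \<in> fst ` sig_minus T i Y" for k'
    using that sig_minus_left_of_plus[OF x] by force
  ultimately have "(LEAST k. k \<in> fst ` sig_minus T i Y') = k"
    by (intro Least_equality) auto
  then show "wall_e T i Y' = Some Y"
    unfolding wall_e_def using sig(2) step by (simp add: Y')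
qed

lemma wall_e_step:
  assumes Y: "Y \<in> reduced_walls T g" and e: "wall_e T i Y = Some Y'"
  shows "Y' \<in> reduced_walls T g" "wall_f T i Y' = Some Y"
proof -
  obtain k y' where Y': "Y' = Y(k := y')" and ek: "col_e T i (Y k) = Some y'"
    and x: "(k, col_eps T i (Y k) - 1) \<in> sig_minus T i Y"
    and right: "\<And>p. p \<in> sig_minus T i Y \<Longrightarrow> \<not> left_of (k, col_eps T i (Y k) - 1) p"
    using wall_e_Some[OF Y e] by metis
  let ?x = "(k, col_eps T i (Y k) - 1)"
  note e' = e_step[OF reduced_D(2)[OF Y] ek]
  note fk = conjunct2[OF e']
  note step = f_step[OF e'[THEN conjunct1] fk]
  then obtain b where b: "b \<notin> y'" "bcol T b = i" "Y k = insert b y'" by blast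
  note sig = signature_after_e[OF Y ek x right, folded Y']
  \<comment> \<open>The chosen letter is the last \<open>-\<close> of its column, so only \<epsilon>
    minus one letters precede it. This is the value of \<epsilon> at \<open>y'\<close>, where the
    energy rule for the lowering operator is applied.\<close>
  have "col_phi T i (Y (Suc k)) \<le> card {j'. j' < col_eps T i (Y k) - 1 \<and> j' < col_eps T i (Y k)}"
  proof (rule phi_le_of_uncancelled)
    show "(Suc k, j') \<notin> sig_plus T i Y" for j'
      using sig_minus_left_of_plus[OF _ x, of "(Suc k, j')"] by auto
  qed (use x in auto)
  also have "\<dots> \<le> card {..<col_eps T i (Y k) - 1}" by (rule card_mono) auto
  finally have L: "col_phi T i (Y (Suc k)) \<le> col_eps T i y'" using step by simp
  have R: "col_eps T i (Y k') < col_phi T i y'" if k': "k = Suc k'" for k'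
  proof -
    have "col_eps T i (Y k') \<le> card {j'. col_eps T i (Y k) - 1 < j' \<and> is_plus T i Y (Suc k', j')}"
    proof (rule eps_le_of_uncancelled)
      show "(k', j') \<notin> sig_minus T i Y" for j' using right[of "(k', j')"] k' by auto
    qed (use x k' in auto)
    also have "\<dots> \<le> card {col_eps T i (Y k)..<col_eps T i (Y k) + col_phi T i (Y k)}"
      by (rule card_mono) (auto simp: k')
    also have "\<dots> < col_phi T i y'" using step by simp
    finally show ?thesis .
  qed
  have yw: "young_wall T g Y'"
    unfolding Y'
    by (rule young_wall_upd[OF reduced_D(1)[OF Y]]) (use e' b in \<open>auto simp: insert_Diff_if\<close>)
  have fin: "finite ((y' - g) \<union> (g - y'))"
  proof -
    have "(y' - g) \<union> (g - y') \<subseteq> insert b (Y k - g)" using b reduced_D(3)[OF Y, of k] by auto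
    then show ?thesis using reduced_D(4)[OF Y] finite_subset by blast
  qed
  \<comment> \<open>Reducedness of the new wall, and with it \<open>g \<subseteq> y'\<close>, is not
    yet available. The removed block may for the moment belong to \<open>g\<close>; the signed count
    \<open>zero_content\<close> changes by the same amount in that case.\<close>
  have z: "zero_content T g (Y k) = zero_content T g y' + (if i = I0 then 1 else 0)"
  proof (cases "b \<in> g")
    case False
    then have "g \<subseteq> y'" using b reduced_D(3)[OF Y, of k] by auto
    then show ?thesis using zero_content_insert[of y' b] fin b by simp
  next
    case True
    let ?S = "{b' \<in> g - Y k. bcol T b' = I0}"
    have "finite ?S" by (rule finite_subset[OF _ fin]) (use b in auto)
    then have "card (insert b ?S) = Suc (card ?S)"
      by (rule card_insert_disjoint) (use b in simp)
    moreover have "{b' \<in> g - y'. bcol T b' = I0} = (if i = I0 then insert b ?S else ?S)"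
      using True b by auto
    moreover have "Y k - g = y' - g" using b True by auto
    ultimately show ?thesis using b by (simp add: zero_content_def del: Diff_iff)
  qed
  show red: "Y' \<in> reduced_walls T g"
    unfolding Y'
  proof (rule reduced_upd[OF Y yw[unfolded Y']])
    show "energy T (cls T (Y (Suc k)), cls T y') - zero_content T g y' =
      energy T (cls T (Y (Suc k)), cls T (Y k)) - zero_content T g (Y k)"
      using energy_right[OF reduced_D(2)[OF Y] e'[THEN conjunct1] fk L] z by simp
    show "energy T (cls T y', cls T (Y k')) + zero_content T g y' =
      energy T (cls T (Y k), cls T (Y k')) + zero_content T g (Y k)" if "k = Suc k'" for k'
      using energy_left[OF e'[THEN conjunct1] reduced_D(2)[OF Y] fk R[OF that]] z by simp
  qed
  have "fst ` sig_plus T i Y' = insert k (fst ` sig_plus T i Y)" using sig by auto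
  moreover have "k' \<le> k" if "k' \<in> fst ` sig_plus T i Y" for k'
    using that sig_minus_left_of_plus[OF _ x] by force
  ultimately have "(GREATEST k. k \<in> fst ` sig_plus T i Y') = k"
    by (intro Greatest_equality) auto
  then show "wall_f T i Y' = Some Y"
    unfolding wall_f_def using sig(2) e' by (simp add: Y')
qed

lemma affine_crystal_reduced_walls:
  "affine_crystal (cartan T) (reduced_walls T g) (wall_wt T (Lambda I0) g)
     (wall_e T) (wall_f T) (wall_eps T) (wall_phi T)"
  unfolding affine_crystal_def
proof (intro conjI allI ballI impI)
  fix i Y assume Y: "Y \<in> reduced_walls T g"
  show "wall_phi T i Y = zadd (wall_eps T i Y) (pair_h i (wall_wt T (Lambda I0) g Y))"
    using phi_minus_eps[OF Y, of i] by (simp add: wall_phi_def wall_eps_def pair_h_wall_wt)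
  show "wall_e T i Y = None" "wall_f T i Y = None" if "wall_phi T i Y = NegInf"
    using that by (simp_all add: wall_phi_def)
  fix Y'
  {
    assume f: "wall_f T i Y = Some Y'"
    note s = wall_f_step[OF Y f]
    show "Y' \<in> reduced_walls T g" by (rule s)
    show "wall_wt T (Lambda I0) g Y' = wall_wt T (Lambda I0) g Y - alpha (cartan T) i" by (rule s)
    show "wall_eps T i Y' = zadd (wall_eps T i Y) 1" "wall_phi T i Y' = zadd (wall_phi T i Y) (-1)"
      using s(3,4) by (simp_all add: wall_eps_def wall_phi_def)
  }
  {
    assume e: "wall_e T i Y = Some Y'"
    note Y' = wall_e_step[OF Y e]
    \<comment> \<open>The assertions about raising are those about lowering, read from the raised
      wall.\<close>
    note s = wall_f_step[OF Y']
    show "Y' \<in> reduced_walls T g" by (rule Y')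
    show "wall_wt T (Lambda I0) g Y' = wall_wt T (Lambda I0) g Y + alpha (cartan T) i"
      using s(2) by simp
    show "wall_eps T i Y' = zadd (wall_eps T i Y) (-1)" "wall_phi T i Y' = zadd (wall_phi T i Y) 1"
      using s(3,4) by (simp_all add: wall_eps_def wall_phi_def)
  }
next
  fix i Y Y' assume "Y \<in> reduced_walls T g" "Y' \<in> reduced_walls T g"
  then show "wall_f T i Y = Some Y' \<longleftrightarrow> wall_e T i Y' = Some Y"
    using wall_f_step(5) wall_e_step(2) by metis
qed

end

section \<open>Columns and their normal forms\<close>

definition shift :: "int \<Rightarrow> 'l block \<Rightarrow> 'l block" where
  "shift n b = (fst b, snd b + n)"

lemma shift_simps [simp]:
  "fst (shift n b) = fst b" "snd (shift n b) = snd b + n" "shift 0 b = b"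
  "shift m (shift n b) = shift (n + m) b"
  by (simp_all add: shift_def algebra_simps)

lemma shift_eq_iff: "shift n b = b' \<longleftrightarrow> b = shift (-n) b'"
  by (auto simp: shift_def)

lemma mem_sigma_pow [simp]: "b \<in> sigma_pow n y \<longleftrightarrow> shift (-n) b \<in> y"
proof -
  have "(\<lambda>(l, m). (l, m + n)) = shift n" by (auto simp: shift_def)
  moreover have "b \<in> shift n ` y" if "shift (-n) b \<in> y"
    by (rule image_eqI[OF _ that]) simp
  moreover have "shift (-n) b \<in> y" if mem: "b \<in> shift n ` y"
  proof -
    obtain b' where "b = shift n b'" "b' \<in> y" using mem by blast
    then show ?thesis by simp
  qed
  ultimately show ?thesis unfolding sigma_pow_def by metis
qed

lemma sigma_pow_sigma_pow [simp]: "sigma_pow m (sigma_pow n y) = sigma_pow (m + n) y"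
  by (auto simp: add.commute)

lemma sigma_pow_0 [simp]: "sigma_pow 0 y = y"
  by auto

lemma ex1_mem_iff: "(\<exists>!x. x \<in> A) \<longleftrightarrow> (\<exists>x. A = {x})"
  by auto

lemma eq_sigma_pow_1:
  assumes "\<And>l m. (l, m) \<in> y \<longleftrightarrow> (l, m - 1) \<in> z" shows "y = sigma_pow 1 z"
  using assms by (auto simp: shift_def)

lemma insert_sigma_pow: "insert b (sigma_pow n y) = sigma_pow n (insert (shift (-n) b) y)"
  by (auto simp: shift_eq_iff)

lemma sigma_pow_insert: "sigma_pow n (insert b y) = insert (shift n b) (sigma_pow n y)"
  by (simp add: insert_sigma_pow)

lemma sigma_pow_remove: "sigma_pow n y - {b} = sigma_pow n (y - {shift (-n) b})"
  by (auto simp: shift_eq_iff)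

definition idx_list :: "idx list" where
  "idx_list = [I0, I1, I2, I3, I4]"

lemma set_idx_list: "set idx_list = UNIV"
  by (simp add: idx_list_def UNIV_idx)

lemma list_all_UNIV: "set xs = UNIV \<Longrightarrow> list_all P xs \<Longrightarrow> P x"
  by (simp add: list_all_iff)

text \<open>
  The support of the blocks of index \<open>0\<close> is given by a list of letters and index offsets.
  Finite lists \<open>xs\<close> of blocks of index at least \<open>-1\<close> stand for the columns consisting of \<open>xs\<close>
  and all blocks of index at most \<open>-2\<close>.
\<close>

locale block_data =
  fixes col :: "'l \<Rightarrow> idx" and lev :: "'l \<Rightarrow> int" and rl :: "'l \<Rightarrow> ('l \<times> int) list"
begin

definition rests :: "'l block \<Rightarrow> 'l block list" where
  "rests b = map (\<lambda>(l, k). (l, snd b + k)) (rl (fst b))"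

definition supported :: "'l block list \<Rightarrow> 'l block \<Rightarrow> bool" where
  "supported xs b = list_all (\<lambda>r. snd r \<le> -2 \<or> r \<in> set xs) (rests b)"

definition unloaded :: "'l block list \<Rightarrow> 'l block \<Rightarrow> bool" where
  "unloaded xs b = list_all (\<lambda>b'. b \<notin> set (rests b')) xs"

definition topmost :: "'l block list \<Rightarrow> 'l block \<Rightarrow> bool" where
  "topmost xs b = list_all (\<lambda>b'. 4 * snd b' + lev (fst b') \<le> 4 * snd b + lev (fst b)) xs"

definition exc :: "'l block list \<Rightarrow> bool" where
  "exc xs = (length (filter (\<lambda>b. if col (fst b) = I2 then
       if topmost xs b then unloaded xs b else False else False) xs) = 1 \<and>
     list_ex (\<lambda>b. if col (fst b) = I1 then unloaded xs b else False) xs)"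

definition list_col :: "'l block list \<Rightarrow> 'l column" where
  "list_col xs = {b. snd b \<le> -2} \<union> set xs"

fun exts :: "'l block list \<Rightarrow> 'l block list \<Rightarrow> 'l block list list" where
  "exts [] xs = [xs]"
| "exts (b # bs) xs = (if supported xs b then exts bs xs @ exts bs (b # xs) else exts bs xs)"

definition below_step :: "'l block list \<Rightarrow> 'l block list" where
  "below_step xs = remdups (xs @ filter (\<lambda>b. -1 \<le> snd b) (concat (map rests xs)))"

text \<open>The list \<open>ls\<close> of letters is used only for its length, as a bound for the depth of the search.\<close>

definition below :: "'l list \<Rightarrow> 'l block \<Rightarrow> 'l block list" where
  "below ls b = fold (\<lambda>_. below_step) ls [b]"

text \<open>These checks confine a column whose highest anchor block has index -1. The anchor of
  index \<open>m\<close> forces every letter of index \<open>m - 1\<close>, and every letter of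
  index \<open>m\<close> forces the anchor of index \<open>m - 1\<close>; so all indices up to -2
  are full and none above 0 occurs. A letter of index 0 that is not a candidate would force the
  anchor of index 0.\<close>

definition anchor_ok :: "'l \<Rightarrow> 'l block list \<Rightarrow> 'l block list \<Rightarrow> 'l list \<Rightarrow> bool" where
  "anchor_ok anc base cand ls = (list_all (\<lambda>l. (l, -1) \<in> set (below ls (anc, 0)) \<and>
       (l, -1) \<in> set (base @ cand) \<and> (anc, -1) \<in> set (below ls (l, 0)) \<and>
       ((l, 0) \<in> set cand \<or> (anc, 0) \<in> set (below ls (l, 0)))) ls \<and>
     list_all (\<lambda>b. (fst b, snd b + 1) \<in> set (below ls (anc, 0))) base)"

definition letter_ok :: "'l list \<Rightarrow> 'l list \<Rightarrow> 'l \<Rightarrow> bool" where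
  "letter_ok caps ls l = (rl l \<noteq> [] \<and>
     list_all (\<lambda>(l', k). (k = 0 \<or> k = -1) \<and> (l', k) \<noteq> (l, 0)) (rl l) \<and>
     0 \<le> lev l \<and> lev l \<le> 3 \<and>
     (list_ex (\<lambda>l'. (l, 0) \<in> set (rl l')) ls \<or> list_ex (\<lambda>l'. (l, -1) \<in> set (rl l')) caps))"

text \<open>The letters of one period of the pattern, counted by colour, are the coefficients of the
  null root \<delta>: they are annihilated by the Cartan matrix, and the coefficient of the 0-th
  simple root is 1.\<close>

definition null_ok :: "(idx \<Rightarrow> idx \<Rightarrow> int) \<Rightarrow> 'l list \<Rightarrow> bool" where
  "null_ok A ls = (list_all (\<lambda>i. sum_list (map (\<lambda>j.
       A i j * int (length (filter (\<lambda>l. col l = j) ls))) idx_list) = 0) idx_list \<and>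
     length (filter (\<lambda>l. col l = I0) ls) = 1)"

definition windowed :: "'l list \<Rightarrow> 'l block list \<Rightarrow> bool" where
  "windowed caps xs \<longleftrightarrow> distinct xs \<and> (\<forall>b\<in>set xs. -1 \<le> snd b) \<and> (\<forall>l\<in>set caps. (l, -1) \<in> set xs)"

fun topological :: "'l block list \<Rightarrow> bool" where
  "topological [] = True"
| "topological (b # bs) = (list_all (\<lambda>r. r \<notin> set (b # bs)) (rests b) \<and> topological bs)"

end

locale shift_pattern = block_data "colour T" "level T" rl
  for T :: "'l pattern" and rl :: "'l \<Rightarrow> ('l \<times> int) list" +
  fixes caps ls :: "'l list"
  assumes rests_on: "rests_on T b = set (rests b)"
    and ls: "set ls = UNIV" "distinct ls"
    and letter_ok: "list_all (letter_ok caps ls) ls"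
begin

abbreviation "window \<equiv> windowed caps"

lemma
  shows offsets: "(l', k) \<in> set (rl l) \<Longrightarrow> k = 0 \<or> k = -1"
    and rl_nonempty: "rl l \<noteq> []"
    and rl_irrefl: "(l, 0) \<notin> set (rl l)"
    and level_range: "0 \<le> level T l" "level T l \<le> 3"
    and capped: "(\<exists>l'. (l, 0) \<in> set (rl l')) \<or> (\<exists>l' \<in> set caps. (l, -1) \<in> set (rl l'))"
  using list_all_UNIV[OF ls(1) letter_ok, of l] unfolding letter_ok_def list_all_iff list_ex_iff
  by auto

lemma mem_rests: "(l, m) \<in> set (rests b) \<longleftrightarrow> (l, m - snd b) \<in> set (rl (fst b))"
  unfolding rests_def by force

lemma mem_rests_shift: "shift n r \<in> set (rests (shift n b)) \<longleftrightarrow> r \<in> set (rests b)"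
  by (cases r) (simp add: mem_rests shift_def)

lemma row_shift [simp]: "row T (shift n b) = row T b + 4 * n"
  by (simp add: row_def)

lemma bcol_shift [simp]: "bcol T (shift n b) = bcol T b"
  by (simp add: bcol_def)

section \<open>Invariance of Young columns under the shift\<close>

lemma pre_young_iff:
  "pre_young T y \<longleftrightarrow> y \<noteq> {} \<and> bdd_above (row T ` y) \<and> (\<forall>b\<in>y. set (rests b) \<subseteq> y)"
  by (simp add: pre_young_def rests_on)

lemma pre_young_D: "pre_young T y \<Longrightarrow> b \<in> y \<Longrightarrow> r \<in> set (rests b) \<Longrightarrow> r \<in> y"
  by (auto simp: pre_young_iff)

lemma below_mem:
  assumes y: "pre_young T y" and "shift m b \<in> y" "b' \<in> set (below ks b)"
  shows "shift m b' \<in> y"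
proof -
  have step: "shift m b' \<in> y"
    if "\<forall>b\<in>set xs. shift m b \<in> y" "b' \<in> set (below_step xs)" for xs b'
  proof -
    from that(2) consider "b' \<in> set xs" | b where "b \<in> set xs" "b' \<in> set (rests b)"
      by (auto simp: below_step_def)
    then show ?thesis
    proof cases
      case 1
      then show ?thesis using that(1) by blast
    next
      case 2
      then have "shift m b' \<in> set (rests (shift m b))" by (simp only: mem_rests_shift)
      then show ?thesis using pre_young_D[OF y] that(1) 2(1) by blast
    qed
  qed
  have "\<forall>b'\<in>set (fold (\<lambda>_. below_step) ks xs). shift m b' \<in> y"
    if "\<forall>b\<in>set xs. shift m b \<in> y" for xs
    using that
  proof (induction ks arbitrary: xs)
    case (Cons k ks)
    have "\<forall>b\<in>set (below_step xs). shift m b \<in> y" using step[OF Cons.prems] by blast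
    from Cons.IH[OF this] show ?case by simp
  qed simp
  from this[of "[b]"] show ?thesis using assms(2,3) unfolding below_def by auto
qed

lemma pre_young_sigma_pow_imp:
  assumes "pre_young T y" shows "pre_young T (sigma_pow n y)"
  unfolding pre_young_iff
proof (intro conjI ballI subsetI)
  obtain b where "b \<in> y" using assms by (auto simp: pre_young_iff)
  then have "shift n b \<in> sigma_pow n y" by simp
  then show "sigma_pow n y \<noteq> {}" by blast
  obtain M where "\<And>b. b \<in> y \<Longrightarrow> row T b \<le> M"
    using assms by (auto simp: pre_young_iff bdd_above_def)
  then have "row T b \<le> M + 4 * n" if "b \<in> sigma_pow n y" for b
    using that by fastforce
  then show "bdd_above (row T ` sigma_pow n y)" by (rule bdd_aboveI2)
next
  fix b r assume b: "b \<in> sigma_pow n y" and r: "r \<in> set (rests b)"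
  have "shift (-n) r \<in> set (rests (shift (-n) b))" using r by (simp only: mem_rests_shift)
  then show "r \<in> sigma_pow n y" using pre_young_D[OF assms] b by auto
qed

lemma pre_young_sigma_pow [simp]: "pre_young T (sigma_pow n y) \<longleftrightarrow> pre_young T y"
  using pre_young_sigma_pow_imp[of "sigma_pow n y" "-n"] pre_young_sigma_pow_imp[of y n] by auto

lemma free_block_sigma_pow [simp]:
  "free_block T (sigma_pow n y) b \<longleftrightarrow> free_block T y (shift (-n) b)"
  by (simp add: free_block_def sigma_pow_remove)

lemma top_row_iff:
  assumes "pre_young T y" "b \<in> y"
  shows "row T b = top_row T y \<longleftrightarrow> (\<forall>b'\<in>y. row T b' \<le> row T b)"
proof -
  obtain M where M: "\<And>b. b \<in> y \<Longrightarrow> row T b \<le> M"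
    using assms by (auto simp: pre_young_iff bdd_above_def)
  \<comment> \<open>Rows are integers bounded only above; a highest block is one whose distance to
    the bound, a natural number, is least.\<close>
  obtain t where t: "t \<in> y" "\<And>b'. b' \<in> y \<Longrightarrow> nat (M - row T t) \<le> nat (M - row T b')"
    using ex_has_least_nat[of "\<lambda>b. b \<in> y" b "\<lambda>b. nat (M - row T b)"] assms(2) by blast
  have t': "row T b' \<le> row T t" if "b' \<in> y" for b'
    using t(2)[OF that] M[OF that] M[OF t(1)] by linarith
  have "top_row T y = row T t"
    unfolding top_row_def by (rule Greatest_equality) (use t(1) t' in auto)
  then show ?thesis using t(1) t' assms(2) by (metis order_antisym)
qed

text \<open>Comparing rows pairwise rather than with \<open>top_row\<close> gives a form that is
  unaffected by a common translation of all rows and can be tested on finite lists.\<close>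

lemma exceptional_iff:
  assumes "pre_young T y"
  shows "exceptional T y \<longleftrightarrow>
    (\<exists>!b. free_block T y b \<and> bcol T b = I2 \<and> (\<forall>b'\<in>y. row T b' \<le> row T b)) \<and>
    (\<exists>b. free_block T y b \<and> bcol T b = I1)"
proof -
  have "(free_block T y b \<and> bcol T b = I2 \<and> row T b = top_row T y) \<longleftrightarrow>
    (free_block T y b \<and> bcol T b = I2 \<and> (\<forall>b'\<in>y. row T b' \<le> row T b))" for b
    using top_row_iff[OF assms, of b] by (auto simp: free_block_def)
  then show ?thesis unfolding exceptional_def by simp
qed

lemma exceptional_sigma_pow_imp:
  assumes "pre_young T y" "exceptional T y" shows "exceptional T (sigma_pow n y)"
proof -
  let ?P = "\<lambda>y b. free_block T y b \<and> bcol T b = I2 \<and> (\<forall>b'\<in>y. row T b' \<le> row T b)"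
  have P: "?P (sigma_pow n y) b \<longleftrightarrow> ?P y (shift (-n) b)" for b
  proof -
    have "(\<forall>b'\<in>sigma_pow n y. row T b' \<le> row T b) \<longleftrightarrow> (\<forall>b'\<in>y. row T b' \<le> row T (shift (-n) b))"
    proof
      assume A: "\<forall>b'\<in>sigma_pow n y. row T b' \<le> row T b"
      have "row T (shift n b') \<le> row T b" if "b' \<in> y" for b'
        using bspec[OF A, of "shift n b'"] that by simp
      then show "\<forall>b'\<in>y. row T b' \<le> row T (shift (-n) b)" by force
    next
      assume A: "\<forall>b'\<in>y. row T b' \<le> row T (shift (-n) b)"
      show "\<forall>b'\<in>sigma_pow n y. row T b' \<le> row T b" using A by fastforce
    qed
    then show ?thesis by simp
  qed
  obtain b where b: "?P y b" "\<And>b'. ?P y b' \<Longrightarrow> b' = b"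
    using assms exceptional_iff[OF assms(1)] by blast
  have "\<exists>!b. ?P (sigma_pow n y) b"
  proof (rule ex1I[of _ "shift n b"])
    show "?P (sigma_pow n y) (shift n b)" unfolding P using b(1) by simp
    show "b' = shift n b" if "?P (sigma_pow n y) b'" for b'
      using b(2)[OF that[unfolded P]] shift_eq_iff[of "-n" b' b] by simp
  qed
  moreover obtain b1 where "free_block T y b1 \<and> bcol T b1 = I1"
    using assms(2) unfolding exceptional_def by blast
  then have "free_block T (sigma_pow n y) (shift n b1) \<and> bcol T (shift n b1) = I1" by simp
  ultimately show ?thesis
    using exceptional_iff[of "sigma_pow n y"] assms(1) by (metis (no_types, lifting) pre_young_sigma_pow)
qed

lemma young_sigma_pow [simp]: "young T (sigma_pow n y) \<longleftrightarrow> young T y"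
proof -
  have "young T (sigma_pow n y)" if "young T y" for y n
    using exceptional_sigma_pow_imp[of "sigma_pow n y" "-n"] that unfolding young_def by auto
  from this[of y n] this[of "sigma_pow n y" "-n"] show ?thesis by auto
qed

lemma addable_sigma_pow [simp]: "addable T i (sigma_pow n y) b \<longleftrightarrow> addable T i y (shift (-n) b)"
  by (simp add: addable_def insert_sigma_pow del: sigma_pow_sigma_pow)

lemma removable_sigma_pow [simp]:
  "removable T i (sigma_pow n y) b \<longleftrightarrow> removable T i y (shift (-n) b)"
  by (simp add: removable_def sigma_pow_remove)

section \<open>Young columns given by finite lists\<close>

lemma pre_young_remove:
  assumes "pre_young T y" "b \<in> y" "y \<noteq> {b}"
  shows "pre_young T (y - {b}) \<longleftrightarrow> (\<forall>b'\<in>y. b \<notin> set (rests b'))"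
proof -
  have "b \<notin> set (rests b)" using rl_irrefl by (cases b) (simp add: mem_rests)
  moreover have "bdd_above (row T ` (y - {b}))"
    using assms(1) by (auto simp: pre_young_iff bdd_above_def)
  ultimately show ?thesis using assms unfolding pre_young_iff by blast
qed

lemma pre_young_insert:
  assumes "pre_young T y"
  shows "pre_young T (insert b y) \<longleftrightarrow> set (rests b) \<subseteq> insert b y"
proof -
  have "bdd_above (row T ` insert b y)" using assms by (simp add: pre_young_iff)
  then show ?thesis using assms unfolding pre_young_iff by auto
qed

lemma supported_iff: "supported xs b \<longleftrightarrow> set (rests b) \<subseteq> list_col xs"
  by (auto simp: supported_def list_col_def list_all_iff)

lemma pre_young_list_col: 
  "pre_young T (list_col xs) \<longleftrightarrow> (\<forall>b\<in>set xs. supported xs b)"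
proof -
  have "(undefined, -2) \<in> list_col xs" by (simp add: list_col_def)
  then have 1: "list_col xs \<noteq> {}" by blast
  have "list_col xs \<subseteq> {b. snd b \<le> -2} \<union> set xs" by (simp add: list_col_def)
  \<comment> \<open>The highest row of a block of index at most -2 is
    \<open>4 * (-2) + 3\<close>.\<close>
  moreover have "row T b \<le> -5" if "snd b \<le> -2" for b
    using that level_range(2)[of "fst b"] by (simp add: row_def)
  then have "bdd_above (row T ` {b. snd b \<le> -2})" by (intro bdd_aboveI[of _ "-5"]) auto
  ultimately have 2: "bdd_above (row T ` list_col xs)"
    by (simp add: list_col_def image_Un)
  have 3: "set (rests b) \<subseteq> list_col xs" if "snd b \<le> -2" for b
  proof -
    have "snd r \<le> -2" if "r \<in> set (rests b)" for r
      using that \<open>snd b \<le> -2\<close> offsets unfolding rests_def by fastforce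
    then show ?thesis by (auto simp: list_col_def)
  qed
  show ?thesis
    unfolding pre_young_iff supported_iff using 1 2 3 by (auto simp: list_col_def)
qed

lemma low_not_free:
  assumes "window xs" "snd b \<le> -2"
  obtains b' where "b' \<in> list_col xs" "b \<in> set (rests b')"
proof -
  obtain l m where b: "b = (l, m)" by (cases b)
  from capped[of l] consider l' where "(l, 0) \<in> set (rl l')"
    | l' where "l' \<in> set caps" "(l, -1) \<in> set (rl l')" by blast
  then show thesis
  proof cases
    case 1
    then show thesis using that[of "(l', m)"] assms b by (simp add: mem_rests list_col_def)
  next
    case 2
    \<comment> \<open>For \<open>m = -2\<close> the covering block has index -1 and is not present
      automatically; this is where the condition on \<open>caps\<close> in \<open>windowed\<close>
      enters.\<close>
    have "(l', m + 1) \<in> list_col xs"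
      using 2 assms b unfolding windowed_def list_col_def by (cases "m = -2") auto
    then show thesis using that[of "(l', m + 1)"] 2 b by (simp add: mem_rests)
  qed
qed

lemma free_block_list_col:
  assumes "window xs" "pre_young T (list_col xs)"
  shows "free_block T (list_col xs) b \<longleftrightarrow> b \<in> set xs \<and> unloaded xs b"
proof -
  have ne: "list_col xs \<noteq> {b}" 
  proof
    assume "list_col xs = {b}"
    moreover have "(undefined, -2) \<in> list_col xs" "(undefined, -3) \<in> list_col xs"
      by (simp_all add: list_col_def)
    ultimately show False by auto
  qed
  have *: "free_block T (list_col xs) b \<longleftrightarrow>
      b \<in> list_col xs \<and> (\<forall>b'\<in>list_col xs. b \<notin> set (rests b'))"
    unfolding free_block_def using pre_young_remove[OF assms(2) _ ne] by blast
  show ?thesis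
  proof (cases "snd b \<le> -2")
    case True
    obtain b' where "b' \<in> list_col xs" "b \<in> set (rests b')"
      using low_not_free[OF assms(1) True] by blast
    moreover have "b \<notin> set xs" using True assms(1) unfolding windowed_def by force
    ultimately show ?thesis unfolding * by blast
  next
    case False
    have "b \<notin> set (rests b')" if "snd b' \<le> -2" for b'
      using that False offsets unfolding rests_def by fastforce
    then show ?thesis using False unfolding * by (auto simp: list_col_def unloaded_def list_all_iff)
  qed
qed

lemma exceptional_list_col:
  assumes w: "window xs" and p: "pre_young T (list_col xs)"
  shows "exceptional T (list_col xs) \<longleftrightarrow> exc xs"
proof -
  have top: "(\<forall>b'\<in>list_col xs. row T b' \<le> row T b) \<longleftrightarrow> topmost xs b" if "b \<in> set xs" for b
  proof -
    have "-4 \<le> row T b"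
      using that w level_range(1)[of "fst b"] unfolding windowed_def row_def by fastforce
    moreover have "row T b' \<le> -5" if "snd b' \<le> -2" for b'
      using that level_range(2)[of "fst b'"] by (simp add: row_def)
    ultimately have "row T b' \<le> row T b" if "snd b' \<le> -2" for b'
      using that by fastforce
    then show ?thesis by (auto simp: list_col_def topmost_def list_all_iff row_def)
  qed
  let ?Q = "\<lambda>b. if colour T (fst b) = I2 then
       if topmost xs b then unloaded xs b else False else False"
  have "(free_block T (list_col xs) b \<and> bcol T b = I2 \<and> (\<forall>b'\<in>list_col xs. row T b' \<le> row T b)) \<longleftrightarrow>
      b \<in> {b \<in> set xs. ?Q b}" for b
    using top[of b] by (auto simp: free_block_list_col[OF w p] bcol_def)
  then have "(\<exists>!b. free_block T (list_col xs) b \<and> bcol T b = I2 \<and> (\<forall>b'\<in>list_col xs. row T b' \<le> row T b)) \<longleftrightarrow>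
      (\<exists>!b. b \<in> {b \<in> set xs. ?Q b})" by simp
  also have "\<dots> \<longleftrightarrow> (\<exists>b. {b \<in> set xs. ?Q b} = {b})" by (rule ex1_mem_iff)
  also have "\<dots> \<longleftrightarrow> card {b \<in> set xs. ?Q b} = 1" by (simp only: card_1_singleton_iff One_nat_def)
  also have "card {b \<in> set xs. ?Q b} = length (filter ?Q xs)"
    using w by (simp only: windowed_def distinct_length_filter Int_def Collect_conj_eq[symmetric])
      (simp add: conj_commute Int_def)
  finally have 1: "(\<exists>!b. free_block T (list_col xs) b \<and> bcol T b = I2 \<and>
      (\<forall>b'\<in>list_col xs. row T b' \<le> row T b)) \<longleftrightarrow> length (filter ?Q xs) = 1" .
  have 2: "(\<exists>b. free_block T (list_col xs) b \<and> bcol T b = I1) \<longleftrightarrow>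
      list_ex (\<lambda>b. if colour T (fst b) = I1 then unloaded xs b else False) xs"
    by (auto simp: free_block_list_col[OF w p] bcol_def list_ex_iff Bex_def split: if_splits)
  show ?thesis unfolding exceptional_iff[OF p] exc_def 1 2 ..
qed

lemma young_list_col:
  assumes "window xs"
  shows "young T (list_col xs) \<longleftrightarrow> (\<forall>b\<in>set xs. supported xs b) \<and> \<not> exc xs"
  using exceptional_list_col[OF assms] pre_young_list_col[of xs] unfolding young_def by blast

text \<open>In topological order the supports of a block precede it, so when a block of
  \<open>y\<close> is considered its supports have already been taken into \<open>xs\<close>. The
  test \<open>supported\<close> therefore never rejects a block of \<open>y\<close>.\<close>

lemma exts_complete:
  assumes "pre_young T y" "list_col xs \<subseteq> y" "y \<subseteq> list_col xs \<union> set bs" "topological bs"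
  shows "\<exists>ys\<in>set (exts bs xs). list_col ys = y"
  using assms(2-)
proof (induction bs arbitrary: xs)
  case Nil
  then show ?case by auto
next
  case (Cons b bs)
  show ?case
  proof (cases "b \<in> y")
    case True
    have "set (rests b) \<subseteq> list_col xs"
      using pre_young_D[OF assms(1) True] Cons.prems(2,3) by (auto simp: list_all_iff)
    then have "supported xs b" by (simp add: supported_iff)
    have "list_col (b # xs) \<subseteq> y" "y \<subseteq> list_col (b # xs) \<union> set bs"
      using Cons.prems True by (auto simp: list_col_def)
    from Cons.IH[OF this] show ?thesis using \<open>supported xs b\<close> Cons.prems(3) by auto
  next
    case False
    then have "y \<subseteq> list_col xs \<union> set bs" using Cons.prems by auto
    from Cons.IH[OF Cons.prems(1) this] show ?thesis using Cons.prems(3) by auto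
  qed
qed

end

section \<open>Tables of column classes\<close>

lemma iter_op_Suc: "iter_op F (Suc n) y = Option.bind (F y) (iter_op F n)"
proof -
  have "((\<lambda>x. Option.bind x F) ^^ n) None = None" by (induction n) auto
  then show ?thesis unfolding iter_op_def by (cases "F y") (simp_all add: funpow_Suc_right del: funpow.simps(2))
qed

text \<open>A counter that drops by one with each application and is 0 where \<open>F\<close> is
  undefined is the maximal number of applications. Thus \<phi> and \<epsilon> can be read from
  tables that are checked one arrow at a time.\<close>

lemma Max_iter_op:
  assumes closed: "\<And>y y'. S y \<Longrightarrow> F y = Some y' \<Longrightarrow> S y' \<and> h y = Suc (h y')"
    and stop: "\<And>y. S y \<Longrightarrow> F y = None \<Longrightarrow> h y = 0"
    and "S y"
  shows "Max {n. iter_op F n y \<noteq> None} = h y"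
proof -
  have "iter_op F n y \<noteq> None \<longleftrightarrow> n \<le> h y" for n
    using \<open>S y\<close>
  proof (induction n arbitrary: y)
    case 0
    then show ?case by (simp add: iter_op_def)
  next
    case (Suc n)
    show ?case
    proof (cases "F y")
      case None
      then show ?thesis using stop[OF Suc.prems] by (simp add: iter_op_Suc)
    next
      case (Some y')
      then show ?thesis using closed[OF Suc.prems Some] Suc.IH[of y'] by (simp add: iter_op_Suc)
    qed
  qed
  then have "{n. iter_op F n y \<noteq> None} = {..h y}" by auto
  then show ?thesis by (simp add: Max_eq_iff)
qed

lemma descend_const:
  assumes "A \<noteq> {}" "\<And>y. y \<in> A \<Longrightarrow> F y = v"
  shows "descend F A = v"
proof -
  have "F ` A = {v}" using assms by blast
  then show ?thesis by (simp add: descend_def)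
qed

text \<open>
  The classes of columns are named by the elements of a finite type, \<open>rep c\<close> being the list of
  blocks of a representative.  An entry \<open>fe c i = Some (b, c', s)\<close> means that \<open>f\<^sub>i\<close> adds
  the block \<open>b\<close> to the representative of \<open>c\<close> and gives that of \<open>c'\<close> shifted by \<open>s\<close>.
\<close>

locale class_data = block_data col lev rl
  for col :: "'l \<Rightarrow> idx" and lev :: "'l \<Rightarrow> int" and rl :: "'l \<Rightarrow> ('l \<times> int) list" +
  fixes W :: "'l block list"
    and rep :: "'c \<Rightarrow> 'l block list"
    and fe :: "'c \<Rightarrow> idx \<Rightarrow> ('l block \<times> 'c \<times> int) option"
    and ee :: "'c \<Rightarrow> idx \<Rightarrow> 'c option"
    and ph ep :: "'c \<Rightarrow> idx \<Rightarrow> nat"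
    and rc :: "idx \<Rightarrow> 'c option"
    and c0 :: 'c
    and H :: "'c \<Rightarrow> 'c \<Rightarrow> nat"
begin

section \<open>Finite certificates for the tables\<close>

definition memb :: "'c \<Rightarrow> 'l block \<Rightarrow> bool" where
  "memb c b = (snd b \<le> -2 \<or> b \<in> set (rep c))"

definition adds :: "idx \<Rightarrow> 'c \<Rightarrow> 'l block list" where
  "adds i c = filter (\<lambda>b. if col (fst b) = i then if b \<in> set (rep c) then False else
     if supported (rep c) b then \<not> exc (b # rep c) else False else False) W"

definition rems :: "idx \<Rightarrow> 'c \<Rightarrow> 'l block list" where
  "rems i c = filter (\<lambda>b. if col (fst b) = i then if unloaded (rep c) b
     then \<not> exc (removeAll b (rep c)) else False else False) (rep c)"

definition blk :: "idx \<Rightarrow> 'c \<Rightarrow> bool" where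
  "blk i c = list_ex (\<lambda>j. j \<noteq> i \<and> rc j = Some c) idx_list"

definition rw :: "'l block \<Rightarrow> int" where
  "rw b = 4 * snd b + lev (fst b)"

text \<open>Comparison on the indices -1, 0 and 1 suffices: below them both columns are full and
  above them both are empty, also after the shift \<open>s\<close>. The shift is 1 when the added
  block is the next anchor, so that the result has to be normalised again.\<close>

definition f_ok :: "idx \<Rightarrow> 'c \<Rightarrow> bool" where
  "f_ok i c = (case fe c i of
     None \<Rightarrow> (if blk i c then True else adds i c = []) \<and> ph c i = 0
   | Some (b, c', s) \<Rightarrow> \<not> blk i c \<and> b \<in> set (adds i c) \<and>
       list_all (\<lambda>b'. b' = b \<or> rw b' < rw b) (adds i c) \<and> (s = 0 \<or> s = 1) \<and>
       list_all (\<lambda>w. (w = b \<or> memb c w) = memb c' (fst w, snd w - s)) W \<and>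
       ee c' i = Some c \<and> ph c i = Suc (ph c' i) \<and> ep c' i = Suc (ep c i))"

definition e_ok :: "idx \<Rightarrow> 'c \<Rightarrow> bool" where
  "e_ok i c = (case ee c i of
     None \<Rightarrow> (if blk i c then True else rems i c = []) \<and> ep c i = 0
   | Some c' \<Rightarrow> \<not> blk i c \<and> (case fe c' i of None \<Rightarrow> False
     | Some (b, c'', s) \<Rightarrow> c'' = c \<and> (fst b, snd b - s) \<in> set (rems i c) \<and>
         list_all (\<lambda>b'. b' = (fst b, snd b - s) \<or> rw (fst b, snd b - s) < rw b') (rems i c)))"

definition rep_ok :: "'l \<Rightarrow> 'l list \<Rightarrow> 'c \<Rightarrow> bool" where
  "rep_ok anc caps c = (distinct (rep c) \<and> \<not> exc (rep c) \<and>
     list_all (\<lambda>b. -1 \<le> snd b \<and> snd b \<le> 0 \<and> supported (rep c) b) (rep c) \<and>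
     (anc, -1) \<in> set (rep c) \<and> (anc, 0) \<notin> set (rep c) \<and>
     list_all (\<lambda>l. (l, -1) \<in> set (rep c) \<and> \<not> unloaded (rep c) (l, -1)) caps)"

definition cnt :: "idx \<Rightarrow> 'c \<Rightarrow> int" where
  "cnt j c = int (length (filter (\<lambda>b. col (fst b) = j) (rep c)))"

text \<open>Contents are taken relative to the class \<open>c0\<close>, for which \<phi> and
  \<epsilon> agree. The shifts of the columns do not enter, because shifting changes the content by
  a multiple of the null root.\<close>

definition weight_ok :: "(idx \<Rightarrow> idx \<Rightarrow> int) \<Rightarrow> idx \<Rightarrow> 'c \<Rightarrow> bool" where
  "weight_ok A i c = (int (ph c i) - int (ep c i) =
     - sum_list (map (\<lambda>j. A i j * (cnt j c - cnt j c0)) idx_list))"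

text \<open>Containment in the representative of \<open>c\<close> of that of \<open>c0\<close> moved
  down by \<open>d\<close> index steps. For \<open>d \<ge> 2\<close> only indices up to -2 remain,
  which are full in every representative.\<close>

definition above_ok :: "'c \<Rightarrow> int \<Rightarrow> bool" where
  "above_ok c d = (if 2 \<le> d then True else if 0 \<le> d
     then list_all (\<lambda>w. memb c0 w \<longrightarrow> memb c (fst w, snd w - d)) W else False)"

text \<open>A column of class \<open>c\<close> and 0-content \<open>k\<close> lies
  \<open>cnt I0 c0 - cnt I0 c + k\<close> index steps above the ground-state column. The first
  clause settles \<open>k \<ge> 3\<close>, the second \<open>k = 2\<close>, and the third
  \<open>k = 1\<close>, where \<open>c0\<close> itself must be exempted.\<close>

definition ground_ok :: "'c \<Rightarrow> bool" where
  "ground_ok c = (cnt I0 c \<le> cnt I0 c0 + 1 \<and> above_ok c (cnt I0 c0 - cnt I0 c + 2) \<and>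
     (c = c0 \<or> above_ok c (cnt I0 c0 - cnt I0 c + 1)) \<and>
     (H c c0 = 0 \<longrightarrow> c = c0) \<and> (H c0 c = 0 \<longrightarrow> c = c0))"

definition energy_ok :: "idx \<Rightarrow> 'c \<Rightarrow> 'c \<Rightarrow> bool" where
  "energy_ok i a b = (if ep b i < ph a i
     then case fe a i of None \<Rightarrow> True
       | Some (_, a', _) \<Rightarrow> H a b = (if i = I0 then Suc (H a' b) else H a' b)
     else case fe b i of None \<Rightarrow> True
       | Some (_, b', _) \<Rightarrow> H a b' = (if i = I0 then Suc (H a b) else H a b))"

definition tf :: "idx \<Rightarrow> 'c \<times> 'c \<Rightarrow> ('c \<times> 'c) option" where
  "tf i p = (case p of (a, b) \<Rightarrow> if ep b i < ph a i
     then case fe a i of None \<Rightarrow> None | Some (_, a', _) \<Rightarrow> Some (a', b)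
     else case fe b i of None \<Rightarrow> None | Some (_, b', _) \<Rightarrow> Some (a, b'))"

definition te :: "idx \<Rightarrow> 'c \<times> 'c \<Rightarrow> ('c \<times> 'c) option" where
  "te i p = (case p of (a, b) \<Rightarrow> if ep b i \<le> ph a i
     then case ee a i of None \<Rightarrow> None | Some a' \<Rightarrow> Some (a', b)
     else case ee b i of None \<Rightarrow> None | Some b' \<Rightarrow> Some (a, b'))"

fun walk :: "(bool \<times> idx) list \<Rightarrow> 'c \<times> 'c \<Rightarrow> ('c \<times> 'c) option" where
  "walk [] p = Some p"
| "walk ((up, i) # ws) p = (case (if up then te i p else tf i p) of
     None \<Rightarrow> None | Some p' \<Rightarrow> walk ws p')"

text \<open>If \<open>ep a i = 0\<close> and \<open>ep b i \<le> ph a i\<close> for all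
  \<open>i \<noteq> I0\<close>, the pair cannot be raised classically and has to appear in
  \<open>paths\<close>. For all other pairs the sum of the two heights serves as termination
  measure.\<close>

definition connected_ok :: "('c \<Rightarrow> nat) \<Rightarrow> 'c list \<Rightarrow> (('c \<times> 'c) \<times> (bool \<times> idx) list) list \<Rightarrow> 'c \<Rightarrow> bool" where
  "connected_ok hgt cs paths a =
     (list_all (\<lambda>i. case ee a i of None \<Rightarrow> True | Some a' \<Rightarrow> hgt a' < hgt a) [I1, I2, I3, I4] \<and>
      (if list_ex (\<lambda>i. 0 < ep a i) [I1, I2, I3, I4] then True
       else list_all (\<lambda>b. if list_ex (\<lambda>i. ph a i < ep b i) [I1, I2, I3, I4] then True
         else (a, b) \<in> set (map fst paths)) cs))"

text \<open>An exceptional list met in the enumeration has to be a window, since only then is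
  \<open>exc\<close> known to describe an exceptional column. Distinctness is tested on membership
  patterns because representatives must differ as sets, not merely as lists.\<close>

definition columns_ok :: "(idx \<Rightarrow> idx \<Rightarrow> int) \<Rightarrow> 'l \<Rightarrow> 'l list \<Rightarrow> 'l block list \<Rightarrow> 'l block list \<Rightarrow> 'c list \<Rightarrow> bool" where
  "columns_ok A anc caps base cand cs \<longleftrightarrow> topological cand \<and>
     list_all (\<lambda>xs. if exc xs then windowed caps xs else xs \<in> rep ` set cs) (exts cand base) \<and>
     distinct (map (\<lambda>c. map (\<lambda>b. b \<in> set (rep c)) cand) cs) \<and>
     list_all (\<lambda>c. rep_ok anc caps c \<and>
       list_all (\<lambda>i. f_ok i c \<and> e_ok i c \<and> weight_ok A i c) idx_list) cs"

definition energies_ok :: "('c \<Rightarrow> nat) \<Rightarrow> 'c list \<Rightarrow> (('c \<times> 'c) \<times> (bool \<times> idx) list) list \<Rightarrow> bool" where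
  "energies_ok hgt cs paths \<longleftrightarrow>
     list_all (\<lambda>i. ph c0 i = (if i = I0 then 1 else 0) \<and> ep c0 i = (if i = I0 then 1 else 0)) idx_list \<and>
     H c0 c0 = 0 \<and> list_all ground_ok cs \<and>
     list_all (\<lambda>i. list_all (\<lambda>a. list_all (energy_ok i a) cs) cs) idx_list \<and>
     list_all (connected_ok hgt cs paths) cs \<and>
     list_all (\<lambda>(p, ws). walk ws p = Some (c0, c0)) paths"

end

text \<open>
  Columns are normalised by letting the highest block with the letter \<open>anc\<close> have index \<open>-1\<close>.  Of
  the blocks of index at least \<open>-1\<close>, a normalised column contains those in \<open>base\<close> and some of
  those in \<open>cand\<close>.  A block of index \<open>-2\<close> not carrying any block of the same index carries a
  block of index \<open>-1\<close> with a letter in \<open>caps\<close>, and so is never free.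
\<close>

locale column_model =
  shift_pattern T rl caps ls +
  class_data "colour T" "level T" rl W rep fe ee ph ep rc c0 H
  for T :: "'l pattern" and rl :: "'l \<Rightarrow> ('l \<times> int) list" and caps ls :: "'l list"
    and W :: "'l block list" and rep :: "'c \<Rightarrow> 'l block list"
    and fe :: "'c \<Rightarrow> idx \<Rightarrow> ('l block \<times> 'c \<times> int) option"
    and ee :: "'c \<Rightarrow> idx \<Rightarrow> 'c option"
    and ph ep :: "'c \<Rightarrow> idx \<Rightarrow> nat"
    and rc :: "idx \<Rightarrow> 'c option" and c0 :: 'c and H :: "'c \<Rightarrow> 'c \<Rightarrow> nat" +
  fixes anc :: 'l and base cand :: "'l block list"
    and cs :: "'c list" and hgt :: "'c \<Rightarrow> nat"
    and paths :: "(('c \<times> 'c) \<times> (bool \<times> idx) list) list"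
  assumes cs: "set cs = UNIV"
    and W: "set W = {b. snd b = -1 \<or> snd b = 0 \<or> snd b = 1}"
    and anchor_ok: "anchor_ok anc base cand ls"
    and y_r: "y_r T j = map_option (\<lambda>c. sigma_pow 1 (list_col (rep c))) (rc j)"
    and y_empty: "y_empty T = sigma_pow 1 (list_col (rep c0))"
    and null_ok: "null_ok (cartan T) ls"
    and columns_ok: "columns_ok (cartan T) anc caps base cand cs"
    and energies_ok: "energies_ok hgt cs paths"
begin

section \<open>Normal form of a column modulo the shift\<close>

lemma anchor_D:
  "(l, -1) \<in> set (below ls (anc, 0))" "(anc, -1) \<in> set (below ls (l, 0))"
  "(l, -1) \<in> set base \<or> (l, -1) \<in> set cand"
  "(l, 0) \<in> set cand \<or> (anc, 0) \<in> set (below ls (l, 0))"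
  "b \<in> set base \<Longrightarrow> (fst b, snd b + 1) \<in> set (below ls (anc, 0))"
  using anchor_ok ls(1) by (auto simp: anchor_ok_def list_all_iff)

lemma anchor_below:
  assumes y: "pre_young T y" and "(l, m) \<in> y" shows "(anc, m - 1) \<in> y"
  using below_mem[OF y, of m "(l, 0)" "(anc, -1)" ls] assms(2) anchor_D(2)
  by (simp add: shift_def add.commute)

lemma below_anchor:
  assumes y: "pre_young T y" and "(anc, m) \<in> y" "k < m" shows "(l, k) \<in> y"
proof -
  have step: "(l, m - 1) \<in> y" if "(anc, m) \<in> y" for l m
    using below_mem[OF y, of m "(anc, 0)" "(l, -1)" ls] that anchor_D(1)
    by (simp add: shift_def add.commute)
  have "(l, m - 1 - int n) \<in> y" for n l
  proof (induction n arbitrary: l)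
    case 0
    then show ?case using step[OF assms(2)] by simp
  next
    case (Suc n)
    then show ?case using step[OF Suc.IH] by (simp add: algebra_simps)
  qed
  from this[of l "nat (m - 1 - k)"] show ?thesis using assms(3) by simp
qed

lemma anchor_base:
  assumes y: "pre_young T y" and a: "(anc, -1) \<in> y" shows "list_col base \<subseteq> y"
proof
  fix b assume "b \<in> list_col base"
  then consider "snd b < -1" | "b \<in> set base" by (auto simp: list_col_def)
  then show "b \<in> y"
  proof cases
    case 1
    then show ?thesis using below_anchor[OF y a, of "snd b" "fst b"] by simp
  next
    case 2
    then show ?thesis
      using below_mem[OF y, of "-1" "(anc, 0)" "(fst b, snd b + 1)" ls] a anchor_D(5)[of b]
      by (simp add: shift_def)
  qed
qed

lemma anchor_cand:
  assumes y: "pre_young T y" and "(anc, 0) \<notin> y" shows "y \<subseteq> list_col base \<union> set cand"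
proof
  fix b assume b: "b \<in> y"
  obtain l m where lm: "b = (l, m)" by (cases b)
  have "m \<le> 0"
  proof (rule ccontr)
    assume "\<not> m \<le> 0"
    then have "m - 1 = 0 \<or> 0 < m - 1" by linarith
    then show False
      using anchor_below[OF y, of l m] below_anchor[OF y, of "m - 1" 0 anc] b lm assms(2) by auto
  qed
  then consider "m \<le> -2" | "m = -1" | "m = 0" by linarith
  then show "b \<in> list_col base \<union> set cand"
  proof cases
    case 1
    then show ?thesis by (simp add: lm list_col_def)
  next
    case 2
    then show ?thesis
      using anchor_D(3)[of l] by (auto simp: lm list_col_def)
  next
    case 3
    then show ?thesis
      using below_mem[OF y, of 0 "(l, 0)" "(anc, 0)" ls] anchor_D(4)[of l] b assms(2)
      by (auto simp: lm)
  qed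
qed

lemma
  shows topo: "topological cand"
    and complete: "list_all (\<lambda>xs. if exc xs then window xs else xs \<in> rep ` set cs) (exts cand base)"
    and rep_distinct: "distinct (map (\<lambda>c. map (\<lambda>b. b \<in> set (rep c)) cand) cs)"
    and class_ok: "list_all (\<lambda>c. rep_ok anc caps c \<and>
      list_all (\<lambda>i. f_ok i c \<and> e_ok i c \<and> weight_ok (cartan T) i c) idx_list) cs"
  using columns_ok unfolding columns_ok_def by blast+

lemma
  shows rep_ok: "rep_ok anc caps c"
    and f_ok: "f_ok i c" and e_ok: "e_ok i c" and weight_ok: "weight_ok (cartan T) i c"
  using list_all_UNIV[OF cs class_ok, of c]
    list_all_UNIV[OF set_idx_list, of "\<lambda>i. f_ok i c \<and> e_ok i c \<and> weight_ok (cartan T) i c" i]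
  by blast+

lemma rep_inj:
  assumes "set (rep c) = set (rep c')" shows "c = c'"
proof -
  have "inj_on (\<lambda>c. map (\<lambda>b. b \<in> set (rep c)) cand) (set cs)"
    using rep_distinct by (simp only: distinct_map)
  then show ?thesis using assms by (auto simp: cs inj_def)
qed

lemma
  shows ground: "ph c0 i = (if i = I0 then 1 else 0)" "ep c0 i = (if i = I0 then 1 else 0)"
      "H c0 c0 = 0" "ground_ok c"
    and energy_ok: "energy_ok i a b"
    and connected_ok: "connected_ok hgt cs paths a"
    and paths_ok: "list_all (\<lambda>(p, ws). walk ws p = Some (c0, c0)) paths"
  using energies_ok cs set_idx_list unfolding energies_ok_def list_all_iff by auto

definition colc :: "'c \<Rightarrow> int \<Rightarrow> 'l column" where
  "colc c n = sigma_pow n (list_col (rep c))"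

lemma rep_D:
  "window (rep c)" "(anc, -1) \<in> set (rep c)" "(anc, 0) \<notin> set (rep c)" "\<not> exc (rep c)"
  "b \<in> set (rep c) \<Longrightarrow> -1 \<le> snd b \<and> snd b \<le> 0 \<and> supported (rep c) b"
  "l \<in> set caps \<Longrightarrow> \<not> unloaded (rep c) (l, -1)"
  using rep_ok[of c] by (auto simp: rep_ok_def windowed_def list_all_iff)

lemma young_rep: "young T (list_col (rep c))"
  using young_list_col[OF rep_D(1)] rep_D(4,5) by blast

lemma young_colc: "young T (colc c n)"
  by (simp add: colc_def young_rep)

lemma pre_young_rep: "pre_young T (list_col (rep c))"
  using young_rep by (simp add: young_def)

lemma memb_iff: "memb c b \<longleftrightarrow> b \<in> list_col (rep c)"
  by (simp add: memb_def list_col_def)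

lemma anchor_colc: "(anc, m) \<in> colc c n \<longleftrightarrow> m \<le> n - 1"
proof -
  have "(anc, k) \<in> list_col (rep c) \<longleftrightarrow> k \<le> -1" for k
  proof -
    consider "k \<le> -2" | "k = -1" | "k = 0" | "k \<ge> 1" by linarith
    then show ?thesis using rep_D(2,3)[of c] rep_D(5)[of "(anc, k)" c]
      by cases (auto simp: list_col_def)
  qed
  then have "(anc, m) \<in> colc c n \<longleftrightarrow> m - n \<le> -1" by (simp only: colc_def mem_sigma_pow shift_def fst_conv snd_conv) simp
  then show ?thesis by linarith
qed

text \<open>The highest anchor block has index \<open>n - 1\<close> and so recovers the shift;
  undoing it leaves the representatives, which differ as sets for different classes.\<close>

lemma colc_inj: 
  assumes "colc c n = colc c' n'" shows "c = c' \<and> n = n'"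
proof -
  have "m \<le> n - 1 \<longleftrightarrow> m \<le> n' - 1" for m using assms anchor_colc by metis
  from this[of "n - 1"] this[of "n' - 1"] have n: "n = n'" by simp
  have "list_col (rep c) = sigma_pow (-n) (colc c n)" by (simp add: colc_def del: mem_sigma_pow)
  also have "\<dots> = list_col (rep c')" using assms n by (simp add: colc_def del: mem_sigma_pow)
  finally have eq: "list_col (rep c) = list_col (rep c')" .
  have "set (rep x) = {b \<in> list_col (rep x). -1 \<le> snd b}" for x
    using rep_D(5)[of _ x] by (auto simp: list_col_def)
  then have "set (rep c) = set (rep c')" using eq by simp
  then show ?thesis using rep_inj n by blast
qed

lemma young_colc_ex:
  assumes y: "young T y" obtains c n where "y = colc c n"
proof -
  have p: "pre_young T y" using y by (simp add: young_def)
  then obtain b where "b \<in> y" by (auto simp: pre_young_iff)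
  then have a: "(anc, snd b - 1) \<in> y" using anchor_below[OF p, of "fst b"] by simp
  obtain M where M: "\<And>b. b \<in> y \<Longrightarrow> row T b \<le> M"
    using p by (auto simp: pre_young_iff bdd_above_def)
  \<comment> \<open>A positive index is at most its row, so \<open>max M 0\<close> bounds the
    indices of all anchor blocks and a highest one exists.\<close>
  have le: "m \<le> M \<or> m \<le> 0" if "(anc, m) \<in> y" for m
    using M[OF that] level_range[of anc] by (simp add: row_def) linarith
  define K where "K = max M 0"
  obtain n where n: "(anc, n) \<in> y" "\<And>m. (anc, m) \<in> y \<Longrightarrow> nat (K - n) \<le> nat (K - m)"
    using ex_has_least_nat[of "\<lambda>m. (anc, m) \<in> y" _ "\<lambda>m. nat (K - m)"] a by blast
  have n': "(anc, n + 1) \<notin> y"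
    using n(2)[of "n + 1"] le[of "n + 1"] unfolding K_def by (auto simp: max_def split: if_splits)
  define y0 where "y0 = sigma_pow (- n - 1) y"
  have y0: "young T y0" using y by (simp add: y0_def)
  have p0: "pre_young T y0" using y0 by (simp add: young_def)
  have a0: "(anc, -1) \<in> y0" "(anc, 0) \<notin> y0" using n(1) n' by (simp_all add: y0_def shift_def add.commute)
  obtain ys where ys: "ys \<in> set (exts cand base)" "list_col ys = y0"
    using exts_complete[OF p0 anchor_base[OF p0 a0(1)] anchor_cand[OF p0 a0(2)] topo] by blast
  have "\<not> exc ys"
    using complete ys y0 young_list_col[of ys] by (auto simp: list_all_iff)
  then have "ys \<in> rep ` set cs" using complete ys(1) by (auto simp: list_all_iff)
  then obtain c where "ys = rep c" by blast
  moreover have "y = sigma_pow (n + 1) y0" by (simp add: y0_def del: mem_sigma_pow)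
  ultimately show thesis using that[of c "n + 1"] ys by (simp add: colc_def)
qed

lemma young_iff: "young T y \<longleftrightarrow> (\<exists>c n. y = colc c n)"
  using young_colc young_colc_ex by metis

definition Cl :: "'c \<Rightarrow> 'l column set" where
  "Cl c = range (colc c)"

lemma cls_colc: "cls T (colc c n) = Cl c"
proof -
  have "sigma_pow m (colc c n) = colc c (m + n)" for m by (simp add: colc_def del: mem_sigma_pow)
  then have "y' \<in> cls T (colc c n) \<longleftrightarrow> (\<exists>m. y' = colc c (m + n))" for y'
    by (auto simp: cls_def col_equiv_def young_colc)
  moreover have "(\<exists>m. y' = colc c (m + n)) \<longleftrightarrow> (\<exists>m. y' = colc c m)" for y'
    by (metis diff_add_cancel)
  ultimately show ?thesis by (auto simp: Cl_def)
qed

lemma Cl_inj: "Cl c = Cl c' \<longleftrightarrow> c = c'"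
  using colc_inj unfolding Cl_def by (metis rangeE rangeI)

lemma col_classes_eq: "col_classes T = range Cl"
proof -
  have "col_classes T = {cls T y | y. young T y}"
    by (auto simp: col_classes_def quotient_def cls_def)
  also have "\<dots> = range Cl" unfolding young_iff using cls_colc by (auto; metis)
  finally show ?thesis .
qed

lemma blocked_iff: "blocked T i (colc c n) \<longleftrightarrow> blk i c"
proof -
  have A: "(\<exists>r. y_r T j = Some r \<and> colc c n \<in> cls T r) \<longleftrightarrow> rc j = Some c" for j
  proof -
    have "colc c n \<in> cls T (sigma_pow 1 (list_col (rep c'))) \<longleftrightarrow> c' = c" for c'
      using cls_colc[of c' 1] unfolding colc_def[of c' 1] Cl_def by (auto dest: colc_inj)
    then show ?thesis by (cases "rc j") (auto simp: y_r)
  qed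
  have B: "list_ex P idx_list \<longleftrightarrow> (\<exists>j. P j)" for P
    by (simp add: list_ex_iff set_idx_list)
  have "blocked T i (colc c n) \<longleftrightarrow> (\<exists>j. j \<noteq> i \<and> (\<exists>r. y_r T j = Some r \<and> colc c n \<in> cls T r))"
    unfolding blocked_def by blast
  also have "\<dots> \<longleftrightarrow> (\<exists>j. j \<noteq> i \<and> rc j = Some c)" by (simp only: A)
  finally show ?thesis by (simp only: blk_def B)
qed

section \<open>Operators on normalised columns\<close>

lemma mem_W_cases:
  obtains "b \<in> set W" | "snd b \<le> -2" | "snd b \<ge> 2"
proof -
  have "snd b = -1 \<or> snd b = 0 \<or> snd b = 1 \<or> snd b \<le> -2 \<or> snd b \<ge> 2" by linarith
  then show thesis using that W by blast
qed

lemma supported_Cons: "supported xs b' \<Longrightarrow> supported (b # xs) b'"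
  by (auto simp: supported_def list_all_iff)

lemma supported_Cons_self: "supported (b # xs) b \<longleftrightarrow> supported xs b"
proof -
  have "b \<notin> set (rests b)" using rl_irrefl by (cases b) (simp add: mem_rests)
  then show ?thesis by (auto simp: supported_def list_all_iff)
qed

lemma addable_rep: "addable T i (list_col (rep c)) b \<longleftrightarrow> b \<in> set (adds i c)"
proof (cases "b \<in> list_col (rep c) \<or> snd b \<ge> 2")
  case True
  then show ?thesis
  proof
    assume b: "b \<in> list_col (rep c)"
    have "\<not> addable T i (list_col (rep c)) b" using b by (simp add: addable_def)
    moreover have "b \<notin> set (adds i c)" using b W by (auto simp: adds_def list_col_def)
    ultimately show ?thesis by blast
  next
    assume b: "snd b \<ge> 2"
    \<comment> \<open>Every block rests on some block of index at most one lower. One of index 2 or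
      more thus needs a support of index at least 1, which no representative contains.\<close>
    obtain l k where lk: "(l, k) \<in> set (rl (fst b))" using rl_nonempty[of "fst b"] by (cases "rl (fst b)") force+
    have "(l, snd b + k) \<in> set (rests b)" using lk by (simp add: mem_rests)
    moreover have "snd b + k \<ge> 1" using offsets[OF lk] b by auto
    then have "(l, snd b + k) \<notin> list_col (rep c)"
      using rep_D(5)[of "(l, snd b + k)" c] by (auto simp: list_col_def)
    moreover have "(l, snd b + k) \<noteq> b" using rl_irrefl[of l] lk by (cases b) auto
    ultimately have "\<not> pre_young T (insert b (list_col (rep c)))"
      using pre_young_insert[OF pre_young_rep] by blast
    then have "\<not> addable T i (list_col (rep c)) b" by (simp add: addable_def young_def)
    moreover have "b \<notin> set (adds i c)" using b W by (auto simp: adds_def)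
    ultimately show ?thesis by blast
  qed
next
  case False
  then have b: "b \<notin> set (rep c)" "-1 \<le> snd b" "b \<in> set W"
    using mem_W_cases[of b] by (auto simp: list_col_def)
  have win: "window (b # rep c)" using rep_D(1) b unfolding windowed_def by auto
  have ins: "insert b (list_col (rep c)) = list_col (b # rep c)" by (auto simp: list_col_def)
  have "young T (insert b (list_col (rep c))) \<longleftrightarrow> supported (rep c) b \<and> \<not> exc (b # rep c)"
    unfolding ins young_list_col[OF win]
    using rep_D(5) supported_Cons supported_Cons_self by auto
  then show ?thesis using b False by (auto simp: addable_def adds_def bcol_def)
qed

lemma removable_rep: "removable T i (list_col (rep c)) b \<longleftrightarrow> b \<in> set (rems i c)"
proof -
  let ?xs = "rep c"
  have free: "b \<in> set ?xs \<and> unloaded ?xs b" if "young T (list_col ?xs - {b})" "b \<in> list_col ?xs"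
  proof -
    have "free_block T (list_col ?xs) b" using that by (simp add: free_block_def young_def)
    then show ?thesis using free_block_list_col[OF rep_D(1) pre_young_rep] by blast
  qed
  have "young T (list_col ?xs - {b}) \<longleftrightarrow> \<not> exc (removeAll b ?xs)"
    if b: "b \<in> set ?xs" "unloaded ?xs b"
  proof -
    have eq: "list_col ?xs - {b} = list_col (removeAll b ?xs)"
      using rep_D(5)[OF b(1)] by (auto simp: list_col_def)
    \<comment> \<open>The blocks of index -1 with letters in \<open>caps\<close> all carry a block,
      so the removed free block is not among them and the shortened list remains a window.\<close>
    have win: "window (removeAll b ?xs)"
      using rep_D(1)[of c] rep_D(6)[of _ c] b(2) unfolding windowed_def
      by (auto simp: distinct_removeAll)
    have "pre_young T (list_col ?xs - {b})"
      using free_block_list_col[OF rep_D(1) pre_young_rep] b unfolding free_block_def by blast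
    then show ?thesis using exceptional_list_col[OF win] unfolding eq young_def by blast
  qed
  then show ?thesis using free by (auto simp: removable_def rems_def bcol_def list_col_def)
qed

lemma addable_colc: "addable T i (colc c n) b \<longleftrightarrow> shift (-n) b \<in> set (adds i c)"
  by (simp add: colc_def addable_rep)

lemma removable_colc: "removable T i (colc c n) b \<longleftrightarrow> shift (-n) b \<in> set (rems i c)"
  by (simp add: colc_def removable_rep)

lemma rw_eq: "rw b = row T b"
  by (simp add: rw_def row_def)

lemma fe_SomeD:
  assumes "fe c i = Some (b, c', s)"
  shows "\<not> blk i c" "b \<in> set (adds i c)" "b' \<in> set (adds i c) \<Longrightarrow> b' = b \<or> row T b' < row T b"
    "insert (shift n b) (colc c n) = colc c' (n + s)"
    "ee c' i = Some c" "ph c i = Suc (ph c' i)" "ep c' i = Suc (ep c i)"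
    "shift n b \<notin> colc c n" "bcol T b = i"
proof -
  have ok: "\<not> blk i c \<and> b \<in> set (adds i c) \<and>
       list_all (\<lambda>b'. b' = b \<or> rw b' < rw b) (adds i c) \<and> (s = 0 \<or> s = 1) \<and>
       list_all (\<lambda>w. (w = b \<or> memb c w) = memb c' (fst w, snd w - s)) W \<and>
       ee c' i = Some c \<and> ph c i = Suc (ph c' i) \<and> ep c' i = Suc (ep c i)"
    using f_ok[of i c] assms by (simp add: f_ok_def)
  then show "\<not> blk i c" "ee c' i = Some c" "ph c i = Suc (ph c' i)" "ep c' i = Suc (ep c i)"
    and badd: "b \<in> set (adds i c)" by blast+
  show "b' = b \<or> row T b' < row T b" if "b' \<in> set (adds i c)"
    using ok that by (auto simp: list_all_iff rw_eq)
  have "w \<in> insert b (list_col (rep c)) \<longleftrightarrow> shift (-s) w \<in> list_col (rep c')" for w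
  proof (cases w rule: mem_W_cases)
    case 1
    then show ?thesis using ok by (auto simp: list_all_iff memb_iff shift_def)
  next
    case 2
    then show ?thesis using ok by (auto simp: list_col_def)
  next
    case 3
    have "w \<noteq> b" using badd W 3 by (auto simp: adds_def)
    then show ?thesis using ok 3 rep_D(5)[of w c] rep_D(5)[of "shift (-s) w" c']
      by (auto simp: list_col_def)
  qed
  then have "insert b (list_col (rep c)) = sigma_pow s (list_col (rep c'))"
    by (intro set_eqI) (simp del: insert_iff)
  then have "sigma_pow n (insert b (list_col (rep c))) = colc c' (n + s)"
    by (simp add: colc_def del: mem_sigma_pow)
  then show "insert (shift n b) (colc c n) = colc c' (n + s)"
    by (simp add: colc_def sigma_pow_insert)
  have "addable T i (colc c n) (shift n b)" using badd by (simp add: addable_colc)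
  then show "shift n b \<notin> colc c n" "bcol T b = i" by (simp_all add: addable_def)
qed

lemma col_f_colc: "col_f T i (colc c n) = map_option (\<lambda>(b, c', s). colc c' (n + s)) (fe c i)"
proof (cases "fe c i")
  case None
  then have "blk i c \<or> adds i c = []" using f_ok[of i c] by (auto simp: f_ok_def split: if_splits)
  then show ?thesis unfolding col_f_def blocked_iff addable_colc using None by auto
next
  case (Some t)
  then obtain b c' s where t: "fe c i = Some (b, c', s)" by (cases t) auto
  note d = fe_SomeD[OF t]
  have add: "addable T i (colc c n) (shift n b)" using d(2) by (simp add: addable_colc)
  have other: "b' = shift n b \<or> row T b' < row T (shift n b)" if "addable T i (colc c n) b'" for b'
    using d(3)[of "shift (-n) b'"] that by (auto simp: addable_colc shift_eq_iff)
  have "arg_max (row T) (addable T i (colc c n)) = shift n b"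
    unfolding arg_max_def is_arg_max_def
  proof (rule some_equality)
    show "addable T i (colc c n) (shift n b) \<and>
        \<not> (\<exists>y. addable T i (colc c n) y \<and> row T (shift n b) < row T y)"
      using add other by (metis less_asym less_irrefl)
    show "x = shift n b" if "addable T i (colc c n) x \<and>
        \<not> (\<exists>y. addable T i (colc c n) y \<and> row T x < row T y)" for x
      using that add other by blast
  qed
  moreover have cond: "\<not> (blk i c \<or> \<not> (\<exists>b. addable T i (colc c n) b))" using add d(1) by blast
  ultimately show ?thesis
    unfolding col_f_def blocked_iff if_not_P[OF cond] using d(4)[of n] t by simp
qed

lemma ee_SomeD:
  assumes "ee c i = Some c'"
  obtains b s where "fe c' i = Some (b, c, s)" "\<not> blk i c" "shift (-s) b \<in> set (rems i c)"
    "\<And>b'. b' \<in> set (rems i c) \<Longrightarrow> b' = shift (-s) b \<or> row T (shift (-s) b) < row T b'"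
proof -
  have sh: "(fst b, snd b - s) = shift (-s) b" for b :: "'l block" and s by (simp add: shift_def)
  show thesis
    using e_ok[of i c] assms that unfolding e_ok_def sh rw_eq
    by (auto simp: list_all_iff split: option.splits)
qed

lemma col_e_colc:
  "col_e T i (colc c n) = (case ee c i of None \<Rightarrow> None
     | Some c' \<Rightarrow> map_option (\<lambda>(b, c'', s). colc c' (n - s)) (fe c' i))"
proof (cases "ee c i")
  case None
  then have "blk i c \<or> rems i c = []" using e_ok[of i c] by (auto simp: e_ok_def split: if_splits)
  then show ?thesis unfolding col_e_def blocked_iff removable_colc using None by auto
next
  case (Some c')
  obtain b s where t: "fe c' i = Some (b, c, s)" "\<not> blk i c" "shift (-s) b \<in> set (rems i c)"
    "\<And>b'. b' \<in> set (rems i c) \<Longrightarrow> b' = shift (-s) b \<or> row T (shift (-s) b) < row T b'"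
    using ee_SomeD[OF Some] by blast
  let ?b = "shift (n - s) b"
  have rem: "removable T i (colc c n) ?b" using t(3) by (simp add: removable_colc)
  have other: "b' = ?b \<or> row T ?b < row T b'" if "removable T i (colc c n) b'" for b'
    using t(4)[of "shift (-n) b'"] that by (auto simp: removable_colc shift_eq_iff)
  have "arg_min (row T) (removable T i (colc c n)) = ?b"
    unfolding arg_min_def is_arg_min_def
  proof (rule some_equality)
    show "removable T i (colc c n) ?b \<and>
        \<not> (\<exists>y. removable T i (colc c n) y \<and> row T y < row T ?b)"
      using rem other by (metis less_asym less_irrefl)
    show "x = ?b" if "removable T i (colc c n) x \<and>
        \<not> (\<exists>y. removable T i (colc c n) y \<and> row T y < row T x)" for x
      using that rem other by blast
  qed
  moreover have "colc c n - {?b} = colc c' (n - s)"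
    using fe_SomeD(4)[OF t(1), of "n - s"] fe_SomeD(8)[OF t(1), of "n - s"] by auto
  moreover have cond: "\<not> (blk i c \<or> \<not> (\<exists>b. removable T i (colc c n) b))"
    using rem t(2) by blast
  ultimately show ?thesis
    unfolding col_e_def blocked_iff if_not_P[OF cond] using t(1) Some by simp
qed

lemma col_phi_colc: "col_phi T i (colc c n) = ph c i"
proof -
  define h where "h y = ph (THE c. \<exists>n. y = colc c n) i" for y
  have h: "h (colc c n) = ph c i" for c n
  proof -
    have "(THE c'. \<exists>n'. colc c n = colc c' n') = c" using colc_inj by blast
    then show ?thesis by (simp add: h_def)
  qed
  have "Max {m. iter_op (col_f T i) m (colc c n) \<noteq> None} = h (colc c n)"
  proof (rule Max_iter_op[where S = "young T"])
    fix y y' assume "young T y" and f: "col_f T i y = Some y'"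
    then obtain c n where y: "y = colc c n" using young_colc_ex by blast
    then obtain b c' s where "fe c i = Some (b, c', s)" "y' = colc c' (n + s)"
      using f by (auto simp: col_f_colc)
    then show "young T y' \<and> h y = Suc (h y')" using fe_SomeD(6) by (simp add: h y young_colc)
  next
    fix y assume "young T y" and f: "col_f T i y = None"
    then obtain c n where y: "y = colc c n" using young_colc_ex by blast
    then have "fe c i = None" using f by (simp add: col_f_colc)
    then show "h y = 0" using f_ok[of i c] by (simp add: f_ok_def h y)
  qed (rule young_colc)
  then show ?thesis by (simp add: col_phi_def h)
qed

lemma ee_iff: "ee c i = Some c' \<longleftrightarrow> (\<exists>b s. fe c' i = Some (b, c, s))"
  using ee_SomeD[of c i c'] fe_SomeD(5)[of c' i] by metis

lemma col_eps_colc: "col_eps T i (colc c n) = ep c i"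
proof -
  define h where "h y = ep (THE c. \<exists>n. y = colc c n) i" for y
  have h: "h (colc c n) = ep c i" for c n
  proof -
    have "(THE c'. \<exists>n'. colc c n = colc c' n') = c" using colc_inj by blast
    then show ?thesis by (simp add: h_def)
  qed
  have "Max {m. iter_op (col_e T i) m (colc c n) \<noteq> None} = h (colc c n)"
  proof (rule Max_iter_op[where S = "young T"])
    fix y y' assume "young T y" and e: "col_e T i y = Some y'"
    then obtain c n where y: "y = colc c n" using young_colc_ex by blast
    then obtain c' b c'' s where "ee c i = Some c'" "fe c' i = Some (b, c'', s)" "y' = colc c' (n - s)"
      using e by (auto simp: col_e_colc split: option.splits)
    moreover from this have "c'' = c" using ee_iff by auto
    ultimately show "young T y' \<and> h y = Suc (h y')" using fe_SomeD(7) by (simp add: h y young_colc)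
  next
    fix y assume "young T y" and e: "col_e T i y = None"
    then obtain c n where y: "y = colc c n" using young_colc_ex by blast
    then have "ee c i = None" using e ee_iff by (fastforce simp: col_e_colc split: option.splits)
    then show "h y = 0" using e_ok[of i c] by (simp add: e_ok_def h y)
  qed (rule young_colc)
  then show ?thesis by (simp add: col_eps_def h)
qed

end

section \<open>Contents, energy and the ground-state column\<close>

lemma sum_idx: "(\<Sum>j\<in>UNIV. F j) = sum_list (map F idx_list)"
  by (simp add: UNIV_idx idx_list_def)

context column_model
begin

definition nl :: "idx \<Rightarrow> int" where
  "nl j = int (card {l. colour T l = j})"

lemma finite_letters: "finite {l. P l}" for P :: "'l \<Rightarrow> bool"
  using ls(1) by (metis finite_set finite_subset subset_UNIV)

lemma nl_eq: "nl j = int (length (filter (\<lambda>l. colour T l = j) ls))"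
proof -
  have "{l. colour T l = j} = set (filter (\<lambda>l. colour T l = j) ls)" using ls(1) by auto
  then show ?thesis
    unfolding nl_def using distinct_card[of "filter (\<lambda>l. colour T l = j) ls"] ls(2) by simp
qed

text \<open>The blocks of index up to \<open>n - 2\<close> form full periods, and the others are the
  shifted representative. Cutting at \<open>N\<close> leaves \<open>n - 2 - N\<close> of these
  periods and makes the count finite.\<close>

lemma card_above:
  assumes "N \<le> n - 2"
  shows "finite {b \<in> colc c n. bcol T b = j \<and> N < snd b}"
    "int (card {b \<in> colc c n. bcol T b = j \<and> N < snd b}) = cnt j c + (n - 2 - N) * nl j"
proof -
  let ?R = "set (filter (\<lambda>b. colour T (fst b) = j) (rep c))"
  let ?L = "{l. colour T l = j} \<times> {N - n<..-2}"
  have eq: "{b \<in> colc c n. bcol T b = j \<and> N < snd b} = shift n ` (?R \<union> ?L)" (is "?A = _")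
  proof (intro set_eqI)
    fix b
    have "b \<in> shift n ` (?R \<union> ?L) \<longleftrightarrow> shift (-n) b \<in> ?R \<union> ?L"
    proof
      assume "b \<in> shift n ` (?R \<union> ?L)"
      then obtain b' where "b = shift n b'" "b' \<in> ?R \<union> ?L" by blast
      then show "shift (-n) b \<in> ?R \<union> ?L" by (simp del: set_filter)
    next
      assume "shift (-n) b \<in> ?R \<union> ?L"
      then show "b \<in> shift n ` (?R \<union> ?L)" by (rule image_eqI[rotated]) simp
    qed
    also have "\<dots> \<longleftrightarrow> b \<in> ?A"
      using rep_D(5)[of "shift (-n) b" c] assms
      by (cases b) (auto simp: colc_def list_col_def bcol_def shift_def)
    finally show "b \<in> ?A \<longleftrightarrow> b \<in> shift n ` (?R \<union> ?L)" by blast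
  qed
  have fin: "finite ?R" "finite ?L" using finite_letters by (simp_all add: finite_cartesian_product)
  then show "finite ?A" unfolding eq by blast
  have "inj_on (shift n) (?R \<union> ?L)"
    by (rule inj_onI) (auto simp: shift_def prod_eq_iff)
  then have "card ?A = card (?R \<union> ?L)" unfolding eq by (rule card_image)
  also have "\<dots> = card ?R + card ?L"
    by (rule card_Un_disjoint[OF fin]) (use rep_D(5)[of _ c] in fastforce)
  also have "card ?R = length (filter (\<lambda>b. colour T (fst b) = j) (rep c))"
    using rep_D(1)[of c] unfolding windowed_def by (intro distinct_card) simp
  also have "card ?L = card {l. colour T l = j} * nat (n - 2 - N)"
  proof -
    have "nat (-2 - (N - n)) = nat (n - 2 - N)" by (rule arg_cong[of _ _ nat]) simp
    then show ?thesis by (simp only: card_cartesian_product card_greaterThanAtMost_int)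
  qed
  finally show "int (card ?A) = cnt j c + (n - 2 - N) * nl j"
    using assms by (simp add: cnt_def nl_def)
qed

lemma card_diff_colc:
  "int (card {b \<in> colc c n - colc c' n'. bcol T b = j}) -
   int (card {b \<in> colc c' n' - colc c n. bcol T b = j}) =
   cnt j c + n * nl j - (cnt j c' + n' * nl j)"
proof -
  \<comment> \<open>Both columns contain every block of index at most this value, so they can be cut
    there without affecting their differences.\<close>
  define N where "N = min n n' - 2"
  have N: "N \<le> n - 2" "N \<le> n' - 2" by (auto simp: N_def)
  let ?A = "{b \<in> colc c n. bcol T b = j \<and> N < snd b}"
  let ?B = "{b \<in> colc c' n'. bcol T b = j \<and> N < snd b}"
  have low: "b \<in> colc c n" "b \<in> colc c' n'" if "snd b \<le> N" for b
    using that N by (auto simp: colc_def list_col_def)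
  have "{b \<in> colc c n - colc c' n'. bcol T b = j} = ?A - ?B"
    "{b \<in> colc c' n' - colc c n. bcol T b = j} = ?B - ?A"
    using low by (auto simp: not_less[symmetric] simp del: split_paired_All)
  moreover have "int (card (?A - ?B)) - int (card (?B - ?A)) = int (card ?A) - int (card ?B)"
  proof -
    note fin = card_above(1)[OF N(1), of c j] card_above(1)[OF N(2), of c' j]
    have "card ?A = card (?A - ?B) + card (?A \<inter> ?B)"
      by (metis (no_types, lifting) Int_Diff_Un Int_Diff_disjoint add.commute card_Un_disjoint fin(1) finite_Diff finite_Int)
    moreover have "card ?B = card (?B - ?A) + card (?B \<inter> ?A)"
      by (metis (no_types, lifting) Int_Diff_Un Int_Diff_disjoint add.commute card_Un_disjoint fin(2) finite_Diff finite_Int)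
    moreover have "?A \<inter> ?B = ?B \<inter> ?A" by (rule Int_commute)
    ultimately show ?thesis by simp
  qed
  ultimately show ?thesis
    using card_above(2)[OF N(1), of c j] card_above(2)[OF N(2), of c' j] by (simp add: algebra_simps)
qed

lemma nl_I0: "nl I0 = 1"
  using null_ok by (simp add: nl_eq null_ok_def)

lemma zero_content_colc:
  "zero_content T (colc c' n') (colc c n) = cnt I0 c + n - (cnt I0 c' + n')"
  using card_diff_colc[of c n c' n' I0] by (simp add: zero_content_def nl_I0)

text \<open>The difference of the contents splits into a part depending on the classes, given by the
  table, and a multiple of the null root, which pairs to zero.\<close>

lemma balance_colc:
  assumes "colc c0 n0 \<subseteq> colc c n"
  shows "int (ph c i) - int (ep c i) =
    - (\<Sum>j\<in>UNIV. cartan T i j * int (card {b \<in> colc c n - colc c0 n0. bcol T b = j}))"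
proof -
  have none: "{b \<in> colc c0 n0 - colc c n. bcol T b = j} = {}" for j using assms by blast
  have content: "int (card {b \<in> colc c n - colc c0 n0. bcol T b = j}) =
      (cnt j c - cnt j c0) + (n - n0) * nl j" for j
    using card_diff_colc[of c n c0 n0 j] unfolding none by (simp add: algebra_simps)
  have "(\<Sum>j\<in>UNIV. cartan T i j * int (card {b \<in> colc c n - colc c0 n0. bcol T b = j})) =
     (\<Sum>j\<in>UNIV. cartan T i j * ((cnt j c - cnt j c0) + (n - n0) * nl j))"
    by (simp only: content)
  also have "\<dots> = (\<Sum>j\<in>UNIV. cartan T i j * (cnt j c - cnt j c0)) + (n - n0) * (\<Sum>j\<in>UNIV. cartan T i j * nl j)"
    by (simp only: sum.distrib sum_distrib_left distrib_left mult.left_commute)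
  also have "(\<Sum>j\<in>UNIV. cartan T i j * nl j) = 0"
    using null_ok list_all_UNIV[OF set_idx_list, of _ i] unfolding sum_idx nl_eq null_ok_def by blast
  also have "(\<Sum>j\<in>UNIV. cartan T i j * (cnt j c - cnt j c0)) = - (int (ph c i) - int (ep c i))"
    using weight_ok[of i c] unfolding sum_idx weight_ok_def by linarith
  finally show ?thesis by simp
qed

section \<open>The tensor square of the classes and its energy\<close>

lemma Cl_nonempty: "Cl c \<noteq> {}"
  by (simp add: Cl_def)

lemma cls_phi_Cl: "cls_phi T i (Cl c) = ph c i"
  unfolding cls_phi_def by (rule descend_const[OF Cl_nonempty]) (auto simp: Cl_def col_phi_colc)

lemma cls_eps_Cl: "cls_eps T i (Cl c) = ep c i"
  unfolding cls_eps_def by (rule descend_const[OF Cl_nonempty]) (auto simp: Cl_def col_eps_colc)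

lemma cls_f_Cl: "cls_f T i (Cl c) = map_option (\<lambda>(b, c', s). Cl c') (fe c i)"
  unfolding cls_f_def
proof (rule descend_const[OF Cl_nonempty])
  fix y assume "y \<in> Cl c"
  then obtain n where "y = colc c n" by (auto simp: Cl_def)
  then show "map_option (cls T) (col_f T i y) = map_option (\<lambda>(b, c', s). Cl c') (fe c i)"
    by (cases "fe c i") (auto simp: col_f_colc cls_colc)
qed

lemma tensor_f_Cl: "tensor_f T i (Cl a, Cl b) = map_option (map_prod Cl Cl) (tf i (a, b))"
  by (cases "fe a i"; cases "fe b i")
    (auto simp: tensor_f_def tf_def cls_phi_Cl cls_eps_Cl cls_f_Cl)

text \<open>A tie of \<phi> and \<epsilon> goes to the left factor for raising and to the right
  factor for lowering. The two rules are inverse because raising the left factor increases its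
  \<phi> by one, and raising the right factor decreases its \<epsilon> by one.\<close>

lemma te_tf:
  assumes "te i p = Some p'" shows "tf i p' = Some p"
proof -
  obtain a b where p: "p = (a, b)" by (cases p)
  show ?thesis
  proof (cases "ep b i \<le> ph a i")
    case True
    then obtain a' where a': "ee a i = Some a'" "p' = (a', b)"
      using assms by (auto simp: te_def p split: option.splits)
    obtain bl s where "fe a' i = Some (bl, a, s)" using a' ee_iff by blast
    moreover from this have "ph a' i = Suc (ph a i)" by (rule fe_SomeD(6))
    ultimately show ?thesis using True a' by (simp add: tf_def p)
  next
    case False
    then obtain b' where b': "ee b i = Some b'" "p' = (a, b')"
      using assms by (auto simp: te_def p split: option.splits)
    obtain bl s where "fe b' i = Some (bl, b, s)" using b' ee_iff by blast
    moreover from this have "ep b i = Suc (ep b' i)" by (rule fe_SomeD(7))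
    ultimately show ?thesis using False b' by (simp add: tf_def p)
  qed
qed

lemma walk_invariant:
  assumes inv: "\<And>i p p'. tf i p = Some p' \<Longrightarrow> D p' = D p"
    and "walk ws p = Some p'"
  shows "D p' = D p"
  using assms(2)
proof (induction ws arbitrary: p)
  case Nil
  then show ?case by simp
next
  case (Cons w ws)
  obtain up i where w: "w = (up, i)" by (cases w)
  obtain p1 where p1: "(if up then te i p else tf i p) = Some p1" "walk ws p1 = Some p'"
    using Cons.prems w by (auto split: option.splits)
  have "D p1 = D p"
    using p1(1) inv[of i p p1] inv[of i p1 p] te_tf[of i p p1] by (auto split: if_splits)
  then show ?case using Cons.IH[OF p1(2)] by simp
qed

text \<open>
  Raising by the operators \<open>e\<^sub>i\<close> with \<open>i \<noteq> 0\<close> leads from every pair of classes to one of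
  finitely many classically highest weight pairs, and these are joined to the pair of ground-state
  classes by the listed walks.
\<close>

lemma invariant_const:
  assumes inv: "\<And>i p p'. tf i p = Some p' \<Longrightarrow> D p' = D p"
  shows "D (a, b) = D (c0, c0)"
proof (induction "hgt a + hgt b" arbitrary: a b rule: less_induct)
  case less
  have raise: "D p' = D (a, b)" if "te i (a, b) = Some p'" for i p'
    using inv[OF te_tf[OF that]] by simp
  have ee_ex: "\<exists>c'. ee c i = Some c' \<and> hgt c' < hgt c" if i: "i \<noteq> I0" "0 < ep c i" for i c
  proof -
    obtain c' where c': "ee c i = Some c'" using e_ok[of i c] i(2) by (cases "ee c i") (auto simp: e_ok_def)
    then show ?thesis
      using connected_ok[of c] i(1) by (cases i) (auto simp: connected_ok_def)
  qed
  consider i where "i \<noteq> I0" "0 < ep a i \<or> ph a i < ep b i" | ws where "((a, b), ws) \<in> set paths"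
  proof -
    have "b \<in> set cs" using cs by simp
    then show thesis
      using connected_ok[of a] that unfolding connected_ok_def list_all_iff
      by (fastforce split: if_splits)
  qed
  then show ?case
  proof cases
    case 1
    show ?thesis
    proof (cases "ep b i \<le> ph a i")
      case True
      then have "0 < ep a i" using 1 by simp
      then obtain a' where a': "ee a i = Some a'" "hgt a' < hgt a" using ee_ex 1 by blast
      then have "te i (a, b) = Some (a', b)" using True by (simp add: te_def)
      then show ?thesis using raise less[of a' b] a' by simp
    next
      case False
      then have "0 < ep b i" by simp
      then obtain b' where b': "ee b i = Some b'" "hgt b' < hgt b" using ee_ex 1 by blast
      then have "te i (a, b) = Some (a, b')" using False by (simp add: te_def)
      then show ?thesis using raise less[of a b'] b' by simp
    qed
  next
    case 2
    then have "walk ws (a, b) = Some (c0, c0)" using paths_ok by (auto simp: list_all_iff)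
    from walk_invariant[of D, OF inv this] show ?thesis by simp
  qed
qed

text \<open>The table satisfies the defining rule. The difference \<open>D\<close> between any other
  solution and the table is invariant under all lowering operators, hence constant by connectedness,
  and it vanishes at the ground-state pair. Extensionality removes the freedom outside the set of
  classes.\<close>

lemma energy_Cl: "energy T (Cl a, Cl b) = int (H a b)"
proof -
  define h where "h = restrict (\<lambda>(A, B). int (H (inv Cl A) (inv Cl B))) (col_classes T \<times> col_classes T)"
  have "inj Cl" by (rule injI) (simp add: Cl_inj)
  then have h: "h (Cl a, Cl b) = int (H a b)" for a b
    by (simp add: h_def col_classes_eq)
  have h_step: "h (Cl (fst p'), Cl (snd p')) - h (Cl a, Cl b) =
      (if i \<noteq> I0 then 0 else if ph a I0 > ep b I0 then -1 else 1)" if "tf i (a, b) = Some p'" for i a b p'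
    using energy_ok[of i a b] that unfolding energy_ok_def tf_def
    by (auto simp: h split: if_splits option.splits prod.splits)
  have is_energy_iff: "is_energy T h' \<longleftrightarrow> h' (Cl c0, Cl c0) = 0 \<and>
    (\<forall>i a b p'. tf i (a, b) = Some p' \<longrightarrow> h' (Cl (fst p'), Cl (snd p')) - h' (Cl a, Cl b) =
      (if i \<noteq> I0 then 0 else if ph a I0 > ep b I0 then -1 else 1))" for h'
  proof -
    have "cls T (y_empty T) = Cl c0" using cls_colc[of c0 1] by (simp add: y_empty colc_def)
    then show ?thesis
      unfolding is_energy_def col_classes_eq
      by (fastforce simp: tensor_f_Cl cls_phi_Cl cls_eps_Cl map_prod_def split: prod.splits)
  qed
  have "energy T = h"
    unfolding energy_def
  proof (rule the_equality)
    have "h \<in> extensional (col_classes T \<times> col_classes T)" by (simp add: h_def)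
    moreover have "is_energy T h" unfolding is_energy_iff using h_step by (simp add: h ground(3))
    ultimately show "h \<in> extensional (col_classes T \<times> col_classes T) \<and> is_energy T h" ..
  next
    fix h' assume h': "h' \<in> extensional (col_classes T \<times> col_classes T) \<and> is_energy T h'"
    define D where "D p = h' (Cl (fst p), Cl (snd p)) - h (Cl (fst p), Cl (snd p))" for p
    have "D p' = D p" if "tf i p = Some p'" for i p p'
    proof -
      obtain a b where p: "p = (a, b)" by (cases p)
      have "h' (Cl (fst p'), Cl (snd p')) - h' (Cl a, Cl b) =
        (if i \<noteq> I0 then 0 else if ph a I0 > ep b I0 then -1 else 1)"
        using h' that p unfolding is_energy_iff by blast
      then show ?thesis using h_step[of i a b p'] that p by (simp add: D_def)
    qed
    then have "D (a, b) = D (c0, c0)" for a b by (rule invariant_const)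
    moreover have "D (c0, c0) = 0"
      using h' unfolding is_energy_iff by (simp add: D_def h ground(3))
    ultimately have "h' (Cl a, Cl b) = h (Cl a, Cl b)" for a b by (simp add: D_def)
    then show "h' = h"
      using h' by (intro extensionalityI[of _ "col_classes T \<times> col_classes T"])
        (auto simp: h_def col_classes_eq)
  qed
  then show ?thesis by (simp add: h)
qed

text \<open>One period contains exactly one 0-block, so the surplus \<open>k\<close> of 0-blocks and
  the class determine the index distance \<open>n - n0\<close>; containment is then a table
  entry.\<close>

lemma ground_subset:
  assumes "c \<noteq> c0 \<or> k \<ge> 2" "k \<ge> 1" "cnt I0 c + n = cnt I0 c0 + n0 + k"
  shows "colc c0 n0 \<subseteq> colc c n"
proof -
  let ?d = "cnt I0 c0 - cnt I0 c + k"
  have g: "cnt I0 c \<le> cnt I0 c0 + 1" "above_ok c (cnt I0 c0 - cnt I0 c + 2)"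
    "c = c0 \<or> above_ok c (cnt I0 c0 - cnt I0 c + 1)"
    using ground(4)[of c] by (simp_all add: ground_ok_def)
  have "k = 1 \<or> k = 2 \<or> k \<ge> 3" using assms(2) by linarith
  then have "above_ok c ?d"
  proof (elim disjE)
    assume "k = 1" then show ?thesis using g(3) assms(1) by auto
  next
    assume "k = 2" then show ?thesis using g(2) by simp
  next
    assume "k \<ge> 3" then show ?thesis using g(1) by (simp add: above_ok_def)
  qed
  have "shift (- ?d) w \<in> list_col (rep c)" if w: "w \<in> list_col (rep c0)" for w
  proof -
    have w0: "snd w \<le> 0" using w rep_D(5)[of w c0] by (auto simp: list_col_def)
    show ?thesis
    proof (cases "2 \<le> ?d")
      case True
      then show ?thesis using w0 by (simp add: list_col_def)
    next
      case False
      then have d: "0 \<le> ?d" "list_all (\<lambda>w. memb c0 w \<longrightarrow> memb c (fst w, snd w - ?d)) W"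
        using \<open>above_ok c ?d\<close> by (simp_all add: above_ok_def split: if_splits)
      show ?thesis
      proof (cases w rule: mem_W_cases)
        case 1
        have "shift (- ?d) w = (fst w, snd w - ?d)" by (simp add: shift_def)
        then show ?thesis using d(2) w 1 unfolding list_all_iff memb_iff by metis
      next
        case 2
        then show ?thesis using d(1) by (simp add: list_col_def)
      next
        case 3
        then show ?thesis using w0 by simp
      qed
    qed
  qed
  moreover have "shift (- n) (shift n0 w) = shift (- ?d) w" for w :: "'l block"
    using assms(3) by (simp add: shift_def)
  ultimately have "shift (- n) (shift n0 w) \<in> list_col (rep c)" if "w \<in> list_col (rep c0)" for w
    using that by metis
  note * = this
  have "b \<in> colc c n" if "b \<in> colc c0 n0" for b
    using *[of "shift (- n0) b"] that by (simp add: colc_def)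
  then show ?thesis by blast
qed

lemma reduced_contains_ground:
  assumes Y: "Y \<in> reduced_walls T (colc c0 n0)"
  shows "colc c0 n0 \<subseteq> Y k"
proof -
  let ?g = "colc c0 n0"
  have yw: "young_wall T ?g Y"
    and step: "energy T (cls T (Y (Suc k)), cls T (Y k)) + zero_content T ?g (Y (Suc k)) - zero_content T ?g (Y k) = 0" for k
    using Y by (auto simp: reduced_walls_def)
  have "\<forall>k. \<exists>c n. Y k = colc c n"
    using yw by (simp add: young_wall_def young_iff)
  then obtain c n where cn: "Y k = colc (c k) (n k)" for k by metis
  have zc: "zero_content T ?g (Y k) = cnt I0 (c k) + n k - (cnt I0 c0 + n0)" for k
    unfolding cn by (rule zero_content_colc)
  have step': "zero_content T ?g (Y k) = zero_content T ?g (Y (Suc k)) + int (H (c (Suc k)) (c k))" for k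
    using step[of k] unfolding cn cls_colc energy_Cl by simp
  have H0: "c (Suc k) = c0" if "H (c (Suc k)) (c k) = 0" "c k = c0" for k
    using ground(4)[of "c (Suc k)"] that by (simp add: ground_ok_def)
  have H0': "c k = c0" if "H (c (Suc k)) (c k) = 0" "c (Suc k) = c0" for k
    using ground(4)[of "c k"] that by (simp add: ground_ok_def)
  obtain N where tail: "\<And>k. k \<ge> N \<Longrightarrow> Y k = ?g" using young_wall_tail[OF yw] by blast
  \<comment> \<open>Besides nonnegativity, the invariant restricts the class at contents 0 and 1.
    These are the cases in which the surplus of 0-blocks alone does not give containment.\<close>
  let ?P = "\<lambda>k. 0 \<le> zero_content T ?g (Y k) \<and> (zero_content T ?g (Y k) = 0 \<longrightarrow> c k = c0) \<and>
    (zero_content T ?g (Y k) = 1 \<longrightarrow> c k \<noteq> c0)"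
  have far: "?P k" if "k \<ge> N" for k
  proof -
    have "c k = c0 \<and> n k = n0" using tail[OF that] cn[of k] colc_inj by metis
    then show ?thesis using zc[of k] by simp
  qed
  have P: "?P k"
  proof (cases "k \<le> N")
    case True
    then show ?thesis
    proof (induction rule: inc_induct)
      case base
      then show ?case using far[of N] by simp
    next
      case (step k)
      \<comment> \<open>A step of energy 1 from content 0 to content 1 cannot join two columns of
        class \<open>c0\<close>, whose energy is 0.\<close>
      have "H (c (Suc k)) (c k) = 1 \<longrightarrow> c (Suc k) \<noteq> c0 \<or> c k \<noteq> c0" using ground(3) by auto
      then show ?case using step.IH step'[of k] H0[of k] H0'[of k] by auto
    qed
  qed (use far in simp)
  show ?thesis
  proof (cases "zero_content T ?g (Y k) = 0")
    case True
    then have "c k = c0" "n k = n0" using P zc[of k] by auto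
    then show ?thesis by (simp add: cn)
  next
    case False
    define z where "z = zero_content T ?g (Y k)"
    have "z \<noteq> 0" "0 \<le> z" "z = 1 \<longrightarrow> c k \<noteq> c0" using False P by (auto simp: z_def)
    moreover have "cnt I0 (c k) + n k = cnt I0 c0 + n0 + z" using zc[of k] by (simp add: z_def)
    ultimately show ?thesis
      unfolding cn by (intro ground_subset[of "c k" z]) linarith+
  qed
qed

lemma wall_model_ground: "wall_model T (colc c0 n0)"
proof
  fix y y' i
  show "col_eps T i (colc c0 n0) = (if i = I0 then 1 else 0)"
    "col_phi T i (colc c0 n0) = (if i = I0 then 1 else 0)"
    by (simp_all add: col_eps_colc col_phi_colc ground)
  show "colc c0 n0 \<subseteq> Y k" if "Y \<in> reduced_walls T (colc c0 n0)" for Y k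
    by (rule reduced_contains_ground[OF that])
  assume "young T y"
  then obtain c n where y: "y = colc c n" using young_colc_ex by blast
  show "col_f T i y = None \<longleftrightarrow> col_phi T i y = 0"
    using f_ok[of i c] fe_SomeD(6)[of c i] unfolding y col_f_colc col_phi_colc
    by (cases "fe c i") (auto simp: f_ok_def)
  show "young T y' \<and> (\<exists>b. b \<notin> y \<and> bcol T b = i \<and> y' = insert b y) \<and> col_e T i y' = Some y \<and>
      col_eps T i y' = Suc (col_eps T i y) \<and> col_phi T i y = Suc (col_phi T i y')"
    if f: "col_f T i y = Some y'"
  proof -
    obtain b c' s where t: "fe c i = Some (b, c', s)" "y' = colc c' (n + s)"
      using f by (auto simp: y col_f_colc)
    note d = fe_SomeD[OF t(1)]
    have "\<exists>b. b \<notin> y \<and> bcol T b = i \<and> y' = insert b y"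
      by (rule exI[of _ "shift n b"]) (use d(4,8,9) t y in simp)
    then show ?thesis
      using d(5,6,7) t by (simp add: y young_colc col_e_colc col_eps_colc col_phi_colc)
  qed
  show "young T y' \<and> col_f T i y' = Some y" if e: "col_e T i y = Some y'"
  proof -
    obtain c' b c'' s where "ee c i = Some c'" "fe c' i = Some (b, c'', s)" "y' = colc c' (n - s)"
      using e by (auto simp: y col_e_colc split: option.splits)
    moreover from this have "c'' = c" using ee_iff by auto
    ultimately show ?thesis by (simp add: y young_colc col_f_colc)
  qed
  show "int (col_phi T i y) - int (col_eps T i y) =
      - (\<Sum>j\<in>UNIV. cartan T i j * int (card {b \<in> y - colc c0 n0. bcol T b = j}))"
    if "colc c0 n0 \<subseteq> y"
    using balance_colc that unfolding y col_phi_colc col_eps_colc by blast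
  fix z z' assume "young T z"
  then obtain d m where z: "z = colc d m" using young_colc_ex by blast
  show "energy T (cls T y', cls T z) = energy T (cls T y, cls T z) - (if i = I0 then 1 else 0)"
    if f: "col_f T i y = Some y'" "col_eps T i z < col_phi T i y"
  proof -
    obtain b c' s where t: "fe c i = Some (b, c', s)" "y' = colc c' (n + s)"
      using f(1) by (auto simp: y col_f_colc)
    then show ?thesis
      using energy_ok[of i c d] f(2)
      by (simp add: y z col_eps_colc col_phi_colc cls_colc energy_Cl energy_ok_def)
  qed
  show "energy T (cls T y, cls T z') = energy T (cls T y, cls T z) + (if i = I0 then 1 else 0)"
    if f: "col_f T i z = Some z'" "col_phi T i y \<le> col_eps T i z"
  proof -
    obtain b d' s where t: "fe d i = Some (b, d', s)" "z' = colc d' (m + s)"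
      using f(1) by (auto simp: z col_f_colc)
    then show ?thesis
      using energy_ok[of i c d] f(2)
      by (simp add: y z col_eps_colc col_phi_colc cls_colc energy_Cl energy_ok_def)
  qed
qed

theorem affine_crystal_reduced:
  assumes "g \<in> cls T (y_empty T)"
  shows "affine_crystal (cartan T) (reduced_walls T g) (wall_wt T (Lambda I0) g)
    (wall_e T) (wall_f T) (wall_eps T) (wall_phi T)"
proof -
  have "cls T (y_empty T) = Cl c0" using cls_colc[of c0 1] by (simp add: y_empty colc_def)
  then obtain n0 where "g = colc c0 n0" using assms by (auto simp: Cl_def)
  then show ?thesis
    using wall_model.affine_crystal_reduced_walls[OF wall_model_ground] by simp
qed

end
text \<open>The defining equations of the checks, with the locale parameters as explicit arguments,
  are made available for evaluation, since the checks on the tables have to be established before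
  the interpretations.\<close>

lemmas block_data_code [code] =
  block_data.rests_def block_data.supported_def block_data.unloaded_def block_data.topmost_def
  block_data.exc_def block_data.windowed_def block_data.letter_ok_def block_data.null_ok_def
  block_data.below_step_def block_data.below_def block_data.anchor_ok_def
  block_data.exts.simps block_data.topological.simps
  class_data.memb_def class_data.adds_def class_data.rems_def class_data.blk_def class_data.rw_def
  class_data.f_ok_def class_data.e_ok_def class_data.rep_ok_def class_data.cnt_def
  class_data.weight_ok_def class_data.above_ok_def class_data.ground_ok_def
  class_data.energy_ok_def class_data.tf_def class_data.te_def class_data.walk.simps
  class_data.connected_ok_def class_data.columns_ok_def class_data.energies_ok_def

section \<open>Type \<open>E\<^sub>6\<^sup>(\<^sup>2\<^sup>)\<close>\<close>

text \<open>Under the operators with \<open>i \<noteq> I0\<close> the class \<open>P5\<close> of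
  \<open>y_empty\<close> stands alone. The other 26 classes form one component with highest weight
  class \<open>P13\<close>, the 26-dimensional representation of finite type \<open>F4\<close>. Its
  two classes of weight zero are \<open>P12\<close> and \<open>P15\<close>, named by
  \<open>y_r I1\<close> and \<open>y_r I2\<close>.\<close>

datatype e6_class = P0 | P1 | P2 | P3 | P4 | P5 | P6 | P7 | P8 | P9 | P10 | P11 | P12 | P13 | P14
    | P15 | P16 | P17 | P18 | P19 | P20 | P21 | P22 | P23 | P24 | P25 | P26

definition e6_classes :: "e6_class list" where "e6_classes = [P0, P1, P2, P3, P4, P5, P6, P7, P8,
    P9, P10, P11, P12, P13, P14, P15, P16, P17, P18, P19, P20, P21, P22, P23, P24, P25, P26]"
definition e6_letters :: "e6_letter list" where "e6_letters = [E_c, E_a, E_b, E_b', E_a', E_c',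
    E_z, E_b'', E_d]"

primrec e6_rl :: "e6_letter \<Rightarrow> (e6_letter \<times> int) list" where
"e6_rl E_c = [(E_b'', -1), (E_d, -1)]"
| "e6_rl E_a = [(E_z, -1), (E_b'', -1)]"
| "e6_rl E_b = [(E_c, 0)]"
| "e6_rl E_b' = [(E_c, 0), (E_a, 0)]"
| "e6_rl E_a' = [(E_b, 0)]"
| "e6_rl E_c' = [(E_b, 0), (E_b', 0)]"
| "e6_rl E_z = [(E_a', 0)]"
| "e6_rl E_b'' = [(E_a', 0), (E_c', 0)]"
| "e6_rl E_d = [(E_c', 0)]"

definition e6_window :: "e6_letter block list" where "e6_window = concat (map (\<lambda>l. [(l,
    -1), (l, 0), (l, 1)]) e6_letters)"
text \<open>The anchor is \<open>E_b''\<close>. At index -1 only \<open>E_z\<close> and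
  \<open>E_d\<close> do not lie below it and are left to choice; at index 0 all letters but the
  anchor are candidates.\<close>

definition e6_base :: "e6_letter block list" where "e6_base = [(E_c, -1), (E_a, -1), (E_b, -1),
    (E_b', -1), (E_a', -1), (E_c', -1), (E_b'', -1)]"
definition e6_cand :: "e6_letter block list" where "e6_cand = [(E_z, -1), (E_d, -1), (E_c, 0),
    (E_a, 0), (E_b, 0), (E_b', 0), (E_a', 0), (E_c', 0), (E_z, 0), (E_d, 0)]"

primrec e6_rep :: "e6_class \<Rightarrow> e6_letter block list" where
"e6_rep P0 = [] @ e6_base"
| "e6_rep P1 = [(E_d, -1)] @ e6_base"
| "e6_rep P2 = [(E_c, 0), (E_d, -1)] @ e6_base"
| "e6_rep P3 = [(E_b, 0), (E_c, 0), (E_d, -1)] @ e6_base"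
| "e6_rep P4 = [(E_a', 0), (E_b, 0), (E_c, 0), (E_d, -1)] @ e6_base"
| "e6_rep P5 = [(E_z, 0), (E_a', 0), (E_b, 0), (E_c, 0), (E_d, -1)] @ e6_base"
| "e6_rep P6 = [(E_z, -1)] @ e6_base"
| "e6_rep P7 = [(E_a, 0), (E_z, -1)] @ e6_base"
| "e6_rep P8 = [(E_d, -1), (E_z, -1)] @ e6_base"
| "e6_rep P9 = [(E_a, 0), (E_d, -1), (E_z, -1)] @ e6_base"
| "e6_rep P10 = [(E_c, 0), (E_d, -1), (E_z, -1)] @ e6_base"
| "e6_rep P11 = [(E_b, 0), (E_c, 0), (E_d, -1), (E_z, -1)] @ e6_base"
| "e6_rep P12 = [(E_a', 0), (E_b, 0), (E_c, 0), (E_d, -1), (E_z, -1)] @ e6_base"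
| "e6_rep P13 = [(E_z, 0), (E_a', 0), (E_b, 0), (E_c, 0), (E_d, -1), (E_z, -1)] @ e6_base"
| "e6_rep P14 = [(E_a, 0), (E_c, 0), (E_d, -1), (E_z, -1)] @ e6_base"
| "e6_rep P15 = [(E_b', 0), (E_a, 0), (E_c, 0), (E_d, -1), (E_z, -1)] @ e6_base"
| "e6_rep P16 = [(E_a', 0), (E_b, 0), (E_a, 0), (E_c, 0), (E_d, -1), (E_z, -1)] @ e6_base"
| "e6_rep P17 = [(E_z, 0), (E_a', 0), (E_b, 0), (E_a, 0), (E_c, 0), (E_d, -1), (E_z, -1)] @ e6_base"
| "e6_rep P18 = [(E_b', 0), (E_b, 0), (E_a, 0), (E_c, 0), (E_d, -1), (E_z, -1)] @ e6_base"
| "e6_rep P19 = [(E_c', 0), (E_b', 0), (E_b, 0), (E_a, 0), (E_c, 0), (E_d, -1), (E_z, -1)] @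
    e6_base"
| "e6_rep P20 = [(E_d, 0), (E_c', 0), (E_b', 0), (E_b, 0), (E_a, 0), (E_c, 0), (E_d, -1), (E_z, -1)]
    @ e6_base"
| "e6_rep P21 = [(E_a', 0), (E_b', 0), (E_b, 0), (E_a, 0), (E_c, 0), (E_d, -1), (E_z, -1)] @
    e6_base"
| "e6_rep P22 = [(E_z, 0), (E_a', 0), (E_b', 0), (E_b, 0), (E_a, 0), (E_c, 0), (E_d, -1), (E_z, -1)]
    @ e6_base"
| "e6_rep P23 = [(E_c', 0), (E_a', 0), (E_b', 0), (E_b, 0), (E_a, 0), (E_c, 0), (E_d, -1), (E_z,
    -1)] @ e6_base"
| "e6_rep P24 = [(E_d, 0), (E_c', 0), (E_a', 0), (E_b', 0), (E_b, 0), (E_a, 0), (E_c, 0), (E_d, -1),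
    (E_z, -1)] @ e6_base"
| "e6_rep P25 = [(E_z, 0), (E_c', 0), (E_a', 0), (E_b', 0), (E_b, 0), (E_a, 0), (E_c, 0), (E_d, -1),
    (E_z, -1)] @ e6_base"
| "e6_rep P26 = [(E_d, 0), (E_z, 0), (E_c', 0), (E_a', 0), (E_b', 0), (E_b, 0), (E_a, 0), (E_c, 0),
    (E_d, -1), (E_z, -1)] @ e6_base"

primrec e6_f :: "e6_class \<Rightarrow> idx \<Rightarrow> (e6_letter block \<times> e6_class \<times> int) option" where
"e6_f P0 = case_idx (Some ((E_z, -1), P6, 0)) None None None (Some ((E_d, -1), P1, 0))"
| "e6_f P1 = case_idx (Some ((E_z, -1), P8, 0)) None None (Some ((E_c, 0), P2, 0)) None"
| "e6_f P2 = case_idx (Some ((E_z, -1), P10, 0)) None (Some ((E_b, 0), P3, 0)) None None"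
| "e6_f P3 = case_idx (Some ((E_z, -1), P11, 0)) (Some ((E_a', 0), P4, 0)) None None None"
| "e6_f P4 = case_idx (Some ((E_z, 0), P5, 0)) None None None None"
| "e6_f P5 = case_idx (Some ((E_z, -1), P13, 0)) None None None None"
| "e6_f P6 = case_idx None (Some ((E_a, 0), P7, 0)) None None (Some ((E_d, -1), P8, 0))"
| "e6_f P7 = case_idx None None None None (Some ((E_d, -1), P9, 0))"
| "e6_f P8 = case_idx None (Some ((E_a, 0), P9, 0)) None (Some ((E_c, 0), P10, 0)) None"
| "e6_f P9 = case_idx None None None (Some ((E_c, 0), P14, 0)) None"
| "e6_f P10 = case_idx None (Some ((E_a, 0), P14, 0)) (Some ((E_b, 0), P11, 0)) None None"
| "e6_f P11 = case_idx None (Some ((E_a', 0), P12, 0)) None None None"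
| "e6_f P12 = case_idx None (Some ((E_a, 0), P16, 0)) None None None"
| "e6_f P13 = case_idx None (Some ((E_a, 0), P17, 0)) None None None"
| "e6_f P14 = case_idx None None (Some ((E_b', 0), P15, 0)) None None"
| "e6_f P15 = case_idx None None (Some ((E_b, 0), P18, 0)) None None"
| "e6_f P16 = case_idx (Some ((E_z, 0), P17, 0)) None (Some ((E_b', 0), P21, 0)) None None"
| "e6_f P17 = case_idx None None (Some ((E_b', 0), P22, 0)) None None"
| "e6_f P18 = case_idx None (Some ((E_a', 0), P21, 0)) None (Some ((E_c', 0), P19, 0)) None"
| "e6_f P19 = case_idx None (Some ((E_a', 0), P23, 0)) None None (Some ((E_d, 0), P20, 0))"
| "e6_f P20 = case_idx None (Some ((E_a', 0), P24, 0)) None None None"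
| "e6_f P21 = case_idx (Some ((E_z, 0), P22, 0)) None None (Some ((E_c', 0), P23, 0)) None"
| "e6_f P22 = case_idx None None None (Some ((E_c', 0), P25, 0)) None"
| "e6_f P23 = case_idx (Some ((E_z, 0), P25, 0)) None (Some ((E_b'', 0), P0, 1)) None (Some ((E_d,
    0), P24, 0))"
| "e6_f P24 = case_idx (Some ((E_z, 0), P26, 0)) None (Some ((E_b'', 0), P1, 1)) None None"
| "e6_f P25 = case_idx None None (Some ((E_b'', 0), P6, 1)) None (Some ((E_d, 0), P26, 0))"
| "e6_f P26 = case_idx None None (Some ((E_b'', 0), P8, 1)) None None"

primrec e6_e :: "e6_class \<Rightarrow> idx \<Rightarrow> e6_class option" where
"e6_e P0 = case_idx None None (Some P23) None None"
| "e6_e P1 = case_idx None None (Some P24) None (Some P0)"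
| "e6_e P2 = case_idx None None None (Some P1) None"
| "e6_e P3 = case_idx None None (Some P2) None None"
| "e6_e P4 = case_idx None (Some P3) None None None"
| "e6_e P5 = case_idx (Some P4) None None None None"
| "e6_e P6 = case_idx (Some P0) None (Some P25) None None"
| "e6_e P7 = case_idx None (Some P6) None None None"
| "e6_e P8 = case_idx (Some P1) None (Some P26) None (Some P6)"
| "e6_e P9 = case_idx None (Some P8) None None (Some P7)"
| "e6_e P10 = case_idx (Some P2) None None (Some P8) None"
| "e6_e P11 = case_idx (Some P3) None (Some P10) None None"
| "e6_e P12 = case_idx None (Some P11) None None None"
| "e6_e P13 = case_idx (Some P5) None None None None"
| "e6_e P14 = case_idx None (Some P10) None (Some P9) None"
| "e6_e P15 = case_idx None None (Some P14) None None"
| "e6_e P16 = case_idx None (Some P12) None None None"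
| "e6_e P17 = case_idx (Some P16) (Some P13) None None None"
| "e6_e P18 = case_idx None None (Some P15) None None"
| "e6_e P19 = case_idx None None None (Some P18) None"
| "e6_e P20 = case_idx None None None None (Some P19)"
| "e6_e P21 = case_idx None (Some P18) (Some P16) None None"
| "e6_e P22 = case_idx (Some P21) None (Some P17) None None"
| "e6_e P23 = case_idx None (Some P19) None (Some P21) None"
| "e6_e P24 = case_idx None (Some P20) None None (Some P23)"
| "e6_e P25 = case_idx (Some P23) None None (Some P22) None"
| "e6_e P26 = case_idx (Some P24) None None None (Some P25)"

primrec e6_phi :: "e6_class \<Rightarrow> idx \<Rightarrow> nat" where
"e6_phi P0 = case_idx 1 0 0 0 1"
| "e6_phi P1 = case_idx 1 0 0 1 0"
| "e6_phi P2 = case_idx 1 0 1 0 0"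
| "e6_phi P3 = case_idx 1 1 0 0 0"
| "e6_phi P4 = case_idx 2 0 0 0 0"
| "e6_phi P5 = case_idx 1 0 0 0 0"
| "e6_phi P6 = case_idx 0 1 0 0 1"
| "e6_phi P7 = case_idx 0 0 0 0 1"
| "e6_phi P8 = case_idx 0 1 0 1 0"
| "e6_phi P9 = case_idx 0 0 0 1 0"
| "e6_phi P10 = case_idx 0 1 1 0 0"
| "e6_phi P11 = case_idx 0 2 0 0 0"
| "e6_phi P12 = case_idx 0 1 0 0 0"
| "e6_phi P13 = case_idx 0 1 0 0 0"
| "e6_phi P14 = case_idx 0 0 2 0 0"
| "e6_phi P15 = case_idx 0 0 1 0 0"
| "e6_phi P16 = case_idx 1 0 1 0 0"
| "e6_phi P17 = case_idx 0 0 1 0 0"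
| "e6_phi P18 = case_idx 0 1 0 1 0"
| "e6_phi P19 = case_idx 0 1 0 0 1"
| "e6_phi P20 = case_idx 0 1 0 0 0"
| "e6_phi P21 = case_idx 1 0 0 1 0"
| "e6_phi P22 = case_idx 0 0 0 1 0"
| "e6_phi P23 = case_idx 1 0 1 0 1"
| "e6_phi P24 = case_idx 1 0 1 0 0"
| "e6_phi P25 = case_idx 0 0 1 0 1"
| "e6_phi P26 = case_idx 0 0 1 0 0"

primrec e6_eps :: "e6_class \<Rightarrow> idx \<Rightarrow> nat" where
"e6_eps P0 = case_idx 0 0 1 0 0"
| "e6_eps P1 = case_idx 0 0 1 0 1"
| "e6_eps P2 = case_idx 0 0 0 1 0"
| "e6_eps P3 = case_idx 0 0 1 0 0"
| "e6_eps P4 = case_idx 0 1 0 0 0"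
| "e6_eps P5 = case_idx 1 0 0 0 0"
| "e6_eps P6 = case_idx 1 0 1 0 0"
| "e6_eps P7 = case_idx 0 1 0 0 0"
| "e6_eps P8 = case_idx 1 0 1 0 1"
| "e6_eps P9 = case_idx 0 1 0 0 1"
| "e6_eps P10 = case_idx 1 0 0 1 0"
| "e6_eps P11 = case_idx 1 0 1 0 0"
| "e6_eps P12 = case_idx 0 1 0 0 0"
| "e6_eps P13 = case_idx 2 0 0 0 0"
| "e6_eps P14 = case_idx 0 1 0 1 0"
| "e6_eps P15 = case_idx 0 0 1 0 0"
| "e6_eps P16 = case_idx 0 2 0 0 0"
| "e6_eps P17 = case_idx 1 1 0 0 0"
| "e6_eps P18 = case_idx 0 0 2 0 0"
| "e6_eps P19 = case_idx 0 0 0 1 0"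
| "e6_eps P20 = case_idx 0 0 0 0 1"
| "e6_eps P21 = case_idx 0 1 1 0 0"
| "e6_eps P22 = case_idx 1 0 1 0 0"
| "e6_eps P23 = case_idx 0 1 0 1 0"
| "e6_eps P24 = case_idx 0 1 0 0 1"
| "e6_eps P25 = case_idx 1 0 0 1 0"
| "e6_eps P26 = case_idx 1 0 0 0 1"

definition e6_r :: "idx \<Rightarrow> e6_class option" where
  "e6_r = case_idx None (Some P12) (Some P15) None None"

text \<open>Rows are indexed by the left factor. Starting from 0 at the pair of \<open>P5\<close>
  with itself, all values are forced by the energy rule along the arrows of the connected tensor
  square.\<close>

primrec e6_H :: "e6_class \<Rightarrow> e6_class \<Rightarrow> nat" where
"e6_H P0 = case_e6_class 2 1 1 1 1 1 2 2 2 2 2 2 2 2 2 2 2 2 2 2 1 2 2 2 1 2 2"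
| "e6_H P1 = case_e6_class 2 2 1 1 1 1 2 2 2 2 2 2 2 2 2 2 2 2 2 2 2 2 2 2 2 2 2"
| "e6_H P2 = case_e6_class 2 2 2 1 1 1 2 2 2 2 2 2 2 2 2 2 2 2 2 2 2 2 2 2 2 2 2"
| "e6_H P3 = case_e6_class 2 2 2 2 1 1 2 2 2 2 2 2 2 2 2 2 2 2 2 2 2 2 2 2 2 2 2"
| "e6_H P4 = case_e6_class 2 2 2 2 2 1 2 2 2 2 2 2 2 2 2 2 2 2 2 2 2 2 2 2 2 2 2"
| "e6_H P5 = case_e6_class 1 1 1 1 1 0 1 1 1 1 1 1 1 1 1 1 1 1 1 1 1 1 1 1 1 1 1"
| "e6_H P6 = case_e6_class 1 0 0 0 0 1 2 1 1 1 1 1 1 2 1 1 1 2 1 1 0 1 2 1 0 2 1"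
| "e6_H P7 = case_e6_class 1 0 0 0 0 1 2 2 1 1 1 1 1 2 1 1 1 2 1 1 0 1 2 1 0 2 1"
| "e6_H P8 = case_e6_class 1 1 0 0 0 1 2 1 2 1 1 1 1 2 1 1 1 2 1 1 1 1 2 1 1 2 2"
| "e6_H P9 = case_e6_class 1 1 0 0 0 1 2 2 2 2 1 1 1 2 1 1 1 2 1 1 1 1 2 1 1 2 2"
| "e6_H P10 = case_e6_class 1 1 1 0 0 1 2 1 2 1 2 1 1 2 1 1 1 2 1 1 1 1 2 1 1 2 2"
| "e6_H P11 = case_e6_class 1 1 1 1 0 1 2 1 2 1 2 2 1 2 1 1 1 2 1 1 1 1 2 1 1 2 2"
| "e6_H P12 = case_e6_class 1 1 1 1 0 1 2 1 2 1 2 2 1 2 1 1 1 2 1 1 1 1 2 1 1 2 2"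
| "e6_H P13 = case_e6_class 0 0 0 0 0 1 1 0 1 0 1 1 0 2 0 0 0 1 0 0 0 0 1 0 0 1 1"
| "e6_H P14 = case_e6_class 1 1 1 0 0 1 2 2 2 2 2 1 1 2 2 1 1 2 1 1 1 1 2 1 1 2 2"
| "e6_H P15 = case_e6_class 1 1 1 0 0 1 2 2 2 2 2 1 1 2 2 1 1 2 1 1 1 1 2 1 1 2 2"
| "e6_H P16 = case_e6_class 1 1 1 1 1 1 2 2 2 2 2 2 2 2 2 1 2 2 1 1 1 1 2 1 1 2 2"
| "e6_H P17 = case_e6_class 0 0 0 0 0 1 1 1 1 1 1 1 1 2 1 0 1 2 0 0 0 0 1 0 0 1 1"
| "e6_H P18 = case_e6_class 1 1 1 1 0 1 2 2 2 2 2 2 1 2 2 2 1 2 2 1 1 1 2 1 1 2 2"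
| "e6_H P19 = case_e6_class 1 1 1 1 0 1 2 2 2 2 2 2 1 2 2 2 1 2 2 2 1 1 2 1 1 2 2"
| "e6_H P20 = case_e6_class 1 1 1 1 0 1 2 2 2 2 2 2 1 2 2 2 1 2 2 2 2 1 2 1 1 2 2"
| "e6_H P21 = case_e6_class 1 1 1 1 1 1 2 2 2 2 2 2 2 2 2 2 2 2 2 1 1 2 2 1 1 2 2"
| "e6_H P22 = case_e6_class 0 0 0 0 0 1 1 1 1 1 1 1 1 2 1 1 1 2 1 0 0 1 2 0 0 1 1"
| "e6_H P23 = case_e6_class 1 1 1 1 1 1 2 2 2 2 2 2 2 2 2 2 2 2 2 2 1 2 2 2 1 2 2"
| "e6_H P24 = case_e6_class 1 1 1 1 1 1 2 2 2 2 2 2 2 2 2 2 2 2 2 2 2 2 2 2 2 2 2"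
| "e6_H P25 = case_e6_class 0 0 0 0 0 1 1 1 1 1 1 1 1 2 1 1 1 2 1 1 0 1 2 1 0 2 1"
| "e6_H P26 = case_e6_class 0 0 0 0 0 1 1 1 1 1 1 1 1 2 1 1 1 2 1 1 1 1 2 1 1 2 2"

text \<open>The number of raising steps with \<open>i \<noteq> I0\<close> to the highest weight
  class \<open>P5\<close> or \<open>P13\<close> of the component.\<close>

definition e6_height :: "e6_class \<Rightarrow> nat" where "e6_height = case_e6_class 12 13 14 15
    16 0 4 5 5 6 6 7 8 0 7 8 9 1 9 10 11 10 2 11 12 3 4"

text \<open>One entry for each of the eight classical components of the tensor square: three with a
  factor \<open>P5\<close>, and five from the product of the 26-element component with itself. In a
  walk, \<open>True\<close> stands for raising.\<close>

definition e6_walks :: "((e6_class \<times> e6_class) \<times> (bool \<times> idx) list) list" where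
  "e6_walks = [((P5, P5), []), ((P5, P13), [(True, I0)]), ((P13, P4), [(False, I0), (False, I1),
    (False, I2), (False, I3), (False, I4), (False, I2), (False, I3), (False, I1), (False, I2),
    (False, I2), (False, I3), (False, I4), (False, I1), (False, I2), (False, I3), (False, I2),
    (False, I1), (False, I0)]), ((P13, P5), [(False, I1), (False, I2), (False, I3), (False, I4),
    (False, I2), (False, I3), (False, I1), (False, I2), (False, I2), (False, I3), (False, I4),
    (False, I1), (False, I2), (False, I3), (False, I2), (False, I1), (False, I0)]), ((P13, P7),
    [(True, I0), (True, I1), (True, I2), (True, I3), (True, I2), (True, I1), (True, I0)]), ((P13,
    P12), [(True, I0), (True, I1), (True, I2), (True, I3), (True, I4), (True, I2), (True, I3),
    (True, I2), (True, I1), (True, I0)]), ((P13, P13), [(False, I1), (False, I2), (False, I3),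
    (False, I4), (False, I2), (False, I3), (False, I1), (False, I2), (False, I2), (False, I3),
    (False, I4), (False, I1), (False, I2), (False, I3), (False, I2), (True, I0), (False, I1),
    (False, I0)]), ((P13, P17), [(True, I0), (True, I1), (True, I0), (True, I1), (True, I2),
    (True, I3), (True, I4), (True, I2), (True, I3), (True, I2), (True, I1), (True, I0)])]"

lemma e6_simps [simp]:
  "colour e6 = e6_colour" "level e6 = e6_level" "cartan e6 = e6_cartan"
  "rests_on e6 = e6_rests_on" "y_empty e6 = e6_y_empty" "y_r e6 = e6_y_r"
  by (simp_all add: e6_def)

lemma set_e6_letters: "set e6_letters = UNIV"
proof -
  have "l \<in> set e6_letters" for l by (cases l) (simp_all add: e6_letters_def)
  then show ?thesis by blast
qed

lemma set_e6_classes: "set e6_classes = UNIV"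
proof -
  have "c \<in> set e6_classes" for c by (cases c) (simp_all add: e6_classes_def)
  then show ?thesis by blast
qed

lemma e6_rests_on_eq: "e6_rests_on b = set (block_data.rests e6_rl b)"
proof (cases b)
  case (Pair l m)
  then show ?thesis by (cases l) (simp_all add: block_data.rests_def)
qed

text \<open>Nothing of the same index rests on \<open>E_z\<close>, \<open>E_b''\<close> or
  \<open>E_d\<close>, but \<open>E_a\<close> or \<open>E_c\<close> of the next index does. This
  dictates the choice of \<open>caps\<close>.\<close>

lemma e6_letter_ok: "distinct e6_letters"
  "list_all (block_data.letter_ok e6_level e6_rl [E_a, E_c] e6_letters) e6_letters"
  "block_data.null_ok e6_colour e6_cartan e6_letters"
  "block_data.anchor_ok e6_rl E_b'' e6_base e6_cand e6_letters"
  by code_simp+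

lemma e6_columns_ok:
  "class_data.columns_ok e6_colour e6_level e6_rl e6_window e6_rep e6_f e6_e e6_phi e6_eps
     e6_r P5 e6_cartan E_b'' [E_a, E_c] e6_base e6_cand e6_classes"
  by code_simp

lemma e6_energies_ok:
  "class_data.energies_ok e6_colour e6_window e6_rep e6_f e6_e e6_phi e6_eps P5 e6_H
     e6_height e6_classes e6_walks"
  by code_simp

lemma set_e6_window: "set e6_window = {b. snd b = -1 \<or> snd b = 0 \<or> snd b = 1}"
  using set_e6_letters unfolding e6_window_def by (force simp: prod_eq_iff)

text \<open>In the named columns the highest anchor block has index 0 rather than -1, whence the
  shift by one.\<close>

lemma e6_y_r_eq:
  "e6_y_r j = map_option (\<lambda>c. sigma_pow 1 (block_data.list_col (e6_rep c))) (e6_r j)"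
proof (cases j)
  case I0
  then show ?thesis by (simp add: e6_r_def)
next
  case I1
  have "(l, m) \<in> the (e6_y_r I1) \<longleftrightarrow>
      (l, m - 1) \<in> block_data.list_col (e6_rep P12)" for l m
    by (cases l) (auto simp: e6_D_def block_data.list_col_def e6_base_def)
  then have "the (e6_y_r I1) = sigma_pow 1 (block_data.list_col (e6_rep P12))"
    by (rule eq_sigma_pow_1)
  then show ?thesis using I1 by (simp add: e6_r_def)
next
  case I2
  have "(l, m) \<in> the (e6_y_r I2) \<longleftrightarrow>
      (l, m - 1) \<in> block_data.list_col (e6_rep P15)" for l m
    by (cases l) (auto simp: e6_D_def block_data.list_col_def e6_base_def)
  then have "the (e6_y_r I2) = sigma_pow 1 (block_data.list_col (e6_rep P15))"
    by (rule eq_sigma_pow_1)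
  then show ?thesis using I2 by (simp add: e6_r_def)
next
  case I3
  then show ?thesis by (simp add: e6_r_def)
next
  case I4
  then show ?thesis by (simp add: e6_r_def)
qed

lemma e6_y_empty_eq: "e6_y_empty = sigma_pow 1 (block_data.list_col (e6_rep P5))"
proof (rule eq_sigma_pow_1)
  fix l m
  show "(l, m) \<in> e6_y_empty \<longleftrightarrow>
      (l, m - 1) \<in> block_data.list_col (e6_rep P5)"
    by (cases l) (auto simp: e6_y_empty_def e6_D_def block_data.list_col_def e6_base_def)
qed

interpretation e6: column_model e6 e6_rl "[E_a, E_c]" e6_letters e6_window e6_rep e6_f e6_e
  e6_phi e6_eps e6_r P5 e6_H E_b'' e6_base e6_cand e6_classes e6_height e6_walks
  by (unfold_locales; (unfold e6_simps)?;
    fact e6_rests_on_eq set_e6_letters e6_letter_ok set_e6_classes set_e6_window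
      e6_y_r_eq e6_y_empty_eq
      e6_columns_ok e6_energies_ok)

section \<open>Type \<open>F\<^sub>4\<^sup>(\<^sup>1\<^sup>)\<close>\<close>

text \<open>Here \<open>Q17\<close> is the class of \<open>y_empty\<close>, alone under the
  operators with \<open>i \<noteq> I0\<close>. The other 52 classes form the adjoint crystal of
  finite type \<open>F4\<close> with highest weight class \<open>Q33\<close>; its four classes of
  weight zero are \<open>Q32\<close>, \<open>Q41\<close>, \<open>Q36\<close> and \<open>Q28\<close>,
  named by \<open>y_r\<close>.\<close>

datatype f4_class = Q0 | Q1 | Q2 | Q3 | Q4 | Q5 | Q6 | Q7 | Q8 | Q9 | Q10 | Q11 | Q12 | Q13 | Q14
    | Q15 | Q16 | Q17 | Q18 | Q19 | Q20 | Q21 | Q22 | Q23 | Q24 | Q25 | Q26 | Q27 | Q28 | Q29 |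
    Q30 | Q31 | Q32 | Q33 | Q34 | Q35 | Q36 | Q37 | Q38 | Q39 | Q40 | Q41 | Q42 | Q43 | Q44 | Q45
    | Q46 | Q47 | Q48 | Q49 | Q50 | Q51 | Q52

definition f4_classes :: "f4_class list" where "f4_classes = [Q0, Q1, Q2, Q3, Q4, Q5, Q6, Q7, Q8,
    Q9, Q10, Q11, Q12, Q13, Q14, Q15, Q16, Q17, Q18, Q19, Q20, Q21, Q22, Q23, Q24, Q25, Q26, Q27,
    Q28, Q29, Q30, Q31, Q32, Q33, Q34, Q35, Q36, Q37, Q38, Q39, Q40, Q41, Q42, Q43, Q44, Q45, Q46,
    Q47, Q48, Q49, Q50, Q51, Q52]"
definition f4_letters :: "f4_letter list" where "f4_letters = [F_c1, F_d1, F_a1, F_c2, F_b1, F_b2,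
    F_c3, F_a2, F_c4, F_d2, F_z, F_b3]"

primrec f4_rl :: "f4_letter \<Rightarrow> (f4_letter \<times> int) list" where
"f4_rl F_c1 = [(F_b3, -1), (F_c4, -1), (F_d2, -1)]"
| "f4_rl F_d1 = [(F_c4, -1), (F_d2, -1)]"
| "f4_rl F_a1 = [(F_z, -1), (F_b3, -1)]"
| "f4_rl F_c2 = [(F_c1, 0), (F_d1, 0)]"
| "f4_rl F_b1 = [(F_c1, 0), (F_a1, 0)]"
| "f4_rl F_b2 = [(F_c2, 0)]"
| "f4_rl F_c3 = [(F_b1, 0)]"
| "f4_rl F_a2 = [(F_b2, 0)]"
| "f4_rl F_c4 = [(F_b2, 0), (F_c3, 0)]"
| "f4_rl F_d2 = [(F_c3, 0)]"
| "f4_rl F_z = [(F_a2, 0)]"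
| "f4_rl F_b3 = [(F_a2, 0), (F_c4, 0)]"

definition f4_window :: "f4_letter block list" where "f4_window = concat (map (\<lambda>l. [(l,
    -1), (l, 0), (l, 1)]) f4_letters)"
text \<open>The anchor is \<open>F_c4\<close>. The letters not below it, \<open>F_a2\<close>,
  \<open>F_d2\<close>, \<open>F_z\<close> and \<open>F_b3\<close>, are left to choice at index -1;
  at index 0 the block \<open>F_b3\<close> drops out together with the anchor, on which it
  rests.\<close>

definition f4_base :: "f4_letter block list" where "f4_base = [(F_c1, -1), (F_d1, -1), (F_a1, -1),
    (F_c2, -1), (F_b1, -1), (F_b2, -1), (F_c3, -1), (F_c4, -1)]"
definition f4_cand :: "f4_letter block list" where "f4_cand = [(F_a2, -1), (F_d2, -1), (F_z, -1),
    (F_b3, -1), (F_c1, 0), (F_d1, 0), (F_a1, 0), (F_c2, 0), (F_b1, 0), (F_b2, 0), (F_c3, 0),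
    (F_a2, 0), (F_d2, 0), (F_z, 0)]"

primrec f4_rep :: "f4_class \<Rightarrow> f4_letter block list" where
"f4_rep Q0 = [] @ f4_base"
| "f4_rep Q1 = [(F_d2, -1)] @ f4_base"
| "f4_rep Q2 = [(F_d1, 0), (F_d2, -1)] @ f4_base"
| "f4_rep Q3 = [(F_a2, -1)] @ f4_base"
| "f4_rep Q4 = [(F_b3, -1), (F_a2, -1)] @ f4_base"
| "f4_rep Q5 = [(F_z, -1), (F_a2, -1)] @ f4_base"
| "f4_rep Q6 = [(F_b3, -1), (F_z, -1), (F_a2, -1)] @ f4_base"
| "f4_rep Q7 = [(F_a1, 0), (F_b3, -1), (F_z, -1), (F_a2, -1)] @ f4_base"
| "f4_rep Q8 = [(F_d2, -1), (F_a2, -1)] @ f4_base"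
| "f4_rep Q9 = [(F_d1, 0), (F_d2, -1), (F_a2, -1)] @ f4_base"
| "f4_rep Q10 = [(F_b3, -1), (F_d2, -1), (F_a2, -1)] @ f4_base"
| "f4_rep Q11 = [(F_d1, 0), (F_b3, -1), (F_d2, -1), (F_a2, -1)] @ f4_base"
| "f4_rep Q12 = [(F_c1, 0), (F_b3, -1), (F_d2, -1), (F_a2, -1)] @ f4_base"
| "f4_rep Q13 = [(F_d1, 0), (F_c1, 0), (F_b3, -1), (F_d2, -1), (F_a2, -1)] @ f4_base"
| "f4_rep Q14 = [(F_c2, 0), (F_d1, 0), (F_c1, 0), (F_b3, -1), (F_d2, -1), (F_a2, -1)] @ f4_base"
| "f4_rep Q15 = [(F_b2, 0), (F_c2, 0), (F_d1, 0), (F_c1, 0), (F_b3, -1), (F_d2, -1), (F_a2, -1)] @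
    f4_base"
| "f4_rep Q16 = [(F_a2, 0), (F_b2, 0), (F_c2, 0), (F_d1, 0), (F_c1, 0), (F_b3, -1), (F_d2, -1),
    (F_a2, -1)] @ f4_base"
| "f4_rep Q17 = [(F_z, 0), (F_a2, 0), (F_b2, 0), (F_c2, 0), (F_d1, 0), (F_c1, 0), (F_b3, -1), (F_d2,
    -1), (F_a2, -1)] @ f4_base"
| "f4_rep Q18 = [(F_z, -1), (F_d2, -1), (F_a2, -1)] @ f4_base"
| "f4_rep Q19 = [(F_d1, 0), (F_z, -1), (F_d2, -1), (F_a2, -1)] @ f4_base"
| "f4_rep Q20 = [(F_b3, -1), (F_z, -1), (F_d2, -1), (F_a2, -1)] @ f4_base"
| "f4_rep Q21 = [(F_a1, 0), (F_b3, -1), (F_z, -1), (F_d2, -1), (F_a2, -1)] @ f4_base"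
| "f4_rep Q22 = [(F_d1, 0), (F_b3, -1), (F_z, -1), (F_d2, -1), (F_a2, -1)] @ f4_base"
| "f4_rep Q23 = [(F_a1, 0), (F_d1, 0), (F_b3, -1), (F_z, -1), (F_d2, -1), (F_a2, -1)] @ f4_base"
| "f4_rep Q24 = [(F_c1, 0), (F_b3, -1), (F_z, -1), (F_d2, -1), (F_a2, -1)] @ f4_base"
| "f4_rep Q25 = [(F_a1, 0), (F_c1, 0), (F_b3, -1), (F_z, -1), (F_d2, -1), (F_a2, -1)] @ f4_base"
| "f4_rep Q26 = [(F_b1, 0), (F_a1, 0), (F_c1, 0), (F_b3, -1), (F_z, -1), (F_d2, -1), (F_a2, -1)] @
    f4_base"
| "f4_rep Q27 = [(F_c3, 0), (F_b1, 0), (F_a1, 0), (F_c1, 0), (F_b3, -1), (F_z, -1), (F_d2, -1),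
    (F_a2, -1)] @ f4_base"
| "f4_rep Q28 = [(F_d2, 0), (F_c3, 0), (F_b1, 0), (F_a1, 0), (F_c1, 0), (F_b3, -1), (F_z, -1),
    (F_d2, -1), (F_a2, -1)] @ f4_base"
| "f4_rep Q29 = [(F_d1, 0), (F_c1, 0), (F_b3, -1), (F_z, -1), (F_d2, -1), (F_a2, -1)] @ f4_base"
| "f4_rep Q30 = [(F_c2, 0), (F_d1, 0), (F_c1, 0), (F_b3, -1), (F_z, -1), (F_d2, -1), (F_a2, -1)] @
    f4_base"
| "f4_rep Q31 = [(F_b2, 0), (F_c2, 0), (F_d1, 0), (F_c1, 0), (F_b3, -1), (F_z, -1), (F_d2, -1),
    (F_a2, -1)] @ f4_base"
| "f4_rep Q32 = [(F_a2, 0), (F_b2, 0), (F_c2, 0), (F_d1, 0), (F_c1, 0), (F_b3, -1), (F_z, -1),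
    (F_d2, -1), (F_a2, -1)] @ f4_base"
| "f4_rep Q33 = [(F_z, 0), (F_a2, 0), (F_b2, 0), (F_c2, 0), (F_d1, 0), (F_c1, 0), (F_b3, -1), (F_z,
    -1), (F_d2, -1), (F_a2, -1)] @ f4_base"
| "f4_rep Q34 = [(F_a1, 0), (F_d1, 0), (F_c1, 0), (F_b3, -1), (F_z, -1), (F_d2, -1), (F_a2, -1)] @
    f4_base"
| "f4_rep Q35 = [(F_b1, 0), (F_a1, 0), (F_d1, 0), (F_c1, 0), (F_b3, -1), (F_z, -1), (F_d2, -1),
    (F_a2, -1)] @ f4_base"
| "f4_rep Q36 = [(F_c3, 0), (F_b1, 0), (F_a1, 0), (F_d1, 0), (F_c1, 0), (F_b3, -1), (F_z, -1),
    (F_d2, -1), (F_a2, -1)] @ f4_base"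
| "f4_rep Q37 = [(F_d2, 0), (F_c3, 0), (F_b1, 0), (F_a1, 0), (F_d1, 0), (F_c1, 0), (F_b3, -1), (F_z,
    -1), (F_d2, -1), (F_a2, -1)] @ f4_base"
| "f4_rep Q38 = [(F_c2, 0), (F_a1, 0), (F_d1, 0), (F_c1, 0), (F_b3, -1), (F_z, -1), (F_d2, -1),
    (F_a2, -1)] @ f4_base"
| "f4_rep Q39 = [(F_a2, 0), (F_b2, 0), (F_c2, 0), (F_a1, 0), (F_d1, 0), (F_c1, 0), (F_b3, -1), (F_z,
    -1), (F_d2, -1), (F_a2, -1)] @ f4_base"
| "f4_rep Q40 = [(F_z, 0), (F_a2, 0), (F_b2, 0), (F_c2, 0), (F_a1, 0), (F_d1, 0), (F_c1, 0), (F_b3,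
    -1), (F_z, -1), (F_d2, -1), (F_a2, -1)] @ f4_base"
| "f4_rep Q41 = [(F_b1, 0), (F_c2, 0), (F_a1, 0), (F_d1, 0), (F_c1, 0), (F_b3, -1), (F_z, -1),
    (F_d2, -1), (F_a2, -1)] @ f4_base"
| "f4_rep Q42 = [(F_c3, 0), (F_b1, 0), (F_c2, 0), (F_a1, 0), (F_d1, 0), (F_c1, 0), (F_b3, -1), (F_z,
    -1), (F_d2, -1), (F_a2, -1)] @ f4_base"
| "f4_rep Q43 = [(F_d2, 0), (F_c3, 0), (F_b1, 0), (F_c2, 0), (F_a1, 0), (F_d1, 0), (F_c1, 0), (F_b3,
    -1), (F_z, -1), (F_d2, -1), (F_a2, -1)] @ f4_base"
| "f4_rep Q44 = [(F_b2, 0), (F_b1, 0), (F_c2, 0), (F_a1, 0), (F_d1, 0), (F_c1, 0), (F_b3, -1), (F_z,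
    -1), (F_d2, -1), (F_a2, -1)] @ f4_base"
| "f4_rep Q45 = [(F_a2, 0), (F_b2, 0), (F_b1, 0), (F_c2, 0), (F_a1, 0), (F_d1, 0), (F_c1, 0), (F_b3,
    -1), (F_z, -1), (F_d2, -1), (F_a2, -1)] @ f4_base"
| "f4_rep Q46 = [(F_z, 0), (F_a2, 0), (F_b2, 0), (F_b1, 0), (F_c2, 0), (F_a1, 0), (F_d1, 0), (F_c1,
    0), (F_b3, -1), (F_z, -1), (F_d2, -1), (F_a2, -1)] @ f4_base"
| "f4_rep Q47 = [(F_c3, 0), (F_b2, 0), (F_b1, 0), (F_c2, 0), (F_a1, 0), (F_d1, 0), (F_c1, 0), (F_b3,
    -1), (F_z, -1), (F_d2, -1), (F_a2, -1)] @ f4_base"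
| "f4_rep Q48 = [(F_d2, 0), (F_c3, 0), (F_b2, 0), (F_b1, 0), (F_c2, 0), (F_a1, 0), (F_d1, 0), (F_c1,
    0), (F_b3, -1), (F_z, -1), (F_d2, -1), (F_a2, -1)] @ f4_base"
| "f4_rep Q49 = [(F_a2, 0), (F_c3, 0), (F_b2, 0), (F_b1, 0), (F_c2, 0), (F_a1, 0), (F_d1, 0), (F_c1,
    0), (F_b3, -1), (F_z, -1), (F_d2, -1), (F_a2, -1)] @ f4_base"
| "f4_rep Q50 = [(F_z, 0), (F_a2, 0), (F_c3, 0), (F_b2, 0), (F_b1, 0), (F_c2, 0), (F_a1, 0), (F_d1,
    0), (F_c1, 0), (F_b3, -1), (F_z, -1), (F_d2, -1), (F_a2, -1)] @ f4_base"
| "f4_rep Q51 = [(F_d2, 0), (F_a2, 0), (F_c3, 0), (F_b2, 0), (F_b1, 0), (F_c2, 0), (F_a1, 0), (F_d1,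
    0), (F_c1, 0), (F_b3, -1), (F_z, -1), (F_d2, -1), (F_a2, -1)] @ f4_base"
| "f4_rep Q52 = [(F_z, 0), (F_d2, 0), (F_a2, 0), (F_c3, 0), (F_b2, 0), (F_b1, 0), (F_c2, 0), (F_a1,
    0), (F_d1, 0), (F_c1, 0), (F_b3, -1), (F_z, -1), (F_d2, -1), (F_a2, -1)] @ f4_base"

primrec f4_f :: "f4_class \<Rightarrow> idx \<Rightarrow> (f4_letter block \<times> f4_class \<times> int) option" where
"f4_f Q0 = case_idx None (Some ((F_a2, -1), Q3, 0)) None None (Some ((F_d2, -1), Q1, 0))"
| "f4_f Q1 = case_idx None (Some ((F_a2, -1), Q8, 0)) None None (Some ((F_d1, 0), Q2, 0))"
| "f4_f Q2 = case_idx None (Some ((F_a2, -1), Q9, 0)) None None None"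
| "f4_f Q3 = case_idx (Some ((F_z, -1), Q5, 0)) None (Some ((F_b3, -1), Q4, 0)) None (Some ((F_d2,
    -1), Q8, 0))"
| "f4_f Q4 = case_idx (Some ((F_z, -1), Q6, 0)) None None None (Some ((F_d2, -1), Q10, 0))"
| "f4_f Q5 = case_idx None None (Some ((F_b3, -1), Q6, 0)) None (Some ((F_d2, -1), Q18, 0))"
| "f4_f Q6 = case_idx None (Some ((F_a1, 0), Q7, 0)) None None (Some ((F_d2, -1), Q20, 0))"
| "f4_f Q7 = case_idx None None None None (Some ((F_d2, -1), Q21, 0))"
| "f4_f Q8 = case_idx (Some ((F_z, -1), Q18, 0)) None (Some ((F_b3, -1), Q10, 0)) None (Some ((F_d1,
    0), Q9, 0))"
| "f4_f Q9 = case_idx (Some ((F_z, -1), Q19, 0)) None (Some ((F_b3, -1), Q11, 0)) None None"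
| "f4_f Q10 = case_idx (Some ((F_z, -1), Q20, 0)) None None (Some ((F_c1, 0), Q12, 0)) (Some ((F_d1,
    0), Q11, 0))"
| "f4_f Q11 = case_idx (Some ((F_z, -1), Q22, 0)) None None (Some ((F_c1, 0), Q13, 0)) None"
| "f4_f Q12 = case_idx (Some ((F_z, -1), Q24, 0)) None None None (Some ((F_d1, 0), Q13, 0))"
| "f4_f Q13 = case_idx (Some ((F_z, -1), Q29, 0)) None None (Some ((F_c2, 0), Q14, 0)) None"
| "f4_f Q14 = case_idx (Some ((F_z, -1), Q30, 0)) None (Some ((F_b2, 0), Q15, 0)) None None"
| "f4_f Q15 = case_idx (Some ((F_z, -1), Q31, 0)) (Some ((F_a2, 0), Q16, 0)) None None None"
| "f4_f Q16 = case_idx (Some ((F_z, 0), Q17, 0)) None None None None"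
| "f4_f Q17 = case_idx (Some ((F_z, -1), Q33, 0)) None None None None"
| "f4_f Q18 = case_idx None None (Some ((F_b3, -1), Q20, 0)) None (Some ((F_d1, 0), Q19, 0))"
| "f4_f Q19 = case_idx None None (Some ((F_b3, -1), Q22, 0)) None None"
| "f4_f Q20 = case_idx None (Some ((F_a1, 0), Q21, 0)) None (Some ((F_c1, 0), Q24, 0)) (Some ((F_d1,
    0), Q22, 0))"
| "f4_f Q21 = case_idx None None None (Some ((F_c1, 0), Q25, 0)) (Some ((F_d1, 0), Q23, 0))"
| "f4_f Q22 = case_idx None (Some ((F_a1, 0), Q23, 0)) None (Some ((F_c1, 0), Q29, 0)) None"
| "f4_f Q23 = case_idx None None None (Some ((F_c1, 0), Q34, 0)) None"
| "f4_f Q24 = case_idx None (Some ((F_a1, 0), Q25, 0)) None None (Some ((F_d1, 0), Q29, 0))"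
| "f4_f Q25 = case_idx None None (Some ((F_b1, 0), Q26, 0)) None (Some ((F_d1, 0), Q34, 0))"
| "f4_f Q26 = case_idx None None None (Some ((F_c3, 0), Q27, 0)) (Some ((F_d1, 0), Q35, 0))"
| "f4_f Q27 = case_idx None None None None (Some ((F_d2, 0), Q28, 0))"
| "f4_f Q28 = case_idx None None None None (Some ((F_d1, 0), Q37, 0))"
| "f4_f Q29 = case_idx None (Some ((F_a1, 0), Q34, 0)) None (Some ((F_c2, 0), Q30, 0)) None"
| "f4_f Q30 = case_idx None (Some ((F_a1, 0), Q38, 0)) (Some ((F_b2, 0), Q31, 0)) None None"
| "f4_f Q31 = case_idx None (Some ((F_a2, 0), Q32, 0)) None None None"
| "f4_f Q32 = case_idx None (Some ((F_a1, 0), Q39, 0)) None None None"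
| "f4_f Q33 = case_idx None (Some ((F_a1, 0), Q40, 0)) None None None"
| "f4_f Q34 = case_idx None None (Some ((F_b1, 0), Q35, 0)) (Some ((F_c2, 0), Q38, 0)) None"
| "f4_f Q35 = case_idx None None None (Some ((F_c3, 0), Q36, 0)) None"
| "f4_f Q36 = case_idx None None None (Some ((F_c2, 0), Q42, 0)) None"
| "f4_f Q37 = case_idx None None None (Some ((F_c2, 0), Q43, 0)) None"
| "f4_f Q38 = case_idx None None (Some ((F_b1, 0), Q41, 0)) None None"
| "f4_f Q39 = case_idx (Some ((F_z, 0), Q40, 0)) None (Some ((F_b1, 0), Q45, 0)) None None"
| "f4_f Q40 = case_idx None None (Some ((F_b1, 0), Q46, 0)) None None"
| "f4_f Q41 = case_idx None None (Some ((F_b2, 0), Q44, 0)) None None"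
| "f4_f Q42 = case_idx None None (Some ((F_b2, 0), Q47, 0)) None (Some ((F_d2, 0), Q43, 0))"
| "f4_f Q43 = case_idx None None (Some ((F_b2, 0), Q48, 0)) None None"
| "f4_f Q44 = case_idx None (Some ((F_a2, 0), Q45, 0)) None (Some ((F_c3, 0), Q47, 0)) None"
| "f4_f Q45 = case_idx (Some ((F_z, 0), Q46, 0)) None None (Some ((F_c3, 0), Q49, 0)) None"
| "f4_f Q46 = case_idx None None None (Some ((F_c3, 0), Q50, 0)) None"
| "f4_f Q47 = case_idx None (Some ((F_a2, 0), Q49, 0)) None (Some ((F_c4, 0), Q0, 1)) (Some ((F_d2,
    0), Q48, 0))"
| "f4_f Q48 = case_idx None (Some ((F_a2, 0), Q51, 0)) None (Some ((F_c4, 0), Q1, 1)) None"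
| "f4_f Q49 = case_idx (Some ((F_z, 0), Q50, 0)) None None (Some ((F_c4, 0), Q3, 1)) (Some ((F_d2,
    0), Q51, 0))"
| "f4_f Q50 = case_idx None None None (Some ((F_c4, 0), Q5, 1)) (Some ((F_d2, 0), Q52, 0))"
| "f4_f Q51 = case_idx (Some ((F_z, 0), Q52, 0)) None None (Some ((F_c4, 0), Q8, 1)) None"
| "f4_f Q52 = case_idx None None None (Some ((F_c4, 0), Q18, 1)) None"

primrec f4_e :: "f4_class \<Rightarrow> idx \<Rightarrow> f4_class option" where
"f4_e Q0 = case_idx None None None (Some Q47) None"
| "f4_e Q1 = case_idx None None None (Some Q48) (Some Q0)"
| "f4_e Q2 = case_idx None None None None (Some Q1)"
| "f4_e Q3 = case_idx None (Some Q0) None (Some Q49) None"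
| "f4_e Q4 = case_idx None None (Some Q3) None None"
| "f4_e Q5 = case_idx (Some Q3) None None (Some Q50) None"
| "f4_e Q6 = case_idx (Some Q4) None (Some Q5) None None"
| "f4_e Q7 = case_idx None (Some Q6) None None None"
| "f4_e Q8 = case_idx None (Some Q1) None (Some Q51) (Some Q3)"
| "f4_e Q9 = case_idx None (Some Q2) None None (Some Q8)"
| "f4_e Q10 = case_idx None None (Some Q8) None (Some Q4)"
| "f4_e Q11 = case_idx None None (Some Q9) None (Some Q10)"
| "f4_e Q12 = case_idx None None None (Some Q10) None"
| "f4_e Q13 = case_idx None None None (Some Q11) (Some Q12)"
| "f4_e Q14 = case_idx None None None (Some Q13) None"
| "f4_e Q15 = case_idx None None (Some Q14) None None"
| "f4_e Q16 = case_idx None (Some Q15) None None None"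
| "f4_e Q17 = case_idx (Some Q16) None None None None"
| "f4_e Q18 = case_idx (Some Q8) None None (Some Q52) (Some Q5)"
| "f4_e Q19 = case_idx (Some Q9) None None None (Some Q18)"
| "f4_e Q20 = case_idx (Some Q10) None (Some Q18) None (Some Q6)"
| "f4_e Q21 = case_idx None (Some Q20) None None (Some Q7)"
| "f4_e Q22 = case_idx (Some Q11) None (Some Q19) None (Some Q20)"
| "f4_e Q23 = case_idx None (Some Q22) None None (Some Q21)"
| "f4_e Q24 = case_idx (Some Q12) None None (Some Q20) None"
| "f4_e Q25 = case_idx None (Some Q24) None (Some Q21) None"
| "f4_e Q26 = case_idx None None (Some Q25) None None"
| "f4_e Q27 = case_idx None None None (Some Q26) None"
| "f4_e Q28 = case_idx None None None None (Some Q27)"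
| "f4_e Q29 = case_idx (Some Q13) None None (Some Q22) (Some Q24)"
| "f4_e Q30 = case_idx (Some Q14) None None (Some Q29) None"
| "f4_e Q31 = case_idx (Some Q15) None (Some Q30) None None"
| "f4_e Q32 = case_idx None (Some Q31) None None None"
| "f4_e Q33 = case_idx (Some Q17) None None None None"
| "f4_e Q34 = case_idx None (Some Q29) None (Some Q23) (Some Q25)"
| "f4_e Q35 = case_idx None None (Some Q34) None (Some Q26)"
| "f4_e Q36 = case_idx None None None (Some Q35) None"
| "f4_e Q37 = case_idx None None None None (Some Q28)"
| "f4_e Q38 = case_idx None (Some Q30) None (Some Q34) None"
| "f4_e Q39 = case_idx None (Some Q32) None None None"
| "f4_e Q40 = case_idx (Some Q39) (Some Q33) None None None"
| "f4_e Q41 = case_idx None None (Some Q38) None None"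
| "f4_e Q42 = case_idx None None None (Some Q36) None"
| "f4_e Q43 = case_idx None None None (Some Q37) (Some Q42)"
| "f4_e Q44 = case_idx None None (Some Q41) None None"
| "f4_e Q45 = case_idx None (Some Q44) (Some Q39) None None"
| "f4_e Q46 = case_idx (Some Q45) None (Some Q40) None None"
| "f4_e Q47 = case_idx None None (Some Q42) (Some Q44) None"
| "f4_e Q48 = case_idx None None (Some Q43) None (Some Q47)"
| "f4_e Q49 = case_idx None (Some Q47) None (Some Q45) None"
| "f4_e Q50 = case_idx (Some Q49) None None (Some Q46) None"
| "f4_e Q51 = case_idx None (Some Q48) None None (Some Q49)"
| "f4_e Q52 = case_idx (Some Q51) None None None (Some Q50)"

primrec f4_phi :: "f4_class \<Rightarrow> idx \<Rightarrow> nat" where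
"f4_phi Q0 = case_idx 0 1 0 0 2"
| "f4_phi Q1 = case_idx 0 1 0 0 1"
| "f4_phi Q2 = case_idx 0 1 0 0 0"
| "f4_phi Q3 = case_idx 1 0 1 0 2"
| "f4_phi Q4 = case_idx 1 0 0 0 2"
| "f4_phi Q5 = case_idx 0 0 1 0 2"
| "f4_phi Q6 = case_idx 0 1 0 0 2"
| "f4_phi Q7 = case_idx 0 0 0 0 2"
| "f4_phi Q8 = case_idx 1 0 1 0 1"
| "f4_phi Q9 = case_idx 1 0 1 0 0"
| "f4_phi Q10 = case_idx 1 0 0 1 1"
| "f4_phi Q11 = case_idx 1 0 0 2 0"
| "f4_phi Q12 = case_idx 1 0 0 0 1"
| "f4_phi Q13 = case_idx 1 0 0 1 0"
| "f4_phi Q14 = case_idx 1 0 1 0 0"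
| "f4_phi Q15 = case_idx 1 1 0 0 0"
| "f4_phi Q16 = case_idx 2 0 0 0 0"
| "f4_phi Q17 = case_idx 1 0 0 0 0"
| "f4_phi Q18 = case_idx 0 0 1 0 1"
| "f4_phi Q19 = case_idx 0 0 1 0 0"
| "f4_phi Q20 = case_idx 0 1 0 1 1"
| "f4_phi Q21 = case_idx 0 0 0 1 1"
| "f4_phi Q22 = case_idx 0 1 0 2 0"
| "f4_phi Q23 = case_idx 0 0 0 2 0"
| "f4_phi Q24 = case_idx 0 1 0 0 1"
| "f4_phi Q25 = case_idx 0 0 1 0 1"
| "f4_phi Q26 = case_idx 0 0 0 1 1"
| "f4_phi Q27 = case_idx 0 0 0 0 2"
| "f4_phi Q28 = case_idx 0 0 0 0 1"
| "f4_phi Q29 = case_idx 0 1 0 1 0"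
| "f4_phi Q30 = case_idx 0 1 1 0 0"
| "f4_phi Q31 = case_idx 0 2 0 0 0"
| "f4_phi Q32 = case_idx 0 1 0 0 0"
| "f4_phi Q33 = case_idx 0 1 0 0 0"
| "f4_phi Q34 = case_idx 0 0 1 1 0"
| "f4_phi Q35 = case_idx 0 0 0 2 0"
| "f4_phi Q36 = case_idx 0 0 0 1 0"
| "f4_phi Q37 = case_idx 0 0 0 1 0"
| "f4_phi Q38 = case_idx 0 0 2 0 0"
| "f4_phi Q39 = case_idx 1 0 1 0 0"
| "f4_phi Q40 = case_idx 0 0 1 0 0"
| "f4_phi Q41 = case_idx 0 0 1 0 0"
| "f4_phi Q42 = case_idx 0 0 1 0 1"
| "f4_phi Q43 = case_idx 0 0 1 0 0"
| "f4_phi Q44 = case_idx 0 1 0 2 0"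
| "f4_phi Q45 = case_idx 1 0 0 2 0"
| "f4_phi Q46 = case_idx 0 0 0 2 0"
| "f4_phi Q47 = case_idx 0 1 0 1 1"
| "f4_phi Q48 = case_idx 0 1 0 1 0"
| "f4_phi Q49 = case_idx 1 0 0 1 1"
| "f4_phi Q50 = case_idx 0 0 0 1 1"
| "f4_phi Q51 = case_idx 1 0 0 1 0"
| "f4_phi Q52 = case_idx 0 0 0 1 0"

primrec f4_eps :: "f4_class \<Rightarrow> idx \<Rightarrow> nat" where
"f4_eps Q0 = case_idx 0 0 0 2 0"
| "f4_eps Q1 = case_idx 0 0 0 1 1"
| "f4_eps Q2 = case_idx 0 0 0 0 2"
| "f4_eps Q3 = case_idx 0 1 0 2 0"
| "f4_eps Q4 = case_idx 0 0 1 0 0"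
| "f4_eps Q5 = case_idx 1 0 0 2 0"
| "f4_eps Q6 = case_idx 1 0 1 0 0"
| "f4_eps Q7 = case_idx 0 1 0 0 0"
| "f4_eps Q8 = case_idx 0 1 0 1 1"
| "f4_eps Q9 = case_idx 0 1 0 0 2"
| "f4_eps Q10 = case_idx 0 0 1 0 1"
| "f4_eps Q11 = case_idx 0 0 1 0 2"
| "f4_eps Q12 = case_idx 0 0 0 1 0"
| "f4_eps Q13 = case_idx 0 0 0 1 1"
| "f4_eps Q14 = case_idx 0 0 0 2 0"
| "f4_eps Q15 = case_idx 0 0 1 0 0"
| "f4_eps Q16 = case_idx 0 1 0 0 0"
| "f4_eps Q17 = case_idx 1 0 0 0 0"
| "f4_eps Q18 = case_idx 1 0 0 1 1"
| "f4_eps Q19 = case_idx 1 0 0 0 2"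
| "f4_eps Q20 = case_idx 1 0 1 0 1"
| "f4_eps Q21 = case_idx 0 1 0 0 1"
| "f4_eps Q22 = case_idx 1 0 1 0 2"
| "f4_eps Q23 = case_idx 0 1 0 0 2"
| "f4_eps Q24 = case_idx 1 0 0 1 0"
| "f4_eps Q25 = case_idx 0 1 0 1 0"
| "f4_eps Q26 = case_idx 0 0 1 0 0"
| "f4_eps Q27 = case_idx 0 0 0 1 0"
| "f4_eps Q28 = case_idx 0 0 0 0 1"
| "f4_eps Q29 = case_idx 1 0 0 1 1"
| "f4_eps Q30 = case_idx 1 0 0 2 0"
| "f4_eps Q31 = case_idx 1 0 1 0 0"
| "f4_eps Q32 = case_idx 0 1 0 0 0"
| "f4_eps Q33 = case_idx 2 0 0 0 0"
| "f4_eps Q34 = case_idx 0 1 0 1 1"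
| "f4_eps Q35 = case_idx 0 0 1 0 1"
| "f4_eps Q36 = case_idx 0 0 0 1 0"
| "f4_eps Q37 = case_idx 0 0 0 0 2"
| "f4_eps Q38 = case_idx 0 1 0 2 0"
| "f4_eps Q39 = case_idx 0 2 0 0 0"
| "f4_eps Q40 = case_idx 1 1 0 0 0"
| "f4_eps Q41 = case_idx 0 0 1 0 0"
| "f4_eps Q42 = case_idx 0 0 0 2 0"
| "f4_eps Q43 = case_idx 0 0 0 1 1"
| "f4_eps Q44 = case_idx 0 0 2 0 0"
| "f4_eps Q45 = case_idx 0 1 1 0 0"
| "f4_eps Q46 = case_idx 1 0 1 0 0"
| "f4_eps Q47 = case_idx 0 0 1 1 0"
| "f4_eps Q48 = case_idx 0 0 1 0 1"
| "f4_eps Q49 = case_idx 0 1 0 1 0"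
| "f4_eps Q50 = case_idx 1 0 0 1 0"
| "f4_eps Q51 = case_idx 0 1 0 0 1"
| "f4_eps Q52 = case_idx 1 0 0 0 1"

definition f4_r :: "idx \<Rightarrow> f4_class option" where
  "f4_r = case_idx None (Some Q32) (Some Q41) (Some Q36) (Some Q28)"

primrec f4_H :: "f4_class \<Rightarrow> f4_class \<Rightarrow> nat" where
"f4_H Q0 = case_f4_class 2 1 1 1 1 2 2 2 1 1 1 1 1 1 1 1 0 1 2 2 2 2 2 2 2 2 2 2 1 2 2 2 1 2 2 2 2
    1 2 1 2 2 2 1 2 1 2 2 1 1 2 1 2"
| "f4_H Q1 = case_f4_class 2 1 1 1 1 2 2 2 1 1 1 1 1 1 1 1 0 1 2 2 2 2 2 2 2 2 2 2 1 2 2 2 1 2 2 2 2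
    1 2 1 2 2 2 1 2 1 2 2 1 1 2 1 2"
| "f4_H Q2 = case_f4_class 2 2 2 1 1 2 2 2 1 1 1 1 1 1 1 1 0 1 2 2 2 2 2 2 2 2 2 2 2 2 2 2 1 2 2 2 2
    2 2 1 2 2 2 2 2 1 2 2 2 1 2 1 2"
| "f4_H Q3 = case_f4_class 2 1 1 2 1 2 2 2 1 1 1 1 1 1 1 1 1 1 2 2 2 2 2 2 2 2 2 2 1 2 2 2 2 2 2 2 2
    1 2 2 2 2 2 1 2 2 2 2 1 2 2 1 2"
| "f4_H Q4 = case_f4_class 2 1 1 2 2 2 2 2 1 1 1 1 1 1 1 1 1 1 2 2 2 2 2 2 2 2 2 2 1 2 2 2 2 2 2 2 2
    1 2 2 2 2 2 1 2 2 2 2 1 2 2 1 2"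
| "f4_H Q5 = case_f4_class 1 0 0 1 0 2 1 1 0 0 0 0 0 0 0 0 0 1 1 1 1 1 1 1 1 1 1 1 0 1 1 1 1 2 1 1 1
    0 1 1 2 1 1 0 1 1 2 1 0 1 2 0 1"
| "f4_H Q6 = case_f4_class 1 0 0 1 1 2 2 1 0 0 0 0 0 0 0 0 0 1 1 1 1 1 1 1 1 1 1 1 0 1 1 1 1 2 1 1 1
    0 1 1 2 1 1 0 1 1 2 1 0 1 2 0 1"
| "f4_H Q7 = case_f4_class 1 0 0 1 1 2 2 2 0 0 0 0 0 0 0 0 0 1 1 1 1 1 1 1 1 1 1 1 0 1 1 1 1 2 1 1 1
    0 1 1 2 1 1 0 1 1 2 1 0 1 2 0 1"
| "f4_H Q8 = case_f4_class 2 1 1 2 1 2 2 2 1 1 1 1 1 1 1 1 1 1 2 2 2 2 2 2 2 2 2 2 1 2 2 2 2 2 2 2 2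
    1 2 2 2 2 2 1 2 2 2 2 1 2 2 1 2"
| "f4_H Q9 = case_f4_class 2 2 2 2 1 2 2 2 2 2 1 1 1 1 1 1 1 1 2 2 2 2 2 2 2 2 2 2 2 2 2 2 2 2 2 2 2
    2 2 2 2 2 2 2 2 2 2 2 2 2 2 2 2"
| "f4_H Q10 = case_f4_class 2 1 1 2 2 2 2 2 1 1 1 1 1 1 1 1 1 1 2 2 2 2 2 2 2 2 2 2 1 2 2 2 2 2 2 2
    2 1 2 2 2 2 2 1 2 2 2 2 1 2 2 1 2"
| "f4_H Q11 = case_f4_class 2 2 2 2 2 2 2 2 2 2 2 2 1 1 1 1 1 1 2 2 2 2 2 2 2 2 2 2 2 2 2 2 2 2 2 2
    2 2 2 2 2 2 2 2 2 2 2 2 2 2 2 2 2"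
| "f4_H Q12 = case_f4_class 2 1 1 2 2 2 2 2 1 1 1 1 1 1 1 1 1 1 2 2 2 2 2 2 2 2 2 2 1 2 2 2 2 2 2 2
    2 1 2 2 2 2 2 1 2 2 2 2 1 2 2 1 2"
| "f4_H Q13 = case_f4_class 2 2 2 2 2 2 2 2 2 2 2 2 1 1 1 1 1 1 2 2 2 2 2 2 2 2 2 2 2 2 2 2 2 2 2 2
    2 2 2 2 2 2 2 2 2 2 2 2 2 2 2 2 2"
| "f4_H Q14 = case_f4_class 2 2 2 2 2 2 2 2 2 2 2 2 2 2 2 1 1 1 2 2 2 2 2 2 2 2 2 2 2 2 2 2 2 2 2 2
    2 2 2 2 2 2 2 2 2 2 2 2 2 2 2 2 2"
| "f4_H Q15 = case_f4_class 2 2 2 2 2 2 2 2 2 2 2 2 2 2 2 2 1 1 2 2 2 2 2 2 2 2 2 2 2 2 2 2 2 2 2 2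
    2 2 2 2 2 2 2 2 2 2 2 2 2 2 2 2 2"
| "f4_H Q16 = case_f4_class 2 2 2 2 2 2 2 2 2 2 2 2 2 2 2 2 2 1 2 2 2 2 2 2 2 2 2 2 2 2 2 2 2 2 2 2
    2 2 2 2 2 2 2 2 2 2 2 2 2 2 2 2 2"
| "f4_H Q17 = case_f4_class 1 1 1 1 1 1 1 1 1 1 1 1 1 1 1 1 1 0 1 1 1 1 1 1 1 1 1 1 1 1 1 1 1 1 1 1
    1 1 1 1 1 1 1 1 1 1 1 1 1 1 1 1 1"
| "f4_H Q18 = case_f4_class 1 0 0 1 0 2 1 1 0 0 0 0 0 0 0 0 0 1 1 1 1 1 1 1 1 1 1 1 0 1 1 1 1 2 1 1
    1 0 1 1 2 1 1 0 1 1 2 1 0 1 2 0 1"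
| "f4_H Q19 = case_f4_class 1 1 1 1 0 2 1 1 1 1 0 0 0 0 0 0 0 1 2 2 1 1 1 1 1 1 1 1 1 1 1 1 1 2 1 1
    1 1 1 1 2 1 1 1 1 1 2 1 1 1 2 1 2"
| "f4_H Q20 = case_f4_class 1 0 0 1 1 2 2 1 0 0 0 0 0 0 0 0 0 1 1 1 1 1 1 1 1 1 1 1 0 1 1 1 1 2 1 1
    1 0 1 1 2 1 1 0 1 1 2 1 0 1 2 0 1"
| "f4_H Q21 = case_f4_class 1 0 0 1 1 2 2 2 0 0 0 0 0 0 0 0 0 1 1 1 1 1 1 1 1 1 1 1 0 1 1 1 1 2 1 1
    1 0 1 1 2 1 1 0 1 1 2 1 0 1 2 0 1"
| "f4_H Q22 = case_f4_class 1 1 1 1 1 2 2 1 1 1 1 1 0 0 0 0 0 1 2 2 2 1 2 1 1 1 1 1 1 1 1 1 1 2 1 1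
    1 1 1 1 2 1 1 1 1 1 2 1 1 1 2 1 2"
| "f4_H Q23 = case_f4_class 1 1 1 1 1 2 2 2 1 1 1 1 0 0 0 0 0 1 2 2 2 2 2 2 1 1 1 1 1 1 1 1 1 2 1 1
    1 1 1 1 2 1 1 1 1 1 2 1 1 1 2 1 2"
| "f4_H Q24 = case_f4_class 1 0 0 1 1 2 2 1 0 0 0 0 0 0 0 0 0 1 1 1 1 1 1 1 1 1 1 1 0 1 1 1 1 2 1 1
    1 0 1 1 2 1 1 0 1 1 2 1 0 1 2 0 1"
| "f4_H Q25 = case_f4_class 1 0 0 1 1 2 2 2 0 0 0 0 0 0 0 0 0 1 1 1 1 1 1 1 1 1 1 1 0 1 1 1 1 2 1 1
    1 0 1 1 2 1 1 0 1 1 2 1 0 1 2 0 1"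
| "f4_H Q26 = case_f4_class 1 0 0 1 1 2 2 2 0 0 0 0 0 0 0 0 0 1 1 1 1 1 1 1 1 1 1 1 0 1 1 1 1 2 1 1
    1 0 1 1 2 1 1 0 1 1 2 1 0 1 2 0 1"
| "f4_H Q27 = case_f4_class 1 0 0 1 1 2 2 2 0 0 0 0 0 0 0 0 0 1 1 1 1 1 1 1 1 1 1 1 0 1 1 1 1 2 1 1
    1 0 1 1 2 1 1 0 1 1 2 1 0 1 2 0 1"
| "f4_H Q28 = case_f4_class 1 0 0 1 1 2 2 2 0 0 0 0 0 0 0 0 0 1 1 1 1 1 1 1 1 1 1 1 0 1 1 1 1 2 1 1
    1 0 1 1 2 1 1 0 1 1 2 1 0 1 2 0 1"
| "f4_H Q29 = case_f4_class 1 1 1 1 1 2 2 1 1 1 1 1 0 0 0 0 0 1 2 2 2 1 2 1 1 1 1 1 1 1 1 1 1 2 1 1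
    1 1 1 1 2 1 1 1 1 1 2 1 1 1 2 1 2"
| "f4_H Q30 = case_f4_class 1 1 1 1 1 2 2 1 1 1 1 1 1 1 1 0 0 1 2 2 2 1 2 1 2 1 1 1 1 2 2 1 1 2 1 1
    1 1 1 1 2 1 1 1 1 1 2 1 1 1 2 1 2"
| "f4_H Q31 = case_f4_class 1 1 1 1 1 2 2 1 1 1 1 1 1 1 1 1 0 1 2 2 2 1 2 1 2 1 1 1 1 2 2 2 1 2 1 1
    1 1 1 1 2 1 1 1 1 1 2 1 1 1 2 1 2"
| "f4_H Q32 = case_f4_class 1 1 1 1 1 2 2 1 1 1 1 1 1 1 1 1 0 1 2 2 2 1 2 1 2 1 1 1 1 2 2 2 1 2 1 1
    1 1 1 1 2 1 1 1 1 1 2 1 1 1 2 1 2"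
| "f4_H Q33 = case_f4_class 0 0 0 0 0 1 1 0 0 0 0 0 0 0 0 0 0 1 1 1 1 0 1 0 1 0 0 0 0 1 1 1 0 2 0 0
    0 0 0 0 1 0 0 0 0 0 1 0 0 0 1 0 1"
| "f4_H Q34 = case_f4_class 1 1 1 1 1 2 2 2 1 1 1 1 0 0 0 0 0 1 2 2 2 2 2 2 1 1 1 1 1 1 1 1 1 2 1 1
    1 1 1 1 2 1 1 1 1 1 2 1 1 1 2 1 2"
| "f4_H Q35 = case_f4_class 1 1 1 1 1 2 2 2 1 1 1 1 0 0 0 0 0 1 2 2 2 2 2 2 1 1 1 1 1 1 1 1 1 2 1 1
    1 1 1 1 2 1 1 1 1 1 2 1 1 1 2 1 2"
| "f4_H Q36 = case_f4_class 1 1 1 1 1 2 2 2 1 1 1 1 0 0 0 0 0 1 2 2 2 2 2 2 1 1 1 1 1 1 1 1 1 2 1 1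
    1 1 1 1 2 1 1 1 1 1 2 1 1 1 2 1 2"
| "f4_H Q37 = case_f4_class 1 1 1 1 1 2 2 2 1 1 1 1 0 0 0 0 0 1 2 2 2 2 2 2 1 1 1 1 1 1 1 1 1 2 1 1
    1 1 1 1 2 1 1 1 1 1 2 1 1 1 2 1 2"
| "f4_H Q38 = case_f4_class 1 1 1 1 1 2 2 2 1 1 1 1 1 1 1 0 0 1 2 2 2 2 2 2 2 2 1 1 1 2 2 1 1 2 2 1
    1 1 2 1 2 1 1 1 1 1 2 1 1 1 2 1 2"
| "f4_H Q39 = case_f4_class 1 1 1 1 1 2 2 2 1 1 1 1 1 1 1 1 1 1 2 2 2 2 2 2 2 2 1 1 1 2 2 2 2 2 2 1
    1 1 2 2 2 1 1 1 1 1 2 1 1 1 2 1 2"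
| "f4_H Q40 = case_f4_class 0 0 0 0 0 1 1 1 0 0 0 0 0 0 0 0 0 1 1 1 1 1 1 1 1 1 0 0 0 1 1 1 1 2 1 0
    0 0 1 1 2 0 0 0 0 0 1 0 0 0 1 0 1"
| "f4_H Q41 = case_f4_class 1 1 1 1 1 2 2 2 1 1 1 1 1 1 1 0 0 1 2 2 2 2 2 2 2 2 1 1 1 2 2 1 1 2 2 1
    1 1 2 1 2 1 1 1 1 1 2 1 1 1 2 1 2"
| "f4_H Q42 = case_f4_class 1 1 1 1 1 2 2 2 1 1 1 1 1 1 1 0 0 1 2 2 2 2 2 2 2 2 1 1 1 2 2 1 1 2 2 1
    1 1 2 1 2 1 1 1 1 1 2 1 1 1 2 1 2"
| "f4_H Q43 = case_f4_class 1 1 1 1 1 2 2 2 1 1 1 1 1 1 1 0 0 1 2 2 2 2 2 2 2 2 1 1 1 2 2 1 1 2 2 1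
    1 1 2 1 2 1 1 1 1 1 2 1 1 1 2 1 2"
| "f4_H Q44 = case_f4_class 1 1 1 1 1 2 2 2 1 1 1 1 1 1 1 1 0 1 2 2 2 2 2 2 2 2 2 1 1 2 2 2 1 2 2 2
    1 1 2 1 2 2 1 1 2 1 2 1 1 1 2 1 2"
| "f4_H Q45 = case_f4_class 1 1 1 1 1 2 2 2 1 1 1 1 1 1 1 1 1 1 2 2 2 2 2 2 2 2 2 1 1 2 2 2 2 2 2 2
    1 1 2 2 2 2 1 1 2 2 2 1 1 1 2 1 2"
| "f4_H Q46 = case_f4_class 0 0 0 0 0 1 1 1 0 0 0 0 0 0 0 0 0 1 1 1 1 1 1 1 1 1 1 0 0 1 1 1 1 2 1 1
    0 0 1 1 2 1 0 0 1 1 2 0 0 0 1 0 1"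
| "f4_H Q47 = case_f4_class 1 1 1 1 1 2 2 2 1 1 1 1 1 1 1 1 0 1 2 2 2 2 2 2 2 2 2 1 1 2 2 2 1 2 2 2
    1 1 2 1 2 2 1 1 2 1 2 1 1 1 2 1 2"
| "f4_H Q48 = case_f4_class 1 1 1 1 1 2 2 2 1 1 1 1 1 1 1 1 0 1 2 2 2 2 2 2 2 2 2 1 1 2 2 2 1 2 2 2
    1 1 2 1 2 2 1 1 2 1 2 1 1 1 2 1 2"
| "f4_H Q49 = case_f4_class 1 1 1 1 1 2 2 2 1 1 1 1 1 1 1 1 1 1 2 2 2 2 2 2 2 2 2 1 1 2 2 2 2 2 2 2
    1 1 2 2 2 2 1 1 2 2 2 1 1 1 2 1 2"
| "f4_H Q50 = case_f4_class 0 0 0 0 0 1 1 1 0 0 0 0 0 0 0 0 0 1 1 1 1 1 1 1 1 1 1 0 0 1 1 1 1 2 1 1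
    0 0 1 1 2 1 0 0 1 1 2 0 0 0 1 0 1"
| "f4_H Q51 = case_f4_class 1 1 1 1 1 2 2 2 1 1 1 1 1 1 1 1 1 1 2 2 2 2 2 2 2 2 2 1 1 2 2 2 2 2 2 2
    1 1 2 2 2 2 1 1 2 2 2 1 1 1 2 1 2"
| "f4_H Q52 = case_f4_class 0 0 0 0 0 1 1 1 0 0 0 0 0 0 0 0 0 1 1 1 1 1 1 1 1 1 1 0 0 1 1 1 1 2 1 1
    0 0 1 1 2 1 0 0 1 1 2 0 0 0 1 0 1"

definition f4_height :: "f4_class \<Rightarrow> nat" where "f4_height = case_f4_class 14 15 16 15
    16 4 5 6 16 17 17 18 18 19 20 21 22 0 5 6 6 7 7 8 7 8 9 10 11 8 9 10 11 0 9 10 11 12 10 12 1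
    11 12 13 12 13 2 13 14 14 3 15 4"

text \<open>Again there are eight classical components: three with a factor \<open>Q17\<close>, and
  five from the product of the adjoint component with itself.\<close>

definition f4_walks :: "((f4_class \<times> f4_class) \<times> (bool \<times> idx) list) list" where
  "f4_walks = [((Q17, Q17), []), ((Q17, Q33), [(True, I0)]), ((Q33, Q7), [(True, I0), (True, I1),
    (True, I2), (True, I3), (True, I3), (True, I2), (True, I1), (True, I0)]), ((Q33, Q16),
    [(False, I0), (False, I1), (False, I2), (False, I3), (False, I4), (False, I3), (False, I2),
    (False, I3), (False, I1), (False, I2), (False, I3), (False, I4), (False, I4), (False, I3),
    (False, I2), (False, I3), (False, I4), (False, I1), (False, I2), (False, I3), (False, I3),
    (False, I2), (False, I1), (False, I0)]), ((Q33, Q17), [(False, I1), (False, I2), (False, I3),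
    (False, I4), (False, I3), (False, I2), (False, I3), (False, I1), (False, I2), (False, I3),
    (False, I4), (False, I4), (False, I3), (False, I2), (False, I3), (False, I4), (False, I1),
    (False, I2), (False, I3), (False, I3), (False, I2), (False, I1), (False, I0)]), ((Q33, Q32),
    [(True, I0), (True, I1), (True, I2), (True, I3), (True, I4), (True, I3), (True, I4), (True,
    I2), (True, I3), (True, I3), (True, I2), (True, I1), (True, I0)]), ((Q33, Q33), [(False, I1),
    (False, I2), (False, I3), (False, I4), (False, I3), (False, I2), (False, I3), (False, I1),
    (False, I2), (False, I3), (False, I4), (False, I4), (False, I3), (False, I2), (False, I3),
    (False, I4), (False, I1), (False, I2), (False, I3), (False, I3), (False, I2), (True, I0),
    (False, I1), (False, I0)]), ((Q33, Q40), [(True, I0), (True, I1), (True, I0), (True, I1),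
    (True, I2), (True, I3), (True, I4), (True, I3), (True, I4), (True, I2), (True, I3), (True,
    I3), (True, I2), (True, I1), (True, I0)])]"

lemma f4_simps [simp]:
  "colour f4 = f4_colour" "level f4 = f4_level" "cartan f4 = f4_cartan"
  "rests_on f4 = f4_rests_on" "y_empty f4 = f4_y_empty" "y_r f4 = f4_y_r"
  by (simp_all add: f4_def)

lemma set_f4_letters: "set f4_letters = UNIV"
proof -
  have "l \<in> set f4_letters" for l by (cases l) (simp_all add: f4_letters_def)
  then show ?thesis by blast
qed

lemma set_f4_classes: "set f4_classes = UNIV"
proof -
  have "c \<in> set f4_classes" for c by (cases c) (simp_all add: f4_classes_def)
  then show ?thesis by blast
qed

lemma f4_rests_on_eq: "f4_rests_on b = set (block_data.rests f4_rl b)"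
proof (cases b)
  case (Pair l m)
  then show ?thesis by (cases l) (simp_all add: block_data.rests_def)
qed

text \<open>The letters on which nothing of the same index rests are \<open>F_z\<close>,
  \<open>F_b3\<close> and \<open>F_d2\<close>; they are covered by \<open>F_a1\<close> or
  \<open>F_c1\<close> of the next index.\<close>

lemma f4_letter_ok: "distinct f4_letters"
  "list_all (block_data.letter_ok f4_level f4_rl [F_a1, F_c1] f4_letters) f4_letters"
  "block_data.null_ok f4_colour f4_cartan f4_letters"
  "block_data.anchor_ok f4_rl F_c4 f4_base f4_cand f4_letters"
  by code_simp+

lemma f4_columns_ok:
  "class_data.columns_ok f4_colour f4_level f4_rl f4_window f4_rep f4_f f4_e f4_phi f4_eps
     f4_r Q17 f4_cartan F_c4 [F_a1, F_c1] f4_base f4_cand f4_classes"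
  by code_simp

lemma f4_energies_ok:
  "class_data.energies_ok f4_colour f4_window f4_rep f4_f f4_e f4_phi f4_eps Q17 f4_H
     f4_height f4_classes f4_walks"
  by code_simp

lemma set_f4_window: "set f4_window = {b. snd b = -1 \<or> snd b = 0 \<or> snd b = 1}"
  using set_f4_letters unfolding f4_window_def by (force simp: prod_eq_iff)

lemma f4_y_r_eq:
  "f4_y_r j = map_option (\<lambda>c. sigma_pow 1 (block_data.list_col (f4_rep c))) (f4_r j)"
proof (cases j)
  case I0
  then show ?thesis by (simp add: f4_r_def)
next
  case I1
  have "(l, m) \<in> the (f4_y_r I1) \<longleftrightarrow>
      (l, m - 1) \<in> block_data.list_col (f4_rep Q32)" for l m
    by (cases l) (auto simp: f4_D_def block_data.list_col_def f4_base_def)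
  then have "the (f4_y_r I1) = sigma_pow 1 (block_data.list_col (f4_rep Q32))"
    by (rule eq_sigma_pow_1)
  then show ?thesis using I1 by (simp add: f4_r_def)
next
  case I2
  have "(l, m) \<in> the (f4_y_r I2) \<longleftrightarrow>
      (l, m - 1) \<in> block_data.list_col (f4_rep Q41)" for l m
    by (cases l) (auto simp: f4_D_def block_data.list_col_def f4_base_def)
  then have "the (f4_y_r I2) = sigma_pow 1 (block_data.list_col (f4_rep Q41))"
    by (rule eq_sigma_pow_1)
  then show ?thesis using I2 by (simp add: f4_r_def)
next
  case I3
  have "(l, m) \<in> the (f4_y_r I3) \<longleftrightarrow>
      (l, m - 1) \<in> block_data.list_col (f4_rep Q36)" for l m
    by (cases l) (auto simp: f4_D_def block_data.list_col_def f4_base_def)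
  then have "the (f4_y_r I3) = sigma_pow 1 (block_data.list_col (f4_rep Q36))"
    by (rule eq_sigma_pow_1)
  then show ?thesis using I3 by (simp add: f4_r_def)
next
  case I4
  have "(l, m) \<in> the (f4_y_r I4) \<longleftrightarrow>
      (l, m - 1) \<in> block_data.list_col (f4_rep Q28)" for l m
    by (cases l) (auto simp: f4_D_def block_data.list_col_def f4_base_def)
  then have "the (f4_y_r I4) = sigma_pow 1 (block_data.list_col (f4_rep Q28))"
    by (rule eq_sigma_pow_1)
  then show ?thesis using I4 by (simp add: f4_r_def)
qed

lemma f4_y_empty_eq: "f4_y_empty = sigma_pow 1 (block_data.list_col (f4_rep Q17))"
proof (rule eq_sigma_pow_1)
  fix l m
  show "(l, m) \<in> f4_y_empty \<longleftrightarrow>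
      (l, m - 1) \<in> block_data.list_col (f4_rep Q17)"
    by (cases l) (auto simp: f4_y_empty_def f4_D_def block_data.list_col_def f4_base_def)
qed

interpretation f4: column_model f4 f4_rl "[F_a1, F_c1]" f4_letters f4_window f4_rep f4_f f4_e
  f4_phi f4_eps f4_r Q17 f4_H F_c4 f4_base f4_cand f4_classes f4_height f4_walks
  by (unfold_locales; (unfold f4_simps)?;
    fact f4_rests_on_eq set_f4_letters f4_letter_ok set_f4_classes set_f4_window
      f4_y_r_eq f4_y_empty_eq
      f4_columns_ok f4_energies_ok)

theorem theorem4p8:
  fixes lam :: weight
  assumes "lam = Lambda I0"
  shows "(\<forall>g \<in> cls e6 (y_empty e6).
            affine_crystal (cartan e6) (reduced_walls e6 g) (wall_wt e6 lam g)
              (wall_e e6) (wall_f e6) (wall_eps e6) (wall_phi e6)) \<and>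
         (\<forall>g \<in> cls f4 (y_empty f4).
            affine_crystal (cartan f4) (reduced_walls f4 g) (wall_wt f4 lam g)
              (wall_e f4) (wall_f f4) (wall_eps f4) (wall_phi f4))"
  using assms e6.affine_crystal_reduced f4.affine_crystal_reduced by blast

end
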